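(* Let $m\ge1$. The elements $\mathbf{P}_\tau=\sum_{\alpha\equiv_{ms}\tau}\mathbf{F}_\alpha$, for $\tau$ running over decreasing $(m+1)$-ary trees, span a Hopf subalgebra ${}^m\mathcal{DT}$ of ${}^m\mathbf{FQSym}$. The dual Hopf algebra ${}^m\mathcal{DT}^*$ is the metasylvester quotient ${}^m\mathbf{FQSym}^*/{\equiv_{ms}}$, based on the equivalence classes $\mathbf{Q}_\tau=\overline{\mathbf{G}_\alpha}$ ($\alpha\equiv_{ms}\tau$).
   Context: $\mathbb{K}$ is a field of characteristic $0$; duals are graded duals. $\mathfrak{S}_n^{(m)}$ is the set of $m$-permutations of $n$: words over $\{1,\dots,n\}$ in which each letter occurs exactly $m$ times. An $m$-word is a word in which the number of occurrences of each letter is a multiple of $m$. The $m$-standardization $\mathrm{std}_m(w)$ of an $m$-word $w$ is obtained by iteratively scanning $w$ from left to right, labelling $1$ the first $m$ occurrences of the smallest letter, then $2$ the next $m$ occurrences of this letter or, if there are none left, the first $m$ occurrences of the next letter, and so on. ${}^m\mathbf{FQSym}$ is the graded Hopf algebra with basis $\mathbf{F}_\alpha$, $\alpha\in\mathfrak{S}_n^{(m)}$ (degree $n$), $n\ge0$, with product $\mathbf{F}_\alpha\mathbf{F}_\beta=\sum_{\gamma\in\alpha\Cup\beta}\mathbf{F}_\gamma$, where for $\alpha\in\mathfrak{S}_n^{(m)}$, $\alpha\Cup\beta$ is the shuffle of $\alpha$ with the word $\beta[n]$ obtained from $\beta$ by adding $n$ to each letter, and coproduct $\Delta\mathbf{F}_\alpha=\sum\mathbf{F}_{\mathrm{std}_m(u)}\otimes\mathbf{F}_{\mathrm{std}_m(v)}$,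 sum over all factorizations $\alpha=u\cdot v$ with $u,v$ both $m$-words. $\mathbf{G}_\alpha$ denotes the dual basis of $\mathbf{F}_\alpha$ in ${}^m\mathbf{FQSym}^*$. The metasylvester congruence $\equiv_{ms}$ is generated by $ab\,y\,a\equiv ba\,y\,a$ for letters $a<b$, and $b\,y\,ac\,z\,b\equiv b\,y\,ca\,z\,b$ for letters $a<b<c$ ($y,z$ arbitrary words). A decreasing $(m+1)$-ary tree is an $m$-permutation $\tau$ of $n$ which is either the empty word or of the form $u_1nu_2n\cdots nu_{m+1}$ where the packed words of $u_1,\dots,u_{m+1}$ are decreasing $(m+1)$-ary trees (the packed word of $u$ is its image under the increasing bijection from its set of letters onto $\{1,\dots,r\}$); equivalently, an $m$-permutation avoiding the pattern $a\cdots b\cdots a$ with $a<b$. Each metasylvester class of $m$-permutations contains exactly one such $\tau$. The quotient ${}^m\mathbf{FQSym}^*/{\equiv_{ms}}$ is by the relations $\mathbf{G}_\alpha=\mathbf{G}_\beta$ for $\alpha\equiv_{ms}\beta$, and $\overline{\mathbf{G}_\alpha}$ is the class of $\mathbf{G}_\alpha$. *)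

theory Defs
  imports
    "HOL-Library.Poly_Mapping"
    "HOL-Algebra.Algebraic_Closure_Type"
    "HOL-Algebra.QuotRing"
    "HOL-Algebra.Subrings"
    "HOL-Algebra.Module"
begin

section \<open>Free vector spaces\<close>

text \<open>The vector space with basis \<open>B\<close> is realised by the finitely supported functions with
  support in \<open>B\<close>; the basis vector of \<open>x\<close> is \<open>Poly_Mapping.single x 1\<close>.\<close>

definition pscale :: "'k::field \<Rightarrow> ('a \<Rightarrow>\<^sub>0 'k) \<Rightarrow> ('a \<Rightarrow>\<^sub>0 'k)"
  where "pscale c t = Poly_Mapping.map ((*) c) t"

lemma lookup_pscale [simp]: "Poly_Mapping.lookup (pscale c t) a = c * Poly_Mapping.lookup t a"
  by (simp add: pscale_def Poly_Mapping.map.rep_eq when_def)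

global_interpretation free: vector_space "pscale :: 'k::field \<Rightarrow> ('a \<Rightarrow>\<^sub>0 'k) \<Rightarrow> ('a \<Rightarrow>\<^sub>0 'k)"
  by unfold_locales (rule poly_mapping_eqI, simp add: lookup_add algebra_simps)+

definition lin_ext :: "('a \<Rightarrow> ('b \<Rightarrow>\<^sub>0 'k)) \<Rightarrow> ('a \<Rightarrow>\<^sub>0 'k) \<Rightarrow> ('b \<Rightarrow>\<^sub>0 'k::field)"
  where "lin_ext f t = (\<Sum>a\<in>Poly_Mapping.keys t. pscale (Poly_Mapping.lookup t a) (f a))"


section \<open>Hopf algebras over a field\<close>

text \<open>The scalars are a type \<open>'k\<close> of class \<^class>\<open>Fields.field\<close>, viewed as a ring record through
  \<^const>\<open>ring_of_type_algebra\<close>.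

  The tensor square of a space \<open>H\<close> is the quotient of the free vector space on
  \<open>carrier H \<times> carrier H\<close> by the bilinearity relations. A coproduct is given by a representative
  in the free space, so all identities between coproducts are stated modulo \<open>tensor_eq H\<close> (or
  \<open>tensor3_eq H\<close> in the tensor cube).\<close>

record (overloaded) ('k::zero, 'a) hopf = "('k, 'a) module" +
  counit :: "'a \<Rightarrow> 'k"
  comult :: "'a \<Rightarrow> ('a \<times> 'a \<Rightarrow>\<^sub>0 'k)"
  grade :: "nat \<Rightarrow> 'a set"

abbreviation tens :: "'a \<Rightarrow> 'b \<Rightarrow> ('a \<times> 'b \<Rightarrow>\<^sub>0 'k::field)"
  where "tens a b \<equiv> Poly_Mapping.single (a, b) 1"

abbreviation tens3 :: "'a \<Rightarrow> 'b \<Rightarrow> 'c \<Rightarrow> ('a \<times> 'b \<times> 'c \<Rightarrow>\<^sub>0 'k::field)"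
  where "tens3 a b c \<equiv> Poly_Mapping.single (a, b, c) 1"

definition tensor_rel :: "('k::field, 'a) hopf \<Rightarrow> ('a \<times> 'a \<Rightarrow>\<^sub>0 'k) set"
  where "tensor_rel H =
    {tens (a \<oplus>\<^bsub>H\<^esub> a') b - tens a b - tens a' b | a a' b.
       a \<in> carrier H \<and> a' \<in> carrier H \<and> b \<in> carrier H} \<union>
    {tens a (b \<oplus>\<^bsub>H\<^esub> b') - tens a b - tens a b' | a b b'.
       a \<in> carrier H \<and> b \<in> carrier H \<and> b' \<in> carrier H} \<union>
    {tens (r \<odot>\<^bsub>H\<^esub> a) b - pscale r (tens a b) | r a b. a \<in> carrier H \<and> b \<in> carrier H} \<union>
    {tens a (r \<odot>\<^bsub>H\<^esub> b) - pscale r (tens a b) | r a b. a \<in> carrier H \<and> b \<in> carrier H}"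

definition tensor_eq ::
    "('k::field, 'a) hopf \<Rightarrow> ('a \<times> 'a \<Rightarrow>\<^sub>0 'k) \<Rightarrow> ('a \<times> 'a \<Rightarrow>\<^sub>0 'k) \<Rightarrow> bool"
  where "tensor_eq H s t \<longleftrightarrow> s - t \<in> free.span (tensor_rel H)"

definition tensor3_rel :: "('k::field, 'a) hopf \<Rightarrow> ('a \<times> 'a \<times> 'a \<Rightarrow>\<^sub>0 'k) set"
  where "tensor3_rel H =
    {lin_ext (\<lambda>(a, b). tens3 a b c) t | t c. t \<in> tensor_rel H \<and> c \<in> carrier H} \<union>
    {lin_ext (\<lambda>(b, c). tens3 a b c) t | t a. t \<in> tensor_rel H \<and> a \<in> carrier H}"

definition tensor3_eq ::
    "('k::field, 'a) hopf \<Rightarrow> ('a \<times> 'a \<times> 'a \<Rightarrow>\<^sub>0 'k) \<Rightarrow> ('a \<times> 'a \<times> 'a \<Rightarrow>\<^sub>0 'k) \<Rightarrow> bool"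
  where "tensor3_eq H s t \<longleftrightarrow> s - t \<in> free.span (tensor3_rel H)"

definition leval :: "('k::zero, 'b) hopf \<Rightarrow> ('a \<Rightarrow> 'b) \<Rightarrow> ('a \<Rightarrow>\<^sub>0 'k) \<Rightarrow> 'b"
  where "leval H f t =
    (\<Oplus>\<^bsub>H\<^esub>a\<in>Poly_Mapping.keys t. Poly_Mapping.lookup t a \<odot>\<^bsub>H\<^esub> f a)"

definition linear_on :: "('k::zero, 'a) hopf \<Rightarrow> ('k, 'b) hopf \<Rightarrow> ('a \<Rightarrow> 'b) \<Rightarrow> bool"
  where "linear_on H H' f \<longleftrightarrow>
    f \<in> carrier H \<rightarrow> carrier H' \<and>
    (\<forall>x\<in>carrier H. \<forall>y\<in>carrier H. f (x \<oplus>\<^bsub>H\<^esub> y) = f x \<oplus>\<^bsub>H'\<^esub> f y) \<and>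
    (\<forall>r. \<forall>x\<in>carrier H. f (r \<odot>\<^bsub>H\<^esub> x) = r \<odot>\<^bsub>H'\<^esub> f x)"

definition functional_on :: "('k::field, 'a) hopf \<Rightarrow> ('a \<Rightarrow> 'k) \<Rightarrow> bool"
  where "functional_on H \<phi> \<longleftrightarrow>
    (\<forall>x\<in>carrier H. \<forall>y\<in>carrier H. \<phi> (x \<oplus>\<^bsub>H\<^esub> y) = \<phi> x + \<phi> y) \<and>
    (\<forall>r. \<forall>x\<in>carrier H. \<phi> (r \<odot>\<^bsub>H\<^esub> x) = r * \<phi> x)"

definition unital_algebra :: "('k::field, 'a) hopf \<Rightarrow> bool"
  where "unital_algebra H \<longleftrightarrow>
    Module.module ring_of_type_algebra H \<and> ring H \<and>
    (\<forall>r. \<forall>x\<in>carrier H. \<forall>y\<in>carrier H.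
       (r \<odot>\<^bsub>H\<^esub> x) \<otimes>\<^bsub>H\<^esub> y = r \<odot>\<^bsub>H\<^esub> (x \<otimes>\<^bsub>H\<^esub> y) \<and>
       x \<otimes>\<^bsub>H\<^esub> (r \<odot>\<^bsub>H\<^esub> y) = r \<odot>\<^bsub>H\<^esub> (x \<otimes>\<^bsub>H\<^esub> y))"

definition counital_coalgebra :: "('k::field, 'a) hopf \<Rightarrow> bool"
  where "counital_coalgebra H \<longleftrightarrow>
    (\<forall>x\<in>carrier H. Poly_Mapping.keys (comult H x) \<subseteq> carrier H \<times> carrier H) \<and>
    (\<forall>x\<in>carrier H. \<forall>y\<in>carrier H.
       tensor_eq H (comult H (x \<oplus>\<^bsub>H\<^esub> y)) (comult H x + comult H y)) \<and>
    (\<forall>r. \<forall>x\<in>carrier H. tensor_eq H (comult H (r \<odot>\<^bsub>H\<^esub> x)) (pscale r (comult H x))) \<and>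
    functional_on H (counit H) \<and>
    (\<forall>x\<in>carrier H. tensor3_eq H
       (lin_ext (\<lambda>(a, c). lin_ext (\<lambda>(a', b). tens3 a' b c) (comult H a)) (comult H x))
       (lin_ext (\<lambda>(a, c). lin_ext (\<lambda>(b, c'). tens3 a b c') (comult H c)) (comult H x))) \<and>
    (\<forall>x\<in>carrier H. leval H (\<lambda>(a, b). counit H a \<odot>\<^bsub>H\<^esub> b) (comult H x) = x \<and>
                  leval H (\<lambda>(a, b). counit H b \<odot>\<^bsub>H\<^esub> a) (comult H x) = x)"

definition bialgebra :: "('k::field, 'a) hopf \<Rightarrow> bool"
  where "bialgebra H \<longleftrightarrow>
    unital_algebra H \<and> counital_coalgebra H \<and>
    (\<forall>x\<in>carrier H. \<forall>y\<in>carrier H.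
       counit H (x \<otimes>\<^bsub>H\<^esub> y) = counit H x * counit H y) \<and>
    counit H \<one>\<^bsub>H\<^esub> = 1 \<and>
    (\<forall>x\<in>carrier H. \<forall>y\<in>carrier H. tensor_eq H (comult H (x \<otimes>\<^bsub>H\<^esub> y))
       (lin_ext (\<lambda>(a, b). lin_ext (\<lambda>(c, d). tens (a \<otimes>\<^bsub>H\<^esub> c) (b \<otimes>\<^bsub>H\<^esub> d)) (comult H y))
         (comult H x))) \<and>
    tensor_eq H (comult H \<one>\<^bsub>H\<^esub>) (tens \<one>\<^bsub>H\<^esub> \<one>\<^bsub>H\<^esub>)"

definition is_antipode :: "('k::field, 'a) hopf \<Rightarrow> ('a \<Rightarrow> 'a) \<Rightarrow> bool"
  where "is_antipode H S \<longleftrightarrow>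
    linear_on H H S \<and>
    (\<forall>x\<in>carrier H.
       leval H (\<lambda>(a, b). S a \<otimes>\<^bsub>H\<^esub> b) (comult H x) = counit H x \<odot>\<^bsub>H\<^esub> \<one>\<^bsub>H\<^esub> \<and>
       leval H (\<lambda>(a, b). a \<otimes>\<^bsub>H\<^esub> S b) (comult H x) = counit H x \<odot>\<^bsub>H\<^esub> \<one>\<^bsub>H\<^esub>)"

definition hopf_algebra :: "('k::field, 'a) hopf \<Rightarrow> bool"
  where "hopf_algebra H \<longleftrightarrow> bialgebra H \<and> (\<exists>S. is_antipode H S)"

definition hopf_subalgebra :: "'a set \<Rightarrow> ('k::field, 'a) hopf \<Rightarrow> bool"
  where "hopf_subalgebra D H \<longleftrightarrow>
    hopf_algebra H \<and> submodule D ring_of_type_algebra H \<and> subring D H \<and>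
    (\<forall>x\<in>D. \<exists>t. Poly_Mapping.keys t \<subseteq> D \<times> D \<and> tensor_eq H (comult H x) t) \<and>
    (\<exists>S. is_antipode H S \<and> S ` D \<subseteq> D)"

text \<open>The coproduct of \<open>D\<close> needs representatives with support in \<open>D \<times> D\<close>.\<close>

definition sub_hopf :: "('k::field, 'a) hopf \<Rightarrow> 'a set \<Rightarrow> ('k, 'a) hopf"
  where "sub_hopf H D = H\<lparr>
    carrier := D,
    comult := (\<lambda>x. SOME t. Poly_Mapping.keys t \<subseteq> D \<times> D \<and> tensor_eq H (comult H x) t),
    grade := (\<lambda>n. grade H n \<inter> D)\<rparr>"

definition hopf_ideal :: "'a set \<Rightarrow> ('k::field, 'a) hopf \<Rightarrow> bool"
  where "hopf_ideal I H \<longleftrightarrow>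
    hopf_algebra H \<and> submodule I ring_of_type_algebra H \<and> ideal I H \<and>
    (\<forall>x\<in>I. \<exists>t. Poly_Mapping.keys t \<subseteq> I \<times> carrier H \<union> carrier H \<times> I \<and>
                tensor_eq H (comult H x) t) \<and>
    (\<forall>x\<in>I. counit H x = 0) \<and>
    (\<exists>S. is_antipode H S \<and> S ` I \<subseteq> I)"

text \<open>The elements of the quotient are the cosets of \<open>I\<close>; counit and coproduct are computed on an
  arbitrary element of the coset.\<close>

definition quot_hopf :: "('k::field, 'a) hopf \<Rightarrow> 'a set \<Rightarrow> ('k, 'a set) hopf"
  where "quot_hopf H I = \<lparr>
    carrier = carrier (H Quot I),
    monoid.mult = monoid.mult (H Quot I),
    one = one (H Quot I),
    ring.zero = ring.zero (H Quot I),
    add = add (H Quot I),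
    module.smult = (\<lambda>r A. \<Union>x\<in>A. I +>\<^bsub>H\<^esub> (r \<odot>\<^bsub>H\<^esub> x)),
    counit = (\<lambda>A. counit H (SOME x. x \<in> A)),
    comult = (\<lambda>A. lin_ext (\<lambda>(a, b). tens (I +>\<^bsub>H\<^esub> a) (I +>\<^bsub>H\<^esub> b)) (comult H (SOME x. x \<in> A))),
    grade = (\<lambda>n. (\<lambda>x. I +>\<^bsub>H\<^esub> x) ` grade H n)\<rparr>"

text \<open>Functionals on \<open>H\<close> are normalised to be \<open>0\<close> outside \<open>carrier H\<close>, so that equality of elements
  of the dual is equality of functions. The product and coproduct are the transposes of the
  coproduct and product: \<open>(\<phi>\<psi>)(x) = (\<phi> \<otimes> \<psi>)(\<Delta> x)\<close> and \<open>(\<Delta> \<phi>)(x \<otimes> y) = \<phi>(x y)\<close>.\<close>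

definition graded_dual :: "('k::field, 'a) hopf \<Rightarrow> ('k, 'a \<Rightarrow> 'k) hopf"
  where "graded_dual H = (let
      C = {\<phi>. functional_on H \<phi> \<and> (\<forall>x. x \<notin> carrier H \<longrightarrow> \<phi> x = 0) \<and>
              finite {n. \<exists>x\<in>grade H n. \<phi> x \<noteq> 0}}
    in \<lparr>
      carrier = C,
      monoid.mult = (\<lambda>\<phi> \<psi> x. if x \<in> carrier H
        then \<Sum>(a, b)\<in>Poly_Mapping.keys (comult H x).
               Poly_Mapping.lookup (comult H x) (a, b) * (\<phi> a * \<psi> b)
        else 0),
      one = (\<lambda>x. if x \<in> carrier H then counit H x else 0),
      ring.zero = (\<lambda>x. 0),
      add = (\<lambda>\<phi> \<psi> x. \<phi> x + \<psi> x),
      module.smult = (\<lambda>r \<phi> x. r * \<phi> x),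
      counit = (\<lambda>\<phi>. \<phi> \<one>\<^bsub>H\<^esub>),
      comult = (\<lambda>\<phi>. SOME t. Poly_Mapping.keys t \<subseteq> C \<times> C \<and>
        (\<forall>x\<in>carrier H. \<forall>y\<in>carrier H.
           (\<Sum>(f, g)\<in>Poly_Mapping.keys t. Poly_Mapping.lookup t (f, g) * (f x * g y)) =
           \<phi> (x \<otimes>\<^bsub>H\<^esub> y))),
      grade = (\<lambda>n. {\<phi> \<in> C. \<forall>k. k \<noteq> n \<longrightarrow> (\<forall>x\<in>grade H k. \<phi> x = 0)})\<rparr>)"

definition graded_hopf_iso :: "('k::field, 'a) hopf \<Rightarrow> ('k, 'b) hopf \<Rightarrow> ('a \<Rightarrow> 'b) \<Rightarrow> bool"
  where "graded_hopf_iso H H' f \<longleftrightarrow>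
    bij_betw f (carrier H) (carrier H') \<and> linear_on H H' f \<and>
    (\<forall>x\<in>carrier H. \<forall>y\<in>carrier H. f (x \<otimes>\<^bsub>H\<^esub> y) = f x \<otimes>\<^bsub>H'\<^esub> f y) \<and>
    f \<one>\<^bsub>H\<^esub> = \<one>\<^bsub>H'\<^esub> \<and>
    (\<forall>x\<in>carrier H. counit H' (f x) = counit H x) \<and>
    (\<forall>x\<in>carrier H. tensor_eq H' (comult H' (f x))
       (lin_ext (\<lambda>(a, b). tens (f a) (f b)) (comult H x))) \<and>
    (\<forall>n. f ` grade H n = grade H' n)"

definition is_basis :: "('k::field, 'a) hopf \<Rightarrow> 'a set \<Rightarrow> bool"
  where "is_basis H B \<longleftrightarrow> B \<subseteq> carrier H \<and>
    (\<forall>x\<in>carrier H. \<exists>!c. Poly_Mapping.keys c \<subseteq> B \<and> leval H (\<lambda>b. b) c = x)"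


section \<open>Words\<close>

definition mperms :: "nat \<Rightarrow> nat \<Rightarrow> nat list set"
  where "mperms m n = {w. set w \<subseteq> {1..n} \<and> (\<forall>i\<in>{1..n}. count_list w i = m)}"

definition all_mperms :: "nat \<Rightarrow> nat list set"
  where "all_mperms m = (\<Union>n. mperms m n)"

definition mword :: "nat \<Rightarrow> nat list \<Rightarrow> bool"
  where "mword m w \<longleftrightarrow> (\<forall>a. m dvd count_list w a)"

text \<open>The scans visit the positions of an \<open>m\<close>-word ordered by letter and then from left to right,
  and change the label after every \<open>m\<close> positions.\<close>

definition mstd :: "nat \<Rightarrow> nat list \<Rightarrow> nat list"
  where "mstd m w = map (\<lambda>i. Suc (card {j. j < length w \<and>
      (w ! j < w ! i \<or> (w ! j = w ! i \<and> j < i))} div m)) [0..<length w]"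

text \<open>An \<open>m\<close>-permutation \<open>\<alpha>\<close> of \<open>n\<close> has letters \<open>1, \<dots>, n\<close>, so \<open>card (set \<alpha>)\<close> is \<open>n\<close>. The letters of
  the two shuffled words are disjoint, so the set of shuffles has no multiplicities.\<close>

definition shifted_shuffle :: "nat list \<Rightarrow> nat list \<Rightarrow> nat list set"
  where "shifted_shuffle \<alpha> \<beta> = shuffles \<alpha> (map (\<lambda>i. i + card (set \<alpha>)) \<beta>)"

definition pack :: "nat list \<Rightarrow> nat list"
  where "pack u = map (\<lambda>a. card {b \<in> set u. b \<le> a}) u"

inductive metasylv :: "nat list \<Rightarrow> nat list \<Rightarrow> bool"  (infix \<open>\<equiv>ms\<close> 50)
  where
    refl: "u \<equiv>ms u"
  | sym: "u \<equiv>ms v \<Longrightarrow> v \<equiv>ms u"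
  | trans: "u \<equiv>ms v \<Longrightarrow> v \<equiv>ms w \<Longrightarrow> u \<equiv>ms w"
  | cong: "u \<equiv>ms v \<Longrightarrow> x @ u @ y \<equiv>ms x @ v @ y"
  | rule1: "a < b \<Longrightarrow> [a, b] @ y @ [a] \<equiv>ms [b, a] @ y @ [a]"
  | rule2: "a < b \<Longrightarrow> b < c \<Longrightarrow> [b] @ y @ [a, c] @ z @ [b] \<equiv>ms [b] @ y @ [c, a] @ z @ [b]"

text \<open>The list \<open>us\<close> consists of the \<open>m + 1\<close> factors between the occurrences of \<open>n\<close>.\<close>

inductive dec_tree :: "nat \<Rightarrow> nat list \<Rightarrow> bool"
  for m :: nat
  where
    Nil: "dec_tree m []"
  | node: "hd us @ concat (map (\<lambda>u. n # u) (tl us)) \<in> mperms m n \<Longrightarrow>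
      length us = Suc m \<Longrightarrow> \<forall>u\<in>set us. dec_tree m (pack u) \<Longrightarrow>
      dec_tree m (hd us @ concat (map (\<lambda>u. n # u) (tl us)))"


section \<open>The Hopf algebra of \<open>m\<close>-permutations and the metasylvester quotient of its dual\<close>

abbreviation F :: "nat list \<Rightarrow> (nat list \<Rightarrow>\<^sub>0 'k::field_char_0)"
  where "F \<alpha> \<equiv> Poly_Mapping.single \<alpha> 1"

definition FQSym :: "nat \<Rightarrow> ('k::field_char_0, nat list \<Rightarrow>\<^sub>0 'k) hopf"
  where "FQSym m = \<lparr>
    carrier = {x. Poly_Mapping.keys x \<subseteq> all_mperms m},
    monoid.mult = (\<lambda>x y.
      lin_ext (\<lambda>\<alpha>. lin_ext (\<lambda>\<beta>. \<Sum>\<gamma>\<in>shifted_shuffle \<alpha> \<beta>. F \<gamma>) y) x),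
    one = F [],
    ring.zero = 0,
    add = (+),
    module.smult = pscale,
    counit = (\<lambda>x. Poly_Mapping.lookup x []),
    comult = lin_ext (\<lambda>\<alpha>. \<Sum>(u, v)\<in>{(u, v). \<alpha> = u @ v \<and> mword m u \<and> mword m v}.
      tens (F (mstd m u)) (F (mstd m v))),
    grade = (\<lambda>n. {x. Poly_Mapping.keys x \<subseteq> mperms m n})\<rparr>"

definition G :: "nat \<Rightarrow> nat list \<Rightarrow> (nat list \<Rightarrow>\<^sub>0 'k::field_char_0) \<Rightarrow> 'k"
  where "G m \<alpha> = (\<lambda>x. if x \<in> carrier (FQSym m) then Poly_Mapping.lookup x \<alpha> else 0)"

definition P :: "nat list \<Rightarrow> (nat list \<Rightarrow>\<^sub>0 'k::field_char_0)"
  where "P \<tau> = (\<Sum>\<alpha>\<in>{\<alpha>. \<alpha> \<equiv>ms \<tau>}. F \<alpha>)"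

definition DT :: "nat \<Rightarrow> (nat list \<Rightarrow>\<^sub>0 'k::field_char_0) set"
  where "DT m = free.span (P ` {\<tau>. dec_tree m \<tau>})"

text \<open>The two-sided ideal generated by the relations \<open>G \<alpha> = G \<beta>\<close>.\<close>

definition ms_ideal :: "nat \<Rightarrow> ((nat list \<Rightarrow>\<^sub>0 'k::field_char_0) \<Rightarrow> 'k) set"
  where "ms_ideal m = Idl\<^bsub>graded_dual (FQSym m)\<^esub>
    {G m \<alpha> \<ominus>\<^bsub>graded_dual (FQSym m)\<^esub> G m \<beta> | \<alpha> \<beta>.
       \<alpha> \<in> all_mperms m \<and> \<beta> \<in> all_mperms m \<and> \<alpha> \<equiv>ms \<beta>}"

definition ms_quotient ::
    "nat \<Rightarrow> ('k::field_char_0, ((nat list \<Rightarrow>\<^sub>0 'k) \<Rightarrow> 'k) set) hopf"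
  where "ms_quotient m = quot_hopf (graded_dual (FQSym m)) (ms_ideal m)"

definition G_class :: "nat \<Rightarrow> nat list \<Rightarrow> ((nat list \<Rightarrow>\<^sub>0 'k::field_char_0) \<Rightarrow> 'k) set"
  where "G_class m \<alpha> = ms_ideal m +>\<^bsub>graded_dual (FQSym m)\<^esub> G m \<alpha>"

definition DT_dual :: "nat \<Rightarrow> ('k::field_char_0, (nat list \<Rightarrow>\<^sub>0 'k) \<Rightarrow> 'k) hopf"
  where "DT_dual m = graded_dual (sub_hopf (FQSym m) (DT m))"

end

theory Submission
  imports Defs "HOL-Library.Confluence"
begin

text \<open>The metasylvester relations rewrite a factor \<open>a b\<close> with \<open>a < b\<close> into \<open>b a\<close>, provided that \<open>a\<close> occurs
  again to the right or that some letter strictly between \<open>a\<close> and \<open>b\<close> occurs on both sides. This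
  rewriting terminates and is locally confluent, so every class has exactly one irreducible word; the
  irreducible \<open>m\<close>-permutations are those avoiding \<open>a\<dots>b\<dots>a\<close> with \<open>a < b\<close>, that is, the decreasing trees.
  Hence the span of the \<open>P \<tau>\<close> consists of the elements whose coefficients are constant on classes. It is
  closed under the product because the congruence restricts to intervals of letters, and under the
  coproduct because the congruence is invariant under increasing relabellings and concatenation.

  The antipode is the geometric series \<open>\<Sum>k. (- 1) ^ k (id - \<eta>\<epsilon>)\<^sup>*\<^sup>k\<close>, which preserves every
  subspace closed under product and coproduct. All identities in the graded dual are read off by
  evaluating functionals. The ideal generated by the differences \<open>G \<alpha> - G \<beta>\<close> is the annihilator of the
  span of the \<open>P \<tau>\<close>, and restriction of functionals identifies the quotient with the dual of that
  span; the inverse is the transpose of the projection that keeps \<open>F \<tau>\<close>, replaced by \<open>P \<tau>\<close>, for the trees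
  \<open>\<tau>\<close> and kills the other \<open>F \<alpha>\<close>.\<close>

text \<open>The obstacle is that coproducts are representatives in a free space on pairs of vectors:
  equality in a tensor power is membership in the span of the bilinearity relations, and the
  representatives in the dual and in the subalgebra are picked by \<open>SOME\<close>. Two devices
  remove it. Bilinear maps agree on equivalent representatives, so anything built from a coproduct
  may use a convenient one, homogeneous or supported in the subspace. Conversely, expansion over a
  family of vectors shows that representatives with equal coefficients are equivalent; for
  functionals these coefficients are values on pairs of basis vectors.

  The projection onto the span of the \<open>P \<tau>\<close> has to preserve degrees: composed with
  it, a functional on the subalgebra still vanishes in large degrees and so extends to an element of
  the full graded dual.

  For local confluence the one critical overlap is a factor a b c with a < b < c, both of whose
  reductions meet at c b a.

  The condition m \<ge> 1 makes the degree of an m-permutation readable as its number of distinct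
  letters.\<close>

abbreviation keys :: "('a \<Rightarrow>\<^sub>0 'b::zero) \<Rightarrow> 'a set" where "keys \<equiv> Poly_Mapping.keys"
abbreviation lookup :: "('a \<Rightarrow>\<^sub>0 'b::zero) \<Rightarrow> 'a \<Rightarrow> 'b" where "lookup \<equiv> Poly_Mapping.lookup"
abbreviation single :: "'a \<Rightarrow> 'b::zero \<Rightarrow> 'a \<Rightarrow>\<^sub>0 'b" where "single \<equiv> Poly_Mapping.single"

section \<open>Linear extension\<close>

text \<open>Scalar companion of \<open>lin_ext\<close>. Identities between vectors of a free space
  are reduced to it one coordinate at a time through \<open>lookup_lin_ext\<close>.\<close>

definition lsum :: "('a \<Rightarrow> 'k) \<Rightarrow> ('a \<Rightarrow>\<^sub>0 'k) \<Rightarrow> 'k::field"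
  where "lsum f t = (\<Sum>a\<in>keys t. lookup t a * f a)"

text \<open>Padding with zero coefficients puts combinations with different supports over one index
  set.\<close>

lemma lsum_superset:
  assumes "finite A" "keys t \<subseteq> A"
  shows "lsum f t = (\<Sum>a\<in>A. lookup t a * f a)"
  unfolding lsum_def using assms by (intro sum.mono_neutral_left) (auto simp: in_keys_iff)

lemma lsum_zero [simp]: "lsum f 0 = 0"
  by (simp add: lsum_def)

lemma lsum_single [simp]: "lsum f (single a c) = c * f a"
  by (simp add: lsum_def)

lemma lsum_add: "lsum f (s + t) = lsum f s + lsum f t"
proof -
  let ?A = "keys s \<union> keys t"
  have "keys (s + t) \<subseteq> ?A" by (rule Poly_Mapping.keys_add)
  then show ?thesis
    by (simp add: lsum_superset[of ?A] lookup_add algebra_simps sum.distrib)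
qed

lemma lsum_pscale [simp]: "lsum f (pscale c t) = c * lsum f t"
proof -
  have "keys (pscale c t) \<subseteq> keys t" by (auto simp: in_keys_iff)
  then show ?thesis
    by (simp add: lsum_superset[of "keys t"] sum_distrib_left mult.assoc)
qed

lemma lsum_diff: "lsum f (s - t) = lsum f s - lsum f (t :: 'a \<Rightarrow>\<^sub>0 'k::field)"
  using lsum_add[of f "s - t" t] by simp

lemma lsum_sum: "lsum f (sum t A) = (\<Sum>i\<in>A. lsum f (t i))"
  by (induction A rule: infinite_finite_induct) (auto simp: lsum_add)

lemma lsum_cong: "(\<And>a. a \<in> keys t \<Longrightarrow> f a = g a) \<Longrightarrow> lsum f t = lsum g t"
  by (simp add: lsum_def)

lemma lsum_mult_left: "lsum (\<lambda>a. c * f a) t = c * lsum f t"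
  unfolding lsum_def sum_distrib_left by (simp add: mult_ac)

lemma lsum_mult_right: "lsum (\<lambda>a. f a * c) t = lsum f t * c"
  unfolding lsum_def sum_distrib_right by (simp add: mult_ac)

lemma lsum_fun_add: "lsum (\<lambda>a. f a + g a) t = lsum f t + lsum g t"
  by (simp add: lsum_def algebra_simps sum.distrib)

lemma lsum_fun_diff: "lsum (\<lambda>a. f a - g a) t = lsum f t - lsum g t"
  by (simp add: lsum_def algebra_simps sum_subtractf)

lemma lsum_fun_sum: "lsum (\<lambda>a. \<Sum>i\<in>A. f i a) t = (\<Sum>i\<in>A. lsum (f i) t)"
  unfolding lsum_def by (subst sum.swap) (simp add: sum_distrib_left)

lemma lsum_fun_zero [simp]: "lsum (\<lambda>a. 0) t = 0"
  by (simp add: lsum_def)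

lemma lsum_swap: "lsum (\<lambda>a. lsum (f a) s) t = lsum (\<lambda>b. lsum (\<lambda>a. f a b) t) s"
  unfolding lsum_def sum_distrib_left by (subst sum.swap) (simp add: mult_ac)

lemma lsum_mult: "lsum f s * lsum g t = lsum (\<lambda>a. lsum (\<lambda>b. f a * g b) t) s"
  by (simp add: lsum_mult_left lsum_mult_right)

lemma lookup_lin_ext: "lookup (lin_ext f t) b = lsum (\<lambda>a. lookup (f a) b) t"
  by (simp add: lin_ext_def lsum_def lookup_sum)

lemma lsum_lin_ext: "lsum f (lin_ext g t) = lsum (\<lambda>a. lsum f (g a)) t"
  unfolding lin_ext_def by (simp add: lsum_sum) (simp add: lsum_def)

lemma lin_ext_zero [simp]: "lin_ext f 0 = 0"
  by (simp add: lin_ext_def)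

lemma lin_ext_single [simp]: "lin_ext f (single a c) = pscale c (f a)"
  by (rule poly_mapping_eqI) (simp add: lookup_lin_ext)

lemma pscale_one [simp]: "pscale 1 t = t"
  by (rule poly_mapping_eqI) simp

lemma lin_ext_add: "lin_ext f (s + t) = lin_ext f s + lin_ext f t"
  by (rule poly_mapping_eqI) (simp add: lookup_lin_ext lookup_add lsum_add)

lemma lin_ext_diff: "lin_ext f (s - t) = lin_ext f s - lin_ext f t"
  by (rule poly_mapping_eqI) (simp add: lookup_lin_ext lookup_minus lsum_diff)

lemma lin_ext_pscale: "lin_ext f (pscale c t) = pscale c (lin_ext f t)"
  by (rule poly_mapping_eqI) (simp add: lookup_lin_ext)

lemma lin_ext_sum: "lin_ext f (sum t A) = (\<Sum>i\<in>A. lin_ext f (t i))"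
  by (rule poly_mapping_eqI) (simp add: lookup_lin_ext lookup_sum lsum_sum)

lemma lin_ext_fun_add: "lin_ext (\<lambda>a. f a + g a) t = lin_ext f t + lin_ext g t"
  by (rule poly_mapping_eqI) (simp add: lookup_lin_ext lookup_add lsum_fun_add)

lemma lin_ext_fun_diff: "lin_ext (\<lambda>a. f a - g a) t = lin_ext f t - lin_ext g t"
  by (rule poly_mapping_eqI) (simp add: lookup_lin_ext lookup_minus lsum_fun_diff)

lemma lin_ext_fun_pscale: "lin_ext (\<lambda>a. pscale c (f a)) t = pscale c (lin_ext f t)"
  by (rule poly_mapping_eqI) (simp add: lookup_lin_ext lsum_mult_left)

lemma lin_ext_fun_sum: "lin_ext (\<lambda>a. \<Sum>i\<in>A. f i a) t = (\<Sum>i\<in>A. lin_ext (f i) t)"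
  by (rule poly_mapping_eqI) (simp add: lookup_lin_ext lookup_sum lsum_fun_sum)

lemma lin_ext_fun_zero [simp]: "lin_ext (\<lambda>a. 0) t = 0"
  by (rule poly_mapping_eqI) (simp add: lookup_lin_ext)

lemma lin_ext_cong: "(\<And>a. a \<in> keys t \<Longrightarrow> f a = g a) \<Longrightarrow> lin_ext f t = lin_ext g t"
  by (simp add: lin_ext_def)

lemma lin_ext_lin_ext: "lin_ext f (lin_ext g t) = lin_ext (\<lambda>a. lin_ext f (g a)) t"
  by (rule poly_mapping_eqI) (simp add: lookup_lin_ext lsum_lin_ext)

lemma lin_ext_swap:
  "lin_ext (\<lambda>a. lin_ext (f a) s) t = lin_ext (\<lambda>b. lin_ext (\<lambda>a. f a b) t) s"
  by (rule poly_mapping_eqI) (simp add: lookup_lin_ext lsum_swap[of _ s t])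

lemma lin_ext_id [simp]: "lin_ext (\<lambda>a. single a 1) t = t"
proof (rule poly_mapping_eqI)
  fix b
  have "lookup (lin_ext (\<lambda>a. single a 1) t) b = (\<Sum>a\<in>keys t. if a = b then lookup t a else 0)"
    unfolding lookup_lin_ext lsum_def by (intro sum.cong) (auto simp: lookup_single when_def)
  also have "\<dots> = lookup t b"
    by (simp add: in_keys_iff)
  finally show "lookup (lin_ext (\<lambda>a. single a 1) t) b = lookup t b" .
qed

lemma lin_ext_id_pair [simp]: "lin_ext (\<lambda>(a, b). tens a b) t = t"
  using lin_ext_id[of t] by (simp add: case_prod_unfold)

lemma single_eq_pscale: "single a c = pscale c (single a 1)"
  by (rule poly_mapping_eqI) (simp add: lookup_single when_def)

lemma keys_lin_ext: "keys (lin_ext f t) \<subseteq> (\<Union>a\<in>keys t. keys (f a))"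
proof
  fix b assume "b \<in> keys (lin_ext f t)"
  then have "lsum (\<lambda>a. lookup (f a) b) t \<noteq> 0" by (simp add: in_keys_iff lookup_lin_ext)
  then obtain a where "a \<in> keys t" "lookup (f a) b \<noteq> 0"
    unfolding lsum_def by (metis (mono_tags, lifting) mult_zero_right sum.neutral)
  then show "b \<in> (\<Union>a\<in>keys t. keys (f a))" by (auto simp: in_keys_iff)
qed

lemma lin_ext_mem_subspace:
  assumes "free.subspace W" "\<And>a. a \<in> keys t \<Longrightarrow> f a \<in> W"
  shows "lin_ext f t \<in> W"
  unfolding lin_ext_def
  by (intro free.subspace_sum[OF assms(1)] free.subspace_scale[OF assms(1)] assms(2))

text \<open>Meant for \<open>free.span_minimal\<close>: that the extension of \<open>f\<close> maps
  a whole span into \<open>W\<close> need only be checked on generators.\<close>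

lemma subspace_lin_ext_vimage:
  assumes "free.subspace W"
  shows "free.subspace {t. lin_ext f t \<in> W}"
  using assms by (simp add: free.subspace_def lin_ext_add lin_ext_pscale)

lemma subspace_keys: "free.subspace {x :: 'a \<Rightarrow>\<^sub>0 'k::field. keys x \<subseteq> A}"
proof -
  have "keys (x + y) \<subseteq> A" if "keys x \<subseteq> A" "keys y \<subseteq> A" for x y :: "'a \<Rightarrow>\<^sub>0 'k"
    using that Poly_Mapping.keys_add[of x y] by blast
  moreover have "keys (pscale c x) \<subseteq> A" if "keys x \<subseteq> A" for c and x :: "'a \<Rightarrow>\<^sub>0 'k"
    using that by (auto simp: in_keys_iff)
  ultimately show ?thesis by (simp add: free.subspace_def)
qed

lemma subspace_singleton_zero: "free.subspace {0 :: 'a \<Rightarrow>\<^sub>0 'k::field}"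
  by simp

section \<open>Modules given by coordinate functions\<close>

text \<open>The module laws hold because they hold for scalar coordinates that separate the
  elements. The instances are a free space with \<open>lookup\<close>, a graded dual with
  evaluation, and the quotient by the annihilator with the values of the restricted
  functional.\<close>

locale function_space =
  fixes H :: "('k::field, 'a) hopf" (structure) and crd :: "'a \<Rightarrow> 'i \<Rightarrow> 'k"
  assumes zero_closed: "\<zero> \<in> carrier H" and crd_zero: "crd \<zero> i = 0"
    and add_closed: "x \<in> carrier H \<Longrightarrow> y \<in> carrier H \<Longrightarrow> x \<oplus> y \<in> carrier H"
    and crd_add: "x \<in> carrier H \<Longrightarrow> y \<in> carrier H \<Longrightarrow> crd (x \<oplus> y) i = crd x i + crd y i"
    and smult_closed: "x \<in> carrier H \<Longrightarrow> r \<odot> x \<in> carrier H"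
    and crd_smult: "x \<in> carrier H \<Longrightarrow> crd (r \<odot> x) i = r * crd x i"
    and crd_inj: "x \<in> carrier H \<Longrightarrow> y \<in> carrier H \<Longrightarrow> (\<And>i. crd x i = crd y i) \<Longrightarrow> x = y"
begin

lemma smult_minus_one: "x \<in> carrier H \<Longrightarrow> (- 1) \<odot> x \<oplus> x = \<zero>"
  by (rule crd_inj) (simp_all add: add_closed smult_closed zero_closed crd_add crd_smult crd_zero)

lemma abelian_group: "abelian_group H"
proof (rule abelian_groupI)
  show "\<exists>y\<in>carrier H. y \<oplus> x = \<zero>" if "x \<in> carrier H" for x
    using that smult_minus_one smult_closed by blast
qed (auto intro!: crd_inj simp: add_closed zero_closed crd_add crd_zero algebra_simps)

lemma module: "Module.module ring_of_type_algebra H"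
proof (rule moduleI)
  show "cring (ring_of_type_algebra :: 'k ring)" by (rule cring_from_type_algebra)
  show "abelian_group H" by (rule abelian_group)
qed (auto intro!: crd_inj
      simp: ring_of_type_algebra_def add_closed smult_closed crd_add crd_smult algebra_simps)

lemma a_minus_eq: "x \<in> carrier H \<Longrightarrow> \<ominus> x = (- 1) \<odot> x"
  by (metis abelian_group abelian_group.minus_equality smult_minus_one smult_closed)

lemma minus_closed: "x \<in> carrier H \<Longrightarrow> y \<in> carrier H \<Longrightarrow> x \<ominus> y \<in> carrier H"
  by (simp add: a_minus_def a_minus_eq add_closed smult_closed)

lemma crd_minus: "x \<in> carrier H \<Longrightarrow> y \<in> carrier H \<Longrightarrow> crd (x \<ominus> y) i = crd x i - crd y i"
  by (simp add: a_minus_def a_minus_eq crd_add smult_closed crd_smult)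

lemma smult_zero_zero: "0 \<odot> \<zero> = \<zero>"
  by (rule crd_inj) (auto simp: smult_closed zero_closed crd_smult crd_zero)

lemma functional_on_zero:
  assumes "functional_on H \<phi>"
  shows "\<phi> \<zero> = 0"
proof -
  have "\<phi> (0 \<odot> \<zero>) = 0 * \<phi> \<zero>"
    using assms zero_closed unfolding functional_on_def by blast
  then show ?thesis by (simp add: smult_zero_zero)
qed

lemma functional_on_crd: "functional_on H (\<lambda>x. crd x i)"
  by (simp add: functional_on_def crd_add crd_smult)

lemma functional_on_finsum:
  assumes "functional_on H \<phi>" "finite A" "\<And>a. a \<in> A \<Longrightarrow> f a \<in> carrier H"
  shows "\<phi> (finsum H f A) = (\<Sum>a\<in>A. \<phi> (f a))"
proof -
  interpret abelian_group H by (rule abelian_group)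
  \<comment> \<open>Membership in the carrier is carried along, because additivity of \<phi> is
    assumed on the carrier only.\<close>
  from assms(2,3) have "\<phi> (finsum H f A) = (\<Sum>a\<in>A. \<phi> (f a)) \<and> finsum H f A \<in> carrier H"
  proof (induction A rule: finite_induct)
    case empty
    then show ?case using functional_on_zero[OF assms(1)] by simp
  next
    case (insert a A)
    then have c: "f \<in> A \<rightarrow> carrier H" "f a \<in> carrier H" by auto
    with insert assms(1) show ?case
      by (simp add: finsum_insert functional_on_def)
  qed
  then show ?thesis by simp
qed

lemma leval_closed: "(\<And>a. a \<in> keys t \<Longrightarrow> f a \<in> carrier H) \<Longrightarrow> leval H f t \<in> carrier H"
  unfolding leval_def
  by (rule abelian_monoid.finsum_closed) (auto simp: abelian_group abelian_group.axioms smult_closed)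

lemma functional_on_leval:
  assumes "functional_on H \<phi>" "\<And>a. a \<in> keys t \<Longrightarrow> f a \<in> carrier H"
  shows "\<phi> (leval H f t) = lsum (\<lambda>a. \<phi> (f a)) t"
  unfolding leval_def lsum_def using assms
  by (subst functional_on_finsum) (auto simp: smult_closed functional_on_def)

lemma leval_eqI:
  assumes "x \<in> carrier H" "\<And>a. a \<in> keys t \<Longrightarrow> f a \<in> carrier H"
    "\<And>i. crd x i = lsum (\<lambda>a. crd (f a) i) t"
  shows "leval H f t = x"
  using assms by (intro crd_inj) (auto simp: leval_closed functional_on_leval[OF functional_on_crd])

end

section \<open>Equality in tensor powers\<close>

lemma tensor_rel_add_left:
  "a \<in> carrier H \<Longrightarrow> a' \<in> carrier H \<Longrightarrow> b \<in> carrier H \<Longrightarrow>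
    tens (a \<oplus>\<^bsub>H\<^esub> a') b - tens a b - tens a' b \<in> tensor_rel H"
  unfolding tensor_rel_def by blast

lemma tensor_rel_add_right:
  "a \<in> carrier H \<Longrightarrow> b \<in> carrier H \<Longrightarrow> b' \<in> carrier H \<Longrightarrow>
    tens a (b \<oplus>\<^bsub>H\<^esub> b') - tens a b - tens a b' \<in> tensor_rel H"
  unfolding tensor_rel_def by blast

lemma tensor_rel_smult_left:
  "a \<in> carrier H \<Longrightarrow> b \<in> carrier H \<Longrightarrow> tens (r \<odot>\<^bsub>H\<^esub> a) b - pscale r (tens a b) \<in> tensor_rel H"
  unfolding tensor_rel_def by blast

lemma tensor_rel_smult_right:
  "a \<in> carrier H \<Longrightarrow> b \<in> carrier H \<Longrightarrow> tens a (r \<odot>\<^bsub>H\<^esub> b) - pscale r (tens a b) \<in> tensor_rel H"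
  unfolding tensor_rel_def by blast

lemmas tensor_rel_intros =
  tensor_rel_add_left tensor_rel_add_right tensor_rel_smult_left tensor_rel_smult_right

lemma tensor_relE [consumes 1, case_names add_left add_right smult_left smult_right]:
  assumes "u \<in> tensor_rel H"
  obtains a a' b where "a \<in> carrier H" "a' \<in> carrier H" "b \<in> carrier H"
      "u = tens (a \<oplus>\<^bsub>H\<^esub> a') b - tens a b - tens a' b"
  | a b b' where "a \<in> carrier H" "b \<in> carrier H" "b' \<in> carrier H"
      "u = tens a (b \<oplus>\<^bsub>H\<^esub> b') - tens a b - tens a b'"
  | r a b where "a \<in> carrier H" "b \<in> carrier H" "u = tens (r \<odot>\<^bsub>H\<^esub> a) b - pscale r (tens a b)"
  | r a b where "a \<in> carrier H" "b \<in> carrier H" "u = tens a (r \<odot>\<^bsub>H\<^esub> b) - pscale r (tens a b)"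
  using assms unfolding tensor_rel_def by blast

lemma tensor_eq_refl [simp]: "tensor_eq H s s"
  by (simp add: tensor_eq_def free.span_zero)

lemma tensor_eq_sym: "tensor_eq H s t \<Longrightarrow> tensor_eq H t s"
  using free.span_neg[of "s - t" "tensor_rel H"] by (simp add: tensor_eq_def)

lemma tensor_eq_trans: "tensor_eq H s t \<Longrightarrow> tensor_eq H t u \<Longrightarrow> tensor_eq H s u"
  using free.span_add[of "s - t" "tensor_rel H" "t - u"] by (simp add: tensor_eq_def)

lemma tensor_eq_lin_ext:
  assumes "\<And>a. a \<in> keys t \<Longrightarrow> tensor_eq H (f a) (g a)"
  shows "tensor_eq H (lin_ext f t) (lin_ext g t)"
  unfolding tensor_eq_def lin_ext_fun_diff[symmetric]
  by (rule lin_ext_mem_subspace[OF free.subspace_span]) (use assms in \<open>simp add: tensor_eq_def\<close>)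

lemma tensor3_eq_refl [simp]: "tensor3_eq H s s"
  by (simp add: tensor3_eq_def free.span_zero)

lemma tensor3_eq_sym: "tensor3_eq H s t \<Longrightarrow> tensor3_eq H t s"
  using free.span_neg[of "s - t" "tensor3_rel H"] by (simp add: tensor3_eq_def)

lemma tensor3_eq_trans: "tensor3_eq H s t \<Longrightarrow> tensor3_eq H t u \<Longrightarrow> tensor3_eq H s u"
  using free.span_add[of "s - t" "tensor3_rel H" "t - u"] by (simp add: tensor3_eq_def)

lemma tensor3_eq_lin_ext:
  assumes "\<And>a. a \<in> keys t \<Longrightarrow> tensor3_eq H (f a) (g a)"
  shows "tensor3_eq H (lin_ext f t) (lin_ext g t)"
  unfolding tensor3_eq_def lin_ext_fun_diff[symmetric]
  by (rule lin_ext_mem_subspace[OF free.subspace_span]) (use assms in \<open>simp add: tensor3_eq_def\<close>)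

section \<open>Multilinear maps on tensor powers\<close>

definition linear_from :: "('k::field, 'a) hopf \<Rightarrow> ('a \<Rightarrow> ('j \<Rightarrow>\<^sub>0 'k)) \<Rightarrow> bool"
  where "linear_from H f \<longleftrightarrow>
    (\<forall>x\<in>carrier H. \<forall>y\<in>carrier H. f (x \<oplus>\<^bsub>H\<^esub> y) = f x + f y) \<and>
    (\<forall>r. \<forall>x\<in>carrier H. f (r \<odot>\<^bsub>H\<^esub> x) = pscale r (f x))"

text \<open>Universal property of the tensor square: the combinations killed by the extension of
  \<open>B\<close> form a subspace that contains every bilinearity relation, hence their
  span.\<close>

lemma tensor_eq_bilinear:
  assumes st: "tensor_eq H s t"
    and l: "\<And>b. b \<in> carrier H \<Longrightarrow> linear_from H (\<lambda>a. B a b)"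
    and r: "\<And>a. a \<in> carrier H \<Longrightarrow> linear_from H (\<lambda>b. B a b)"
  shows "lin_ext (\<lambda>(a, b). B a b) s = lin_ext (\<lambda>(a, b). B a b) t"
proof -
  have "s - t \<in> {u. lin_ext (\<lambda>(a, b). B a b) u \<in> {0}}"
    using st unfolding tensor_eq_def
  proof (rule subsetD[OF free.span_minimal, rotated 2])
    show "free.subspace {u. lin_ext (\<lambda>(a, b). B a b) u \<in> {0}}"
      by (intro subspace_lin_ext_vimage subspace_singleton_zero)
    show "tensor_rel H \<subseteq> {u. lin_ext (\<lambda>(a, b). B a b) u \<in> {0}}"
      using l r by (auto elim!: tensor_relE simp: lin_ext_diff lin_ext_pscale linear_from_def)
  qed
  then show ?thesis by (simp add: lin_ext_diff)
qed

lemma functional_on_mult_right: "functional_on H \<phi> \<Longrightarrow> functional_on H (\<lambda>a. \<phi> a * c)"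
  by (simp add: functional_on_def algebra_simps)

lemma functional_on_mult_left: "functional_on H \<phi> \<Longrightarrow> functional_on H (\<lambda>a. c * \<phi> a)"
  by (simp add: functional_on_def algebra_simps)

lemma functional_on_linear_from:
  "functional_on H \<phi> \<Longrightarrow> linear_from H (\<lambda>a. pscale (\<phi> a) v)"
  by (simp add: functional_on_def linear_from_def free.scale_left_distrib)

text \<open>Scalars are viewed as vectors of the one-dimensional space on \<open>()\<close>, so that
  the results on vector-valued multilinear maps cover functionals.\<close>

lemma lsum_eq_lookup: "lsum f t = lookup (lin_ext (\<lambda>a. pscale (f a) (single () 1)) t) ()"
  by (simp add: lookup_lin_ext)

text \<open>A pair of functionals sees only the class of a tensor; this makes the product of the
  graded dual independent of the representative of the coproduct.\<close>

lemma tensor_eq_functionals: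
  assumes "tensor_eq H s t" "functional_on H \<phi>" "functional_on H \<psi>"
  shows "lsum (\<lambda>(a, b). \<phi> a * \<psi> b) s = lsum (\<lambda>(a, b). \<phi> a * \<psi> b) t"
proof -
  have "lin_ext (\<lambda>(a, b). pscale (\<phi> a * \<psi> b) (single () 1)) s
      = lin_ext (\<lambda>(a, b). pscale (\<phi> a * \<psi> b) (single () 1)) t"
    by (rule tensor_eq_bilinear[OF assms(1)])
      (intro functional_on_linear_from functional_on_mult_left functional_on_mult_right assms)+
  then show ?thesis by (simp add: lsum_eq_lookup case_prod_unfold)
qed

text \<open>Functoriality of the tensor square: a linear map sends each of the four kinds of
  relation to a relation of the same kind.\<close>

lemma tensor_eq_push:
  assumes "tensor_eq H s t" "linear_on H H' f"
  shows "tensor_eq H' (lin_ext (\<lambda>(a, b). tens (f a) (f b)) s) (lin_ext (\<lambda>(a, b). tens (f a) (f b)) t)"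
proof -
  let ?p = "lin_ext (\<lambda>(a, b). tens (f a) (f b))"
  have "s - t \<in> {u. ?p u \<in> free.span (tensor_rel H')}"
    using assms(1) unfolding tensor_eq_def
  proof (rule subsetD[OF free.span_minimal, rotated 2])
    show "free.subspace {u. ?p u \<in> free.span (tensor_rel H')}"
      by (intro subspace_lin_ext_vimage free.subspace_span)
    show "tensor_rel H \<subseteq> {u. ?p u \<in> free.span (tensor_rel H')}"
    proof
      fix u assume "u \<in> tensor_rel H"
      then have "?p u \<in> tensor_rel H'"
        using assms(2)
        by (cases rule: tensor_relE)
          (simp_all add: lin_ext_diff lin_ext_pscale linear_on_def Pi_iff tensor_rel_intros)
      then show "u \<in> {u. ?p u \<in> free.span (tensor_rel H')}" by (simp add: free.span_base)
    qed
  qed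
  then show ?thesis by (simp add: tensor_eq_def lin_ext_diff)
qed

lemma tensor_eq_tensor3_left:
  assumes "tensor_eq H s t" "c \<in> carrier H"
  shows "tensor3_eq H (lin_ext (\<lambda>(a, b). tens3 a b c) s) (lin_ext (\<lambda>(a, b). tens3 a b c) t)"
proof -
  have "s - t \<in> {u. lin_ext (\<lambda>(a, b). tens3 a b c) u \<in> free.span (tensor3_rel H)}"
    using assms(1) unfolding tensor_eq_def
    by (rule subsetD[OF free.span_minimal, rotated 2])
      (use assms(2) in \<open>auto simp: tensor3_rel_def intro!: subspace_lin_ext_vimage free.span_base\<close>)
  then show ?thesis by (simp add: tensor3_eq_def lin_ext_diff)
qed

lemma tensor_eq_tensor3_right:
  assumes "tensor_eq H s t" "a \<in> carrier H"
  shows "tensor3_eq H (lin_ext (\<lambda>(b, c). tens3 a b c) s) (lin_ext (\<lambda>(b, c). tens3 a b c) t)"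
proof -
  have "s - t \<in> {u. lin_ext (\<lambda>(b, c). tens3 a b c) u \<in> free.span (tensor3_rel H)}"
    using assms(1) unfolding tensor_eq_def
    by (rule subsetD[OF free.span_minimal, rotated 2])
      (use assms(2) in \<open>auto simp: tensor3_rel_def intro!: subspace_lin_ext_vimage free.span_base\<close>)
  then show ?thesis by (simp add: tensor3_eq_def lin_ext_diff)
qed

text \<open>Each relation of the tensor cube is a relation of the square with one outer factor
  frozen, so freezing that variable of \<open>B\<close> reduces the claim to
  \<open>tensor_eq_bilinear\<close>.\<close>

lemma tensor3_eq_trilinear:
  assumes st: "tensor3_eq H s t"
    and l: "\<And>b c. b \<in> carrier H \<Longrightarrow> c \<in> carrier H \<Longrightarrow> linear_from H (\<lambda>a. B a b c)"
    and m: "\<And>a c. a \<in> carrier H \<Longrightarrow> c \<in> carrier H \<Longrightarrow> linear_from H (\<lambda>b. B a b c)"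
    and r: "\<And>a b. a \<in> carrier H \<Longrightarrow> b \<in> carrier H \<Longrightarrow> linear_from H (\<lambda>c. B a b c)"
  shows "lin_ext (\<lambda>(a, b, c). B a b c) s = lin_ext (\<lambda>(a, b, c). B a b c) t"
proof -
  let ?p = "lin_ext (\<lambda>(a, b, c). B a b c)"
  have "s - t \<in> {u. ?p u \<in> {0}}"
    using st unfolding tensor3_eq_def
  proof (rule subsetD[OF free.span_minimal, rotated 2])
    show "free.subspace {u. ?p u \<in> {0}}"
      by (intro subspace_lin_ext_vimage subspace_singleton_zero)
    have "?p (lin_ext (\<lambda>(a, b). tens3 a b c) u) = 0" if "u \<in> tensor_rel H" "c \<in> carrier H" for u c
    proof -
      have "tensor_eq H u 0" using that by (simp add: tensor_eq_def free.span_base)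
      from tensor_eq_bilinear[OF this, of "\<lambda>a b. B a b c"] that l m show ?thesis
        by (simp add: lin_ext_lin_ext case_prod_unfold)
    qed
    moreover have "?p (lin_ext (\<lambda>(b, c). tens3 a b c) u) = 0"
      if "u \<in> tensor_rel H" "a \<in> carrier H" for u a
    proof -
      have "tensor_eq H u 0" using that by (simp add: tensor_eq_def free.span_base)
      from tensor_eq_bilinear[OF this, of "\<lambda>b c. B a b c"] that m r show ?thesis
        by (simp add: lin_ext_lin_ext case_prod_unfold)
    qed
    ultimately show "tensor3_rel H \<subseteq> {u. ?p u \<in> {0}}"
      by (auto simp: tensor3_rel_def)
  qed
  then show ?thesis by (simp add: lin_ext_diff)
qed

lemma tensor3_eq_functionals:
  assumes "tensor3_eq H s t" "functional_on H \<phi>" "functional_on H \<psi>" "functional_on H \<chi>"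
  shows "lsum (\<lambda>(a, b, c). \<phi> a * \<psi> b * \<chi> c) s = lsum (\<lambda>(a, b, c). \<phi> a * \<psi> b * \<chi> c) t"
proof -
  have "lin_ext (\<lambda>(a, b, c). pscale (\<phi> a * \<psi> b * \<chi> c) (single () 1)) s
      = lin_ext (\<lambda>(a, b, c). pscale (\<phi> a * \<psi> b * \<chi> c) (single () 1)) t"
    by (rule tensor3_eq_trilinear[OF assms(1)])
      (intro functional_on_linear_from functional_on_mult_left functional_on_mult_right assms)+
  then show ?thesis by (simp add: lsum_eq_lookup case_prod_unfold)
qed

section \<open>Expansions over a family, and separation of tensors by coefficients\<close>

locale coordinates = function_space H crd for H :: "('k::field, 'a) hopf" (structure) and crd :: "'a \<Rightarrow> 'j \<Rightarrow> 'k" +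
  fixes e :: "'i \<Rightarrow> 'a" and cf :: "'a \<Rightarrow> ('i \<Rightarrow>\<^sub>0 'k)"
  assumes e_closed: "x \<in> carrier H \<Longrightarrow> i \<in> keys (cf x) \<Longrightarrow> e i \<in> carrier H"
    and leval_cf: "x \<in> carrier H \<Longrightarrow> leval H e (cf x) = x"
begin

text \<open>\<open>tens\<close> is bilinear only modulo the relations, so a finite sum can be pulled
  out of it only modulo their span. \<open>T\<close> stands for \<open>tens\<close> with one
  argument fixed.\<close>

lemma leval_mod_span:
  assumes add: "\<And>x y. x \<in> carrier H \<Longrightarrow> y \<in> carrier H \<Longrightarrow> T (x \<oplus> y) - (T x + T y) \<in> free.span R"
    and smult: "\<And>r x. x \<in> carrier H \<Longrightarrow> T (r \<odot> x) - pscale r (T x) \<in> free.span R"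
    and f: "\<And>i. i \<in> keys t \<Longrightarrow> f i \<in> carrier H"
  shows "T (leval H f t) - lin_ext (\<lambda>i. T (f i)) t \<in> free.span R"
proof -
  interpret abelian_group H by (rule abelian_group)
  let ?g = "\<lambda>i. lookup t i \<odot> f i" and ?h = "\<lambda>i. pscale (lookup t i) (T (f i))"
  have "T (finsum H ?g A) - sum ?h A \<in> free.span R" if "finite A" "A \<subseteq> keys t" for A
    using that
  proof (induction A rule: finite_induct)
    case empty
    \<comment> \<open>The zero vector is 0 times itself, so homogeneity puts
      \<open>T \<zero>\<close> into the span.\<close>
    then show ?case using smult[OF zero_closed, of 0] by (simp add: smult_zero_zero)
  next
    case (insert i A)
    have c: "?g j \<in> carrier H" if "j \<in> insert i A" for j using insert.prems that f smult_closed by blast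
    then have "finsum H ?g A \<in> carrier H" by (intro finsum_closed) auto
    \<comment> \<open>The new error splits into an additivity error, a homogeneity error and the
      error covered by the induction hypothesis.\<close>
    from add[OF c this, of i] smult[OF f, of i "lookup t i"] insert
    have "(T (?g i \<oplus> finsum H ?g A) - (T (?g i) + T (finsum H ?g A))) +
        ((T (?g i) - ?h i) + (T (finsum H ?g A) - sum ?h A)) \<in> free.span R"
      by (intro free.span_add) auto
    then show ?case
      using insert.hyps c by (subst finsum_insert) (auto simp: algebra_simps)
  qed
  then show ?thesis by (simp add: leval_def lin_ext_def)
qed

lemma tens_leval_left:
  assumes "\<And>i. i \<in> keys t \<Longrightarrow> f i \<in> carrier H" "b \<in> carrier H"
  shows "tensor_eq H (tens (leval H f t) b) (lin_ext (\<lambda>i. tens (f i) b) t)"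
  unfolding tensor_eq_def
  by (rule leval_mod_span[OF _ _ assms(1)])
    (use assms(2) in \<open>simp_all add: free.span_base tensor_rel_intros flip: diff_diff_eq\<close>)

lemma tens_leval_right:
  assumes "\<And>i. i \<in> keys t \<Longrightarrow> f i \<in> carrier H" "b \<in> carrier H"
  shows "tensor_eq H (tens b (leval H f t)) (lin_ext (\<lambda>i. tens b (f i)) t)"
  unfolding tensor_eq_def
  by (rule leval_mod_span[OF _ _ assms(1)])
    (use assms(2) in \<open>simp_all add: free.span_base tensor_rel_intros flip: diff_diff_eq\<close>)

text \<open>The finite expansions \<open>cf\<close> are other data than the coordinates
  \<open>crd\<close>: in the graded dual, \<open>crd\<close> evaluates at arbitrary vectors, whereas
  \<open>cf\<close> lists the values at basis vectors.\<close>

definition cf2 :: "('a \<times> 'a \<Rightarrow>\<^sub>0 'k) \<Rightarrow> ('i \<times> 'i \<Rightarrow>\<^sub>0 'k)"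
  where "cf2 = lin_ext (\<lambda>(a, b). lin_ext (\<lambda>i. lin_ext (\<lambda>j. tens i j) (cf b)) (cf a))"

definition cf3 :: "('a \<times> 'a \<times> 'a \<Rightarrow>\<^sub>0 'k) \<Rightarrow> ('i \<times> 'i \<times> 'i \<Rightarrow>\<^sub>0 'k)"
  where "cf3 = lin_ext (\<lambda>(a, b, c).
    lin_ext (\<lambda>i. lin_ext (\<lambda>j. lin_ext (\<lambda>k. tens3 i j k) (cf c)) (cf b)) (cf a))"

lemma tens_expand:
  assumes "a \<in> carrier H" "b \<in> carrier H"
  shows "tensor_eq H (tens a b) (lin_ext (\<lambda>i. lin_ext (\<lambda>j. tens (e i) (e j)) (cf b)) (cf a))"
proof -
  have "tensor_eq H (tens a b) (lin_ext (\<lambda>i. tens (e i) b) (cf a))"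
    using tens_leval_left[of "cf a" e b] assms by (auto simp: e_closed leval_cf)
  also have "tensor_eq H \<dots> (lin_ext (\<lambda>i. lin_ext (\<lambda>j. tens (e i) (e j)) (cf b)) (cf a))"
  proof (rule tensor_eq_lin_ext)
    fix i assume "i \<in> keys (cf a)"
    then show "tensor_eq H (tens (e i) b) (lin_ext (\<lambda>j. tens (e i) (e j)) (cf b))"
      using tens_leval_right[of "cf b" e "e i"] assms by (auto simp: e_closed leval_cf)
  qed
  finally (tensor_eq_trans) show ?thesis .
qed

lemma tensor_eq_cf2:
  assumes "keys t \<subseteq> carrier H \<times> carrier H"
  shows "tensor_eq H t (lin_ext (\<lambda>(i, j). tens (e i) (e j)) (cf2 t))"
proof -
  have "tensor_eq H (lin_ext (\<lambda>(a, b). tens a b) t)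
     (lin_ext (\<lambda>(a, b). lin_ext (\<lambda>i. lin_ext (\<lambda>j. tens (e i) (e j)) (cf b)) (cf a)) t)"
    using assms by (intro tensor_eq_lin_ext) (auto intro!: tens_expand)
  then show ?thesis by (simp add: cf2_def lin_ext_lin_ext case_prod_unfold)
qed

text \<open>Both sides are equivalent to the same combination of tensors of vectors
  \<open>e i\<close> and \<open>e j\<close>.\<close>

lemma tensor_eqI_cf2:
  assumes "keys s \<subseteq> carrier H \<times> carrier H" "keys t \<subseteq> carrier H \<times> carrier H" "cf2 s = cf2 t"
  shows "tensor_eq H s t"
  using tensor_eq_cf2[OF assms(1), unfolded assms(3)] tensor_eq_sym[OF tensor_eq_cf2[OF assms(2)]]
  by (rule tensor_eq_trans)

lemma tens3_expand:
  assumes "a \<in> carrier H" "b \<in> carrier H" "c \<in> carrier H"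
  shows "tensor3_eq H (tens3 a b c) (lin_ext (\<lambda>i. lin_ext (\<lambda>j. lin_ext (\<lambda>k.
    tens3 (e i) (e j) (e k)) (cf c)) (cf b)) (cf a))"
proof -
  have "tensor3_eq H (tens3 a b c) (lin_ext (\<lambda>i. lin_ext (\<lambda>j. tens3 (e i) (e j) c) (cf b)) (cf a))"
    using tensor_eq_tensor3_left[OF tens_expand[OF assms(1,2)] assms(3)]
    by (simp add: lin_ext_lin_ext)
  also have "tensor3_eq H \<dots> (lin_ext (\<lambda>i. lin_ext (\<lambda>j. lin_ext (\<lambda>k.
      tens3 (e i) (e j) (e k)) (cf c)) (cf b)) (cf a))"
  proof (intro tensor3_eq_lin_ext)
    fix i j assume ij: "i \<in> keys (cf a)" "j \<in> keys (cf b)"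
    have "tensor_eq H (tens (e j) c) (lin_ext (\<lambda>k. tens (e j) (e k)) (cf c))"
      using tens_leval_right[of "cf c" e "e j"] assms ij by (auto simp: e_closed leval_cf)
    from tensor_eq_tensor3_right[OF this, of "e i"] ij assms
    show "tensor3_eq H (tens3 (e i) (e j) c) (lin_ext (\<lambda>k. tens3 (e i) (e j) (e k)) (cf c))"
      by (simp add: lin_ext_lin_ext e_closed)
  qed
  finally (tensor3_eq_trans) show ?thesis .
qed

lemma tensor3_eq_cf3:
  assumes "keys t \<subseteq> carrier H \<times> carrier H \<times> carrier H"
  shows "tensor3_eq H t (lin_ext (\<lambda>(i, j, k). tens3 (e i) (e j) (e k)) (cf3 t))"
proof -
  have "tensor3_eq H (lin_ext (\<lambda>(a, b, c). tens3 a b c) t)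
     (lin_ext (\<lambda>(a, b, c). lin_ext (\<lambda>i. lin_ext (\<lambda>j. lin_ext (\<lambda>k.
    tens3 (e i) (e j) (e k)) (cf c)) (cf b)) (cf a)) t)"
    using assms by (intro tensor3_eq_lin_ext) (auto intro!: tens3_expand)
  moreover have "lin_ext (\<lambda>(a, b, c). tens3 a b c) t = t"
    using lin_ext_id[of t] by (simp add: case_prod_unfold)
  ultimately show ?thesis by (simp add: cf3_def lin_ext_lin_ext case_prod_unfold)
qed

lemma tensor3_eqI_cf3:
  assumes "keys s \<subseteq> carrier H \<times> carrier H \<times> carrier H"
    "keys t \<subseteq> carrier H \<times> carrier H \<times> carrier H" "cf3 s = cf3 t"
  shows "tensor3_eq H s t"
  using tensor3_eq_cf3[OF assms(1), unfolded assms(3)] tensor3_eq_sym[OF tensor3_eq_cf3[OF assms(2)]]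
  by (rule tensor3_eq_trans)

end

section \<open>The antipode of a connected graded bialgebra\<close>

text \<open>Finiteness of the homogeneous components makes the transpose of the product a finite sum
  of tensors later on.\<close>

locale free_space =
  fixes H :: "('k::field, 'i \<Rightarrow>\<^sub>0 'k) hopf" (structure) and I :: "'i set" and deg :: "'i \<Rightarrow> nat"
  assumes carrier_eq: "carrier H = {x. keys x \<subseteq> I}"
    and zero_eq: "\<zero> = 0"
    and add_eq: "x \<oplus> y = x + y"
    and smult_eq: "r \<odot> x = pscale r x"
    and finite_deg: "finite {i \<in> I. deg i = n}"
    and grade_eq: "grade H n = {x. keys x \<subseteq> {i \<in> I. deg i = n}}"
begin

lemma subspace_carrier: "free.subspace (carrier H)"
  unfolding carrier_eq by (rule subspace_keys)

lemma subspace_grade: "free.subspace (grade H n)"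
  unfolding grade_eq by (rule subspace_keys)

lemma grade_subset_carrier: "grade H n \<subseteq> carrier H"
  by (auto simp: grade_eq carrier_eq)

lemma single_carrier: "i \<in> I \<Longrightarrow> single i c \<in> carrier H"
  by (simp add: carrier_eq)

lemma single_grade: "i \<in> I \<Longrightarrow> single i c \<in> grade H (deg i)"
  by (simp add: grade_eq)

sublocale function_space H lookup
  by unfold_locales
    (auto simp: zero_eq add_eq smult_eq lookup_add poly_mapping_eqI
      intro: free.subspace_0[OF subspace_carrier] free.subspace_add[OF subspace_carrier]
        free.subspace_scale[OF subspace_carrier])

lemma lin_ext_carrier: "(\<And>a. a \<in> keys t \<Longrightarrow> f a \<in> carrier H) \<Longrightarrow> lin_ext f t \<in> carrier H"
  by (rule lin_ext_mem_subspace[OF subspace_carrier])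

lemma leval_eq_lin_ext:
  assumes "\<And>a. a \<in> keys t \<Longrightarrow> f a \<in> carrier H"
  shows "leval H f t = lin_ext f t"
  by (rule leval_eqI) (simp_all add: assms lin_ext_carrier lookup_lin_ext)

sublocale coordinates H lookup "\<lambda>i. single i 1" "\<lambda>x. x"
proof unfold_locales
  show "leval H (\<lambda>i. single i 1) x = x" if "x \<in> carrier H" for x
    using that by (subst leval_eq_lin_ext) (auto simp: carrier_eq)
qed (auto simp: carrier_eq)

lemma linear_on_endo:
  "linear_on H H f \<longleftrightarrow> f \<in> carrier H \<rightarrow> carrier H \<and>
    (\<forall>x\<in>carrier H. \<forall>y\<in>carrier H. f (x + y) = f x + f y) \<and>
    (\<forall>r. \<forall>x\<in>carrier H. f (pscale r x) = pscale r (f x))"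
  by (simp add: linear_on_def add_eq smult_eq)

lemma linear_on_lin_ext:
  assumes f: "linear_on H H f" and g: "\<And>a. a \<in> keys t \<Longrightarrow> g a \<in> carrier H"
  shows "f (lin_ext g t) = lin_ext (\<lambda>a. f (g a)) t"
proof -
  have z: "f 0 = 0"
  proof -
    have "f (pscale 0 0) = pscale 0 (f 0)"
      using f free.subspace_0[OF subspace_carrier] unfolding linear_on_endo by blast
    then show ?thesis by simp
  qed
  have "f (\<Sum>a\<in>A. pscale (lookup t a) (g a)) = (\<Sum>a\<in>A. pscale (lookup t a) (f (g a)))
      \<and> (\<Sum>a\<in>A. pscale (lookup t a) (g a)) \<in> carrier H"
    if "finite A" "A \<subseteq> keys t" for A
    using that
  proof (induction A rule: finite_induct)
    case empty
    then show ?case using z free.subspace_0[OF subspace_carrier] by simp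
  next
    case (insert a A)
    then have "g a \<in> carrier H" "pscale (lookup t a) (g a) \<in> carrier H"
      using g free.subspace_scale[OF subspace_carrier] by auto
    with insert f show ?case
      by (simp add: linear_on_endo free.subspace_add[OF subspace_carrier])
  qed
  from this[of "keys t"] show ?thesis by (simp add: lin_ext_def)
qed

end

section \<open>Connected graded bialgebras and convolution\<close>

locale connected_bialgebra = free_space H I deg
  for H :: "('k::field, 'i \<Rightarrow>\<^sub>0 'k) hopf" (structure) and I deg +
  assumes bialgebra: "bialgebra H"
    and mult_graded: "x \<in> grade H p \<Longrightarrow> y \<in> grade H q \<Longrightarrow> x \<otimes> y \<in> grade H (p + q)"
    and comult_graded: "x \<in> grade H n \<Longrightarrow>
      \<exists>t. keys t \<subseteq> (\<Union>p\<le>n. grade H p \<times> grade H (n - p)) \<and> tensor_eq H (comult H x) t"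
    and one_graded: "\<one> \<in> grade H 0"
    and connected: "x \<in> grade H 0 \<Longrightarrow> x = pscale (counit H x) \<one>"
    and counit_graded: "x \<in> grade H n \<Longrightarrow> n > 0 \<Longrightarrow> counit H x = 0"
begin

lemma ring: "ring H"
  using bialgebra by (simp add: bialgebra_def unital_algebra_def)

lemma one_closed: "\<one> \<in> carrier H"
  using one_graded grade_subset_carrier by blast

lemma mult_closed: "x \<in> carrier H \<Longrightarrow> y \<in> carrier H \<Longrightarrow> x \<otimes> y \<in> carrier H"
  using ring by (simp add: monoid.m_closed ring.is_monoid)

lemma mult_assoc: "x \<in> carrier H \<Longrightarrow> y \<in> carrier H \<Longrightarrow> z \<in> carrier H \<Longrightarrow>
    (x \<otimes> y) \<otimes> z = x \<otimes> (y \<otimes> z)"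
  using ring by (simp add: monoid.m_assoc ring.is_monoid)

lemma mult_one: "x \<in> carrier H \<Longrightarrow> x \<otimes> \<one> = x" "x \<in> carrier H \<Longrightarrow> \<one> \<otimes> x = x"
  using ring by (simp_all add: monoid.r_one monoid.l_one ring.is_monoid)

lemma linear_mult_left: "y \<in> carrier H \<Longrightarrow> linear_on H H (\<lambda>x. x \<otimes> y)"
  using bialgebra ringE(3)[OF ring]
  by (auto simp: linear_on_def bialgebra_def unital_algebra_def mult_closed)

lemma linear_mult_right: "y \<in> carrier H \<Longrightarrow> linear_on H H (\<lambda>x. y \<otimes> x)"
  using bialgebra ringE(4)[OF ring]
  by (auto simp: linear_on_def bialgebra_def unital_algebra_def mult_closed)

lemma pscale_mult: "x \<in> carrier H \<Longrightarrow> y \<in> carrier H \<Longrightarrow> pscale r x \<otimes> y = pscale r (x \<otimes> y)"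
  using linear_mult_left[of y] by (simp add: linear_on_endo)

lemma mult_pscale: "x \<in> carrier H \<Longrightarrow> y \<in> carrier H \<Longrightarrow> x \<otimes> pscale r y = pscale r (x \<otimes> y)"
  using linear_mult_right[of x] by (simp add: linear_on_endo)

lemma keys_comult: "x \<in> carrier H \<Longrightarrow> keys (comult H x) \<subseteq> carrier H \<times> carrier H"
  using bialgebra by (simp add: bialgebra_def counital_coalgebra_def)

lemma comult_add: "x \<in> carrier H \<Longrightarrow> y \<in> carrier H \<Longrightarrow>
    tensor_eq H (comult H (x + y)) (comult H x + comult H y)"
  using bialgebra by (auto simp: bialgebra_def counital_coalgebra_def add_eq)

lemma comult_pscale: "x \<in> carrier H \<Longrightarrow>
    tensor_eq H (comult H (pscale r x)) (pscale r (comult H x))"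
  using bialgebra by (auto simp: bialgebra_def counital_coalgebra_def smult_eq)

lemma functional_counit: "functional_on H (counit H)"
  using bialgebra by (auto simp: bialgebra_def counital_coalgebra_def)

lemma counit_add: "x \<in> carrier H \<Longrightarrow> y \<in> carrier H \<Longrightarrow> counit H (x + y) = counit H x + counit H y"
  using functional_counit by (simp add: functional_on_def add_eq)

lemma counit_pscale: "x \<in> carrier H \<Longrightarrow> counit H (pscale r x) = r * counit H x"
  using functional_counit by (simp add: functional_on_def smult_eq)

lemma coassoc: "x \<in> carrier H \<Longrightarrow> tensor3_eq H
    (lin_ext (\<lambda>(a, c). lin_ext (\<lambda>(a', b). tens3 a' b c) (comult H a)) (comult H x))
    (lin_ext (\<lambda>(a, c). lin_ext (\<lambda>(b, c'). tens3 a b c') (comult H c)) (comult H x))"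
  using bialgebra by (auto simp: bialgebra_def counital_coalgebra_def)

lemma counit_left: "x \<in> carrier H \<Longrightarrow> lin_ext (\<lambda>(a, b). pscale (counit H a) b) (comult H x) = x"
proof -
  assume x: "x \<in> carrier H"
  then have "leval H (\<lambda>(a, b). pscale (counit H a) b) (comult H x) = x"
    using bialgebra by (auto simp: bialgebra_def counital_coalgebra_def smult_eq)
  moreover have "leval H (\<lambda>(a, b). pscale (counit H a) b) (comult H x)
      = lin_ext (\<lambda>(a, b). pscale (counit H a) b) (comult H x)"
    using keys_comult[OF x] by (intro leval_eq_lin_ext) (auto intro: free.subspace_scale[OF subspace_carrier])
  ultimately show ?thesis by simp
qed

lemma counit_right: "x \<in> carrier H \<Longrightarrow> lin_ext (\<lambda>(a, b). pscale (counit H b) a) (comult H x) = x"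
proof -
  assume x: "x \<in> carrier H"
  then have "leval H (\<lambda>(a, b). pscale (counit H b) a) (comult H x) = x"
    using bialgebra by (auto simp: bialgebra_def counital_coalgebra_def smult_eq)
  moreover have "leval H (\<lambda>(a, b). pscale (counit H b) a) (comult H x)
      = lin_ext (\<lambda>(a, b). pscale (counit H b) a) (comult H x)"
    using keys_comult[OF x] by (intro leval_eq_lin_ext) (auto intro: free.subspace_scale[OF subspace_carrier])
  ultimately show ?thesis by simp
qed

text \<open>The convolution product of maps from H to itself; its neutral element is the composite
  of counit and unit, \<open>unit_counit\<close>.\<close>

definition conv :: "(('i \<Rightarrow>\<^sub>0 'k) \<Rightarrow> ('i \<Rightarrow>\<^sub>0 'k)) \<Rightarrow> (('i \<Rightarrow>\<^sub>0 'k) \<Rightarrow> ('i \<Rightarrow>\<^sub>0 'k)) \<Rightarrow> ('i \<Rightarrow>\<^sub>0 'k) \<Rightarrow> ('i \<Rightarrow>\<^sub>0 'k)"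
  where "conv f g x = lin_ext (\<lambda>(a, b). f a \<otimes> g b) (comult H x)"

lemma linear_on_closed: "linear_on H H f \<Longrightarrow> x \<in> carrier H \<Longrightarrow> f x \<in> carrier H"
  by (auto simp: linear_on_def)

lemma linear_from_mult_left:
  assumes "linear_on H H f" "y \<in> carrier H"
  shows "linear_from H (\<lambda>x. f x \<otimes> y)" "linear_from H (\<lambda>x. y \<otimes> f x)"
  using assms linear_mult_left[of y] linear_mult_right[of y]
  by (auto simp: linear_from_def linear_on_endo add_eq smult_eq Pi_iff)

text \<open>Convolution of linear maps depends only on the class of the coproduct. This licenses
  replacing it by a homogeneous representative, or by one supported in a subspace.\<close>

lemma conv_tensor_eq:
  assumes "linear_on H H f" "linear_on H H g" "tensor_eq H s t"
  shows "lin_ext (\<lambda>(a, b). f a \<otimes> g b) s = lin_ext (\<lambda>(a, b). f a \<otimes> g b) t"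
proof (rule tensor_eq_bilinear[OF assms(3)])
  show "linear_from H (\<lambda>a. f a \<otimes> g b)" if "b \<in> carrier H" for b
    by (rule linear_from_mult_left(1)[OF assms(1) linear_on_closed[OF assms(2) that]])
  show "linear_from H (\<lambda>b. f a \<otimes> g b)" if "a \<in> carrier H" for a
    by (rule linear_from_mult_left(2)[OF assms(2) linear_on_closed[OF assms(1) that]])
qed

lemma conv_closed:
  assumes "linear_on H H f" "linear_on H H g" "x \<in> carrier H"
  shows "conv f g x \<in> carrier H"
  unfolding conv_def using assms keys_comult
  by (intro lin_ext_carrier) (auto intro!: mult_closed linear_on_closed[OF assms(1)] linear_on_closed[OF assms(2)])

lemma linear_conv:
  assumes f: "linear_on H H f" and g: "linear_on H H g"
  shows "linear_on H H (conv f g)"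
  unfolding linear_on_endo
  using conv_tensor_eq[OF f g comult_add] conv_tensor_eq[OF f g comult_pscale] conv_closed[OF f g]
  by (auto simp: conv_def lin_ext_add lin_ext_pscale)

text \<open>Both sides evaluate the trilinear expression
  \<open>f a \<otimes> (g b \<otimes> h c)\<close> on the two iterated coproducts. These agree only
  in the tensor cube, and trilinearity carries the agreement over to H.\<close>

lemma conv_assoc:
  assumes f: "linear_on H H f" and g: "linear_on H H g" and h: "linear_on H H h"
    and x: "x \<in> carrier H"
  shows "conv (conv f g) h x = conv f (conv g h) x"
proof -
  note c = linear_on_closed[OF f] linear_on_closed[OF g] linear_on_closed[OF h]
  let ?B = "\<lambda>a b c. f a \<otimes> (g b \<otimes> h c)"
  have kx: "keys (comult H x) \<subseteq> carrier H \<times> carrier H" by (rule keys_comult[OF x])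
  have "conv (conv f g) h x
      = lin_ext (\<lambda>(a, c). lin_ext (\<lambda>(a', b). ?B a' b c) (comult H a)) (comult H x)"
    unfolding conv_def
  proof (intro lin_ext_cong, clarify)
    fix a d assume "(a, d) \<in> keys (comult H x)"
    then have "a \<in> carrier H" "d \<in> carrier H" using kx by auto
    note kd = keys_comult[OF this(1)] and hd = c(3)[OF this(2)]
    have "lin_ext (\<lambda>(a, b). f a \<otimes> g b) (comult H a) \<otimes> h d
       = lin_ext (\<lambda>p. (case p of (a, b) \<Rightarrow> f a \<otimes> g b) \<otimes> h d) (comult H a)"
      by (rule linear_on_lin_ext[OF linear_mult_left[OF hd]])
        (use kd in \<open>auto intro!: mult_closed c(1,2)\<close>)
    also have "\<dots> = lin_ext (\<lambda>(a', b). ?B a' b d) (comult H a)"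
      using kd hd by (intro lin_ext_cong) (auto intro!: mult_assoc c(1,2))
    finally show "lin_ext (\<lambda>(a, b). f a \<otimes> g b) (comult H a) \<otimes> h d
       = lin_ext (\<lambda>(a', b). ?B a' b d) (comult H a)" .
  qed
  also have "\<dots> = lin_ext (\<lambda>(a, b, c). ?B a b c)
      (lin_ext (\<lambda>(a, c). lin_ext (\<lambda>(a', b). tens3 a' b c) (comult H a)) (comult H x))"
    by (simp add: lin_ext_lin_ext case_prod_unfold)
  also have "\<dots> = lin_ext (\<lambda>(a, b, c). ?B a b c)
      (lin_ext (\<lambda>(a, c). lin_ext (\<lambda>(b, c'). tens3 a b c') (comult H c)) (comult H x))"
  proof (rule tensor3_eq_trilinear[OF coassoc[OF x]])
    fix b d assume bd: "b \<in> carrier H" "d \<in> carrier H"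
    show "linear_from H (\<lambda>a. ?B a b d)"
      by (rule linear_from_mult_left(1)[OF f]) (simp add: bd c mult_closed)
    have "linear_on H H (\<lambda>a. g a \<otimes> h d)" "linear_on H H (\<lambda>a. g b \<otimes> h a)"
      using g h c bd linear_mult_left[of "h d"] linear_mult_right[of "g b"]
      by (auto simp: linear_on_endo Pi_iff)
    from linear_from_mult_left(2)[OF this(1), of "f b"] linear_from_mult_left(2)[OF this(2), of "f d"]
    show "linear_from H (\<lambda>a. ?B b a d)" and "linear_from H (\<lambda>a. ?B d b a)"
      using bd c by simp_all
  qed
  also have "\<dots> = lin_ext (\<lambda>(a, c). lin_ext (\<lambda>(b, c'). ?B a b c') (comult H c)) (comult H x)"
    by (simp add: lin_ext_lin_ext case_prod_unfold)
  also have "\<dots> = conv f (conv g h) x"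
    unfolding conv_def
  proof (intro lin_ext_cong, clarify)
    fix a d assume "(a, d) \<in> keys (comult H x)"
    then have "a \<in> carrier H" "d \<in> carrier H" using kx by auto
    note kd = keys_comult[OF this(2)] and fa = c(1)[OF this(1)]
    have "f a \<otimes> lin_ext (\<lambda>(a, b). g a \<otimes> h b) (comult H d)
       = lin_ext (\<lambda>p. f a \<otimes> (case p of (a, b) \<Rightarrow> g a \<otimes> h b)) (comult H d)"
      by (rule linear_on_lin_ext[OF linear_mult_right[OF fa]])
        (use kd in \<open>auto intro!: mult_closed c(2,3)\<close>)
    then show "lin_ext (\<lambda>(b, c'). ?B a b c') (comult H d)
      = f a \<otimes> lin_ext (\<lambda>(a, b). g a \<otimes> h b) (comult H d)"
      by (simp add: case_prod_unfold)
  qed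
  finally show ?thesis .
qed

definition unit_counit :: "('i \<Rightarrow>\<^sub>0 'k) \<Rightarrow> ('i \<Rightarrow>\<^sub>0 'k)"
  where "unit_counit x = pscale (counit H x) \<one>"

lemma linear_unit_counit: "linear_on H H unit_counit"
  unfolding linear_on_endo unit_counit_def
  by (auto simp: counit_add counit_pscale one_closed free.scale_left_distrib
      intro: free.subspace_scale[OF subspace_carrier])

lemma conv_unit_right:
  assumes f: "linear_on H H f" and x: "x \<in> carrier H"
  shows "conv f unit_counit x = f x"
proof -
  have kx: "keys (comult H x) \<subseteq> carrier H \<times> carrier H" by (rule keys_comult[OF x])
  have "conv f unit_counit x = lin_ext (\<lambda>p. f (case p of (a, b) \<Rightarrow> pscale (counit H b) a)) (comult H x)"
    unfolding conv_def unit_counit_def using kx f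
    by (intro lin_ext_cong) (auto simp: mult_pscale mult_one one_closed linear_on_endo Pi_iff)
  also have "\<dots> = f (lin_ext (\<lambda>(a, b). pscale (counit H b) a) (comult H x))"
    using kx by (intro linear_on_lin_ext[OF f, symmetric])
      (auto intro: free.subspace_scale[OF subspace_carrier])
  finally show ?thesis by (simp add: counit_right x)
qed

lemma conv_unit_left:
  assumes f: "linear_on H H f" and x: "x \<in> carrier H"
  shows "conv unit_counit f x = f x"
proof -
  have kx: "keys (comult H x) \<subseteq> carrier H \<times> carrier H" by (rule keys_comult[OF x])
  have "conv unit_counit f x = lin_ext (\<lambda>p. f (case p of (a, b) \<Rightarrow> pscale (counit H a) b)) (comult H x)"
    unfolding conv_def unit_counit_def using kx f
    by (intro lin_ext_cong) (auto simp: pscale_mult mult_one one_closed linear_on_endo Pi_iff)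
  also have "\<dots> = f (lin_ext (\<lambda>(a, b). pscale (counit H a) b) (comult H x))"
    using kx by (intro linear_on_lin_ext[OF f, symmetric])
      (auto intro: free.subspace_scale[OF subspace_carrier])
  finally show ?thesis by (simp add: counit_left x)
qed

section \<open>Convolution powers of the augmentation\<close>

definition aug :: "('i \<Rightarrow>\<^sub>0 'k) \<Rightarrow> ('i \<Rightarrow>\<^sub>0 'k)"
  where "aug x = x - unit_counit x"

fun cpow :: "nat \<Rightarrow> ('i \<Rightarrow>\<^sub>0 'k) \<Rightarrow> ('i \<Rightarrow>\<^sub>0 'k)"
  where "cpow 0 = unit_counit" | "cpow (Suc k) = conv (cpow k) aug"

lemma linear_aug: "linear_on H H aug"
  using linear_unit_counit unfolding linear_on_endo aug_def
  by (auto simp: algebra_simps free.scale_right_diff_distrib intro!: free.subspace_diff[OF subspace_carrier])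

lemma linear_cpow: "linear_on H H (cpow k)"
  by (induction k) (simp_all add: linear_unit_counit linear_conv linear_aug)

lemma conv_cong:
  "x \<in> carrier H \<Longrightarrow> (\<And>a. a \<in> carrier H \<Longrightarrow> f a = f' a) \<Longrightarrow> (\<And>a. a \<in> carrier H \<Longrightarrow> g a = g' a) \<Longrightarrow>
    conv f g x = conv f' g' x"
  unfolding conv_def using keys_comult[of x] by (intro lin_ext_cong) auto

text \<open>The powers grow by a factor \<open>aug\<close> on the right, whereas convolving the
  identity with a power from the left produces the factor on the left.\<close>

lemma cpow_commute: "x \<in> carrier H \<Longrightarrow> conv aug (cpow k) x = cpow (Suc k) x"
proof (induction k arbitrary: x)
  case 0
  then show ?case by (simp add: conv_unit_left conv_unit_right linear_aug)
next
  case (Suc k)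
  have "conv aug (cpow (Suc k)) x = conv (conv aug (cpow k)) aug x"
    using Suc.prems by (simp add: conv_assoc linear_aug linear_cpow)
  also have "\<dots> = conv (cpow (Suc k)) aug x"
    using Suc by (intro conv_cong) auto
  finally show ?case by simp
qed

lemma aug_grade: "x \<in> grade H n \<Longrightarrow> aug x \<in> grade H n"
  using connected[of x] counit_graded[of x n]
  by (cases "n = 0") (auto simp: aug_def unit_counit_def intro: free.subspace_0[OF subspace_grade])

lemma aug_grade_0: "x \<in> grade H 0 \<Longrightarrow> aug x = 0"
  using connected[of x] by (simp add: aug_def unit_counit_def)

lemma unit_counit_grade: "x \<in> grade H n \<Longrightarrow> unit_counit x \<in> grade H n"
  using counit_graded[of x n] one_graded
  by (cases "n = 0") (auto simp: unit_counit_def intro: free.subspace_0[OF subspace_grade]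
      free.subspace_scale[OF subspace_grade])

lemma cpow_grade: "x \<in> grade H n \<Longrightarrow> cpow k x \<in> grade H n"
proof (induction k arbitrary: x n)
  case 0
  then show ?case by (simp add: unit_counit_grade)
next
  case (Suc k)
  obtain t where t: "keys t \<subseteq> (\<Union>p\<le>n. grade H p \<times> grade H (n - p))" "tensor_eq H (comult H x) t"
    using comult_graded[OF Suc.prems] by blast
  have "cpow (Suc k) x = lin_ext (\<lambda>(a, b). cpow k a \<otimes> aug b) t"
    using conv_tensor_eq[OF linear_cpow linear_aug t(2)] by (simp add: conv_def)
  also have "\<dots> \<in> grade H n"
  proof (rule lin_ext_mem_subspace[OF subspace_grade], clarify)
    fix a b assume "(a, b) \<in> keys t"
    then obtain p where "p \<le> n" "a \<in> grade H p" "b \<in> grade H (n - p)" using t(1) by auto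
    then show "cpow k a \<otimes> aug b \<in> grade H n"
      using mult_graded[OF Suc.IH aug_grade] by fastforce
  qed
  finally show ?case .
qed

text \<open>\<^term>\<open>aug\<close> kills degree \<open>0\<close>, so its \<open>k\<close>-th convolution power kills every degree below \<open>k\<close>:
  the geometric series for the convolution inverse of the identity is locally finite.\<close>

lemma cpow_grade_zero: "x \<in> grade H n \<Longrightarrow> n < k \<Longrightarrow> cpow k x = 0"
proof (induction k arbitrary: x n)
  case (Suc k)
  obtain t where t: "keys t \<subseteq> (\<Union>p\<le>n. grade H p \<times> grade H (n - p))" "tensor_eq H (comult H x) t"
    using comult_graded[OF Suc.prems(1)] by blast
  have "cpow (Suc k) x = lin_ext (\<lambda>(a, b). cpow k a \<otimes> aug b) t"
    using conv_tensor_eq[OF linear_cpow linear_aug t(2)] by (simp add: conv_def)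
  also have "\<dots> = lin_ext (\<lambda>_. 0) t"
  proof (rule lin_ext_cong, clarify)
    fix a b assume "(a, b) \<in> keys t"
    then obtain p where p: "p \<le> n" "a \<in> grade H p" "b \<in> grade H (n - p)" using t(1) by auto
    then have c: "cpow k a \<in> carrier H" "aug b \<in> carrier H"
      using cpow_grade aug_grade grade_subset_carrier by blast+
    have "0 \<otimes> aug b = 0" "cpow k a \<otimes> 0 = 0"
      using pscale_mult[of 0 "aug b" 0] mult_pscale[of "cpow k a" 0 0] c
        free.subspace_0[OF subspace_carrier] by simp_all
    \<comment> \<open>Since n \<le> k, a left factor of degree at least k leaves degree 0 for the
      right factor, where \<open>aug\<close> vanishes.\<close>
    moreover have "p < k \<or> n - p = 0" using Suc.prems(2) p(1) by linarith
    ultimately show "cpow k a \<otimes> aug b = 0"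
      using p Suc.IH[of a p] aug_grade_0[of b] by fastforce
  qed
  finally show ?case by simp
qed simp

section \<open>The geometric series for the antipode\<close>

definition sapprox :: "nat \<Rightarrow> ('i \<Rightarrow>\<^sub>0 'k) \<Rightarrow> ('i \<Rightarrow>\<^sub>0 'k)"
  where "sapprox M x = (\<Sum>k\<le>M. pscale ((- 1) ^ k) (cpow k x))"

text \<open>The inserted 0 gives \<open>Max\<close> a nonempty set, and the zero vector the value
  0.\<close>

definition maxdeg :: "('i \<Rightarrow>\<^sub>0 'k) \<Rightarrow> nat"
  where "maxdeg x = Max (insert 0 (deg ` keys x))"

definition antip :: "('i \<Rightarrow>\<^sub>0 'k) \<Rightarrow> ('i \<Rightarrow>\<^sub>0 'k)"
  where "antip x = sapprox (maxdeg x) x"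

lemma cpow_zero: "x \<in> carrier H \<Longrightarrow> maxdeg x < k \<Longrightarrow> cpow k x = 0"
proof -
  assume x: "x \<in> carrier H" and k: "maxdeg x < k"
  have "cpow k (lin_ext (\<lambda>i. single i 1) x) = lin_ext (\<lambda>i. cpow k (single i 1)) x"
    using x by (intro linear_on_lin_ext linear_cpow) (auto simp: carrier_eq)
  also have "\<dots> = lin_ext (\<lambda>_. 0) x"
  proof (rule lin_ext_cong)
    fix i assume i: "i \<in> keys x"
    then have "deg i \<le> maxdeg x" by (simp add: maxdeg_def)
    then show "cpow k (single i 1) = 0"
      using i x k cpow_grade_zero[OF single_grade[of i 1]] by (auto simp: carrier_eq)
  qed
  finally show ?thesis by simp
qed

text \<open>Terms beyond the largest degree vanish, so the truncation may be lengthened at will. The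
  length in \<open>antip\<close> depends on the vector; linearity is proved by passing to a common
  one.\<close>

lemma antip_eq: "x \<in> carrier H \<Longrightarrow> maxdeg x \<le> M \<Longrightarrow> antip x = sapprox M x"
  unfolding antip_def sapprox_def
  by (rule sum.mono_neutral_left) (auto simp: cpow_zero)

lemma linear_sapprox: "linear_on H H (sapprox M)"
  using linear_cpow unfolding linear_on_endo sapprox_def
  by (auto simp: sum.distrib free.scale_right_distrib free.scale_sum_right mult.commute Pi_iff
      intro!: free.subspace_sum[OF subspace_carrier] free.subspace_scale[OF subspace_carrier])

lemma linear_antip: "linear_on H H antip"
  unfolding linear_on_endo
proof (intro conjI ballI allI)
  show "antip \<in> carrier H \<rightarrow> carrier H"
    by (auto simp: antip_def intro: linear_on_closed[OF linear_sapprox])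
  fix x y assume xy: "x \<in> carrier H" "y \<in> carrier H"
  define M where "M = max (maxdeg (x + y)) (max (maxdeg x) (maxdeg y))"
  have "antip (x + y) = sapprox M (x + y)" "antip x = sapprox M x" "antip y = sapprox M y"
    using xy by (auto simp: M_def intro!: antip_eq free.subspace_add[OF subspace_carrier])
  then show "antip (x + y) = antip x + antip y"
    using linear_sapprox xy by (simp add: linear_on_endo)
next
  fix r x assume x: "x \<in> carrier H"
  define M where "M = max (maxdeg (pscale r x)) (maxdeg x)"
  have "antip (pscale r x) = sapprox M (pscale r x)" "antip x = sapprox M x"
    using x by (auto simp: M_def intro!: antip_eq free.subspace_scale[OF subspace_carrier])
  then show "antip (pscale r x) = pscale r (antip x)"
    using linear_sapprox x by (simp add: linear_on_endo)
qed

text \<open>For u k the k-th convolution power of \<open>aug\<close> at x, the summands are the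
  convolutions with the identity; what survives is the convolution unit and a power of too high an
  order.\<close>

lemma telescope: "(\<Sum>k\<le>M. pscale ((- 1) ^ k) (u k + u (Suc k))) = u 0 + pscale ((- 1) ^ M) (u (Suc M))"
  by (induction M) (simp_all add: free.scale_right_distrib)

lemma conv_add_right:
  assumes "linear_on H H f" "linear_on H H g" "linear_on H H h" "x \<in> carrier H"
  shows "conv f (\<lambda>a. g a + h a) x = conv f g x + conv f h x"
proof -
  have "conv f (\<lambda>a. g a + h a) x
      = lin_ext (\<lambda>p. (case p of (a, b) \<Rightarrow> f a \<otimes> g b) + (case p of (a, b) \<Rightarrow> f a \<otimes> h b)) (comult H x)"
    unfolding conv_def using assms(1-3) keys_comult[OF assms(4)] linear_mult_right
    by (intro lin_ext_cong) (auto simp: linear_on_endo Pi_iff)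
  then show ?thesis by (simp add: lin_ext_fun_add conv_def)
qed

lemma conv_add_left:
  assumes "linear_on H H f" "linear_on H H g" "linear_on H H h" "x \<in> carrier H"
  shows "conv (\<lambda>a. g a + h a) f x = conv g f x + conv h f x"
proof -
  have "conv (\<lambda>a. g a + h a) f x
      = lin_ext (\<lambda>p. (case p of (a, b) \<Rightarrow> g a \<otimes> f b) + (case p of (a, b) \<Rightarrow> h a \<otimes> f b)) (comult H x)"
    unfolding conv_def using assms(1-3) keys_comult[OF assms(4)] linear_mult_left
    by (intro lin_ext_cong) (auto simp: linear_on_endo Pi_iff)
  then show ?thesis by (simp add: lin_ext_fun_add conv_def)
qed

text \<open>The identity is the convolution unit plus \<open>aug\<close>, so convolving with it adds
  the next power.\<close>

lemma cpow_id:
  assumes "x \<in> carrier H"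
  shows "conv (cpow k) (\<lambda>x. x) x = cpow k x + cpow (Suc k) x"
    and "conv (\<lambda>x. x) (cpow k) x = cpow k x + cpow (Suc k) x"
proof -
  have id: "(\<lambda>x. x) = (\<lambda>x. unit_counit x + aug x)" by (simp add: aug_def)
  show "conv (cpow k) (\<lambda>x. x) x = cpow k x + cpow (Suc k) x"
    by (subst id) (simp add: conv_add_right linear_cpow linear_aug linear_unit_counit assms conv_unit_right)
  show "conv (\<lambda>x. x) (cpow k) x = cpow k x + cpow (Suc k) x"
    by (subst id) (simp add: conv_add_left linear_cpow linear_aug linear_unit_counit assms
        conv_unit_left cpow_commute del: cpow.simps)
qed

lemma ex_degree_bound: "finite A \<Longrightarrow> \<exists>M. \<forall>a\<in>A. maxdeg a \<le> M"
  by (metis finite_imageI finite_nat_set_iff_bounded_le imageI)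

lemma conv_antip_left:
  assumes x: "x \<in> carrier H"
  shows "conv antip (\<lambda>x. x) x = unit_counit x"
proof -
  have kx: "keys (comult H x) \<subseteq> carrier H \<times> carrier H" by (rule keys_comult[OF x])
  \<comment> \<open>The bound covers the left factors, so that one truncation serves for all of
    them, and also x itself, so that the last term of the telescoping sum vanishes.\<close>
  obtain M where M: "\<forall>a\<in>insert x (fst ` keys (comult H x)). maxdeg a \<le> M"
    using ex_degree_bound[of "insert x (fst ` keys (comult H x))"] by auto
  have "conv antip (\<lambda>x. x) x
      = lin_ext (\<lambda>p. \<Sum>k\<le>M. pscale ((- 1) ^ k) (case p of (a, b) \<Rightarrow> cpow k a \<otimes> b)) (comult H x)"
    unfolding conv_def
  proof (rule lin_ext_cong, clarify)
    fix a b assume ab: "(a, b) \<in> keys (comult H x)"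
    then have c: "a \<in> carrier H" "b \<in> carrier H" using kx by auto
    have "maxdeg a \<le> M" using M ab by force
    \<comment> \<open>The alternating sum is written as the extension of a map on exponents, which
      lets \<open>linear_on_lin_ext\<close> distribute the product over it.\<close>
    then have "antip a \<otimes> b = lin_ext (\<lambda>k. cpow k a) (\<Sum>k\<le>M. single k ((- 1) ^ k)) \<otimes> b"
      using c by (simp add: antip_eq sapprox_def lin_ext_sum)
    also have "\<dots> = lin_ext (\<lambda>k. cpow k a \<otimes> b) (\<Sum>k\<le>M. single k ((- 1) ^ k))"
      by (rule linear_on_lin_ext[OF linear_mult_left]) (use c in \<open>auto intro: linear_on_closed[OF linear_cpow]\<close>)
    finally show "antip a \<otimes> b = (\<Sum>k\<le>M. pscale ((- 1) ^ k) (cpow k a \<otimes> b))"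
      by (simp add: lin_ext_sum)
  qed
  also have "\<dots> = (\<Sum>k\<le>M. pscale ((- 1) ^ k) (conv (cpow k) (\<lambda>x. x) x))"
    by (simp add: lin_ext_fun_sum lin_ext_fun_pscale conv_def)
  also have "\<dots> = unit_counit x"
    using M x telescope[of "\<lambda>k. cpow k x" M] by (simp add: cpow_id cpow_zero del: cpow.simps(2))
  finally show ?thesis .
qed

lemma conv_antip_right:
  assumes x: "x \<in> carrier H"
  shows "conv (\<lambda>x. x) antip x = unit_counit x"
proof -
  have kx: "keys (comult H x) \<subseteq> carrier H \<times> carrier H" by (rule keys_comult[OF x])
  obtain M where M: "\<forall>a\<in>insert x (snd ` keys (comult H x)). maxdeg a \<le> M"
    using ex_degree_bound[of "insert x (snd ` keys (comult H x))"] by auto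
  have "conv (\<lambda>x. x) antip x
      = lin_ext (\<lambda>p. \<Sum>k\<le>M. pscale ((- 1) ^ k) (case p of (a, b) \<Rightarrow> a \<otimes> cpow k b)) (comult H x)"
    unfolding conv_def
  proof (rule lin_ext_cong, clarify)
    fix a b assume ab: "(a, b) \<in> keys (comult H x)"
    then have c: "a \<in> carrier H" "b \<in> carrier H" using kx by auto
    have "maxdeg b \<le> M" using M ab by force
    then have "a \<otimes> antip b = a \<otimes> lin_ext (\<lambda>k. cpow k b) (\<Sum>k\<le>M. single k ((- 1) ^ k))"
      using c by (simp add: antip_eq sapprox_def lin_ext_sum)
    also have "\<dots> = lin_ext (\<lambda>k. a \<otimes> cpow k b) (\<Sum>k\<le>M. single k ((- 1) ^ k))"
      by (rule linear_on_lin_ext[OF linear_mult_right]) (use c in \<open>auto intro: linear_on_closed[OF linear_cpow]\<close>)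
    finally show "a \<otimes> antip b = (\<Sum>k\<le>M. pscale ((- 1) ^ k) (a \<otimes> cpow k b))"
      by (simp add: lin_ext_sum)
  qed
  also have "\<dots> = (\<Sum>k\<le>M. pscale ((- 1) ^ k) (conv (\<lambda>x. x) (cpow k) x))"
    by (simp add: lin_ext_fun_sum lin_ext_fun_pscale conv_def)
  also have "\<dots> = unit_counit x"
    using M x telescope[of "\<lambda>k. cpow k x" M] by (simp add: cpow_id cpow_zero del: cpow.simps(2))
  finally show ?thesis .
qed

lemma is_antipode_antip: "is_antipode H antip"
  unfolding is_antipode_def
proof (intro conjI ballI linear_antip)
  fix x assume x: "x \<in> carrier H"
  then have kx: "keys (comult H x) \<subseteq> carrier H \<times> carrier H" by (rule keys_comult)
  have "leval H (\<lambda>(a, b). antip a \<otimes> b) (comult H x) = conv antip (\<lambda>x. x) x"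
    unfolding conv_def using kx
    by (intro leval_eq_lin_ext) (auto intro!: mult_closed linear_on_closed[OF linear_antip])
  then show "leval H (\<lambda>(a, b). antip a \<otimes> b) (comult H x) = counit H x \<odot> \<one>"
    using x by (simp add: conv_antip_left unit_counit_def smult_eq)
  have "leval H (\<lambda>(a, b). a \<otimes> antip b) (comult H x) = conv (\<lambda>x. x) antip x"
    unfolding conv_def using kx
    by (intro leval_eq_lin_ext) (auto intro!: mult_closed linear_on_closed[OF linear_antip])
  then show "leval H (\<lambda>(a, b). a \<otimes> antip b) (comult H x) = counit H x \<odot> \<one>"
    using x by (simp add: conv_antip_right unit_counit_def smult_eq)
qed

lemma hopf_algebra: "hopf_algebra H"
  using bialgebra is_antipode_antip by (auto simp: hopf_algebra_def)

lemma antip_grade: "x \<in> grade H n \<Longrightarrow> antip x \<in> grade H n"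
  unfolding antip_def sapprox_def
  by (intro free.subspace_sum[OF subspace_grade] free.subspace_scale[OF subspace_grade] cpow_grade)

lemma antip_closed: "x \<in> carrier H \<Longrightarrow> antip x \<in> carrier H"
  by (rule linear_on_closed[OF linear_antip])

lemma antip_subspace:
  assumes D: "free.subspace D" "\<one> \<in> D" "\<And>x y. x \<in> D \<Longrightarrow> y \<in> D \<Longrightarrow> x \<otimes> y \<in> D"
    and comult: "\<And>x. x \<in> D \<Longrightarrow> \<exists>t. keys t \<subseteq> D \<times> D \<and> tensor_eq H (comult H x) t"
    and x: "x \<in> D"
  shows "antip x \<in> D"
proof -
  have uc: "unit_counit x \<in> D" for x
    by (simp add: unit_counit_def D(2) free.subspace_scale[OF D(1)])
  have cp: "cpow k x \<in> D" if "x \<in> D" for k x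
    using that
  proof (induction k arbitrary: x)
    case 0
    then show ?case by (simp add: uc)
  next
    case (Suc k)
    obtain t where t: "keys t \<subseteq> D \<times> D" "tensor_eq H (comult H x) t"
      using comult[OF Suc.prems] by blast
    \<comment> \<open>Convolution sees only the class of the coproduct, so the representative
      supported in D may be used.\<close>
    have "cpow (Suc k) x = lin_ext (\<lambda>(a, b). cpow k a \<otimes> aug b) t"
      using conv_tensor_eq[OF linear_cpow linear_aug t(2)] by (simp add: conv_def)
    also have "\<dots> \<in> D"
      using t(1) Suc.IH uc
      by (intro lin_ext_mem_subspace[OF D(1)])
        (auto simp: aug_def intro!: D(3) free.subspace_diff[OF D(1)])
    finally show ?case .
  qed
  show ?thesis
    unfolding antip_def sapprox_def
    by (intro free.subspace_sum[OF D(1)] free.subspace_scale[OF D(1)] cp x)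
qed

end

section \<open>The graded dual\<close>

lemma lsum_lookup_single: "lsum (\<lambda>a. lookup (single a 1) i) t = lookup t i"
  using lookup_lin_ext[of "\<lambda>a. single a 1" t i] by simp

lemma lookup_tens_product:
  "lookup (lin_ext (\<lambda>i. lin_ext (\<lambda>j. tens i j) u) v) (i, j) = lookup v i * lookup u j"
proof -
  have "lookup (lin_ext (\<lambda>i. lin_ext (\<lambda>j. tens i j) u) v) (i, j)
     = lsum (\<lambda>a. lsum (\<lambda>b. lookup (single a 1) i * lookup (single b 1) j) u) v"
    unfolding lookup_lin_ext by (intro lsum_cong) (auto simp: lookup_single when_def)
  then show ?thesis by (simp add: lsum_lookup_single flip: lsum_mult)
qed

lemma lookup_tens3_product:
  "lookup (lin_ext (\<lambda>i. lin_ext (\<lambda>j. lin_ext (\<lambda>k. tens3 i j k) w) u) v) (i, j, k)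
    = lookup v i * lookup u j * lookup w k"
proof -
  have "lookup (lin_ext (\<lambda>i. lin_ext (\<lambda>j. lin_ext (\<lambda>k. tens3 i j k) w) u) v) (i, j, k)
     = lsum (\<lambda>a. lsum (\<lambda>b. lsum (\<lambda>c. lookup (single a 1) i * lookup (single b 1) j * lookup (single c 1) k) w) u) v"
    unfolding lookup_lin_ext by (intro lsum_cong) (auto simp: lookup_single when_def)
  then show ?thesis by (simp add: lsum_lookup_single lsum_mult_left lsum_mult_right)
qed

context coordinates
begin

lemma lookup_cf2: "lookup (cf2 t) (i, j) = lsum (\<lambda>(a, b). lookup (cf a) i * lookup (cf b) j) t"
  unfolding cf2_def by (subst lookup_lin_ext) (simp add: lookup_tens_product case_prod_unfold)

lemma lookup_cf3:
  "lookup (cf3 t) (i, j, k) = lsum (\<lambda>(a, b, c). lookup (cf a) i * lookup (cf b) j * lookup (cf c) k) t"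
  unfolding cf3_def by (subst lookup_lin_ext) (simp add: lookup_tens3_product case_prod_unfold)

lemma tensor_eqI_lookup:
  assumes "keys s \<subseteq> carrier H \<times> carrier H" "keys t \<subseteq> carrier H \<times> carrier H"
    "\<And>i j. lsum (\<lambda>(a, b). lookup (cf a) i * lookup (cf b) j) s
         = lsum (\<lambda>(a, b). lookup (cf a) i * lookup (cf b) j) t"
  shows "tensor_eq H s t"
  using assms(1,2) by (rule tensor_eqI_cf2) (auto intro!: poly_mapping_eqI simp: lookup_cf2 assms(3))

lemma tensor3_eqI_lookup:
  assumes "keys s \<subseteq> carrier H \<times> carrier H \<times> carrier H"
    "keys t \<subseteq> carrier H \<times> carrier H \<times> carrier H"
    "\<And>i j k. lsum (\<lambda>(a, b, c). lookup (cf a) i * lookup (cf b) j * lookup (cf c) k) s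
         = lsum (\<lambda>(a, b, c). lookup (cf a) i * lookup (cf b) j * lookup (cf c) k) t"
  shows "tensor3_eq H s t"
  using assms(1,2) by (rule tensor3_eqI_cf3) (auto intro!: poly_mapping_eqI simp: lookup_cf3 assms(3))

end

section \<open>The operations of a graded dual\<close>

lemma mem_dual_iff:
  "\<phi> \<in> carrier (graded_dual K) \<longleftrightarrow> functional_on K \<phi> \<and> (\<forall>x. x \<notin> carrier K \<longrightarrow> \<phi> x = 0) \<and>
    finite {n. \<exists>x\<in>grade K n. \<phi> x \<noteq> 0}"
  by (simp add: graded_dual_def Let_def)

lemma dual_add [simp]: "\<phi> \<oplus>\<^bsub>graded_dual K\<^esub> \<psi> = (\<lambda>x. \<phi> x + \<psi> x)"
  by (simp add: graded_dual_def Let_def)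

lemma dual_smult [simp]: "r \<odot>\<^bsub>graded_dual K\<^esub> \<phi> = (\<lambda>x. r * \<phi> x)"
  by (simp add: graded_dual_def Let_def)

lemma dual_zero [simp]: "\<zero>\<^bsub>graded_dual K\<^esub> = (\<lambda>x. 0)"
  by (simp add: graded_dual_def Let_def)

lemma dual_one: "\<one>\<^bsub>graded_dual K\<^esub> = (\<lambda>x. if x \<in> carrier K then counit K x else 0)"
  by (simp add: graded_dual_def Let_def)

lemma dual_counit [simp]: "counit (graded_dual K) \<phi> = \<phi> \<one>\<^bsub>K\<^esub>"
  by (simp add: graded_dual_def Let_def)

lemma dual_mult: "\<phi> \<otimes>\<^bsub>graded_dual K\<^esub> \<psi> =
    (\<lambda>x. if x \<in> carrier K then lsum (\<lambda>(a, b). \<phi> a * \<psi> b) (comult K x) else 0)"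
  by (auto simp: graded_dual_def Let_def lsum_def case_prod_unfold)

lemma dual_grade:
  "grade (graded_dual K) n = {\<phi> \<in> carrier (graded_dual K). \<forall>k. k \<noteq> n \<longrightarrow> (\<forall>x\<in>grade K k. \<phi> x = 0)}"
  by (simp add: graded_dual_def Let_def)

text \<open>The coproduct of a functional is a \<open>SOME\<close>: exhibiting one representative
  \<open>t\<close> gives the chosen one the right support and the right values, which is all that
  later arguments rely on.\<close>

lemma dual_comult:
  assumes "keys t \<subseteq> carrier (graded_dual K) \<times> carrier (graded_dual K)"
    "\<And>x y. x \<in> carrier K \<Longrightarrow> y \<in> carrier K \<Longrightarrow> lsum (\<lambda>(f, g). f x * g y) t = \<phi> (x \<otimes>\<^bsub>K\<^esub> y)"
  shows "keys (comult (graded_dual K) \<phi>) \<subseteq> carrier (graded_dual K) \<times> carrier (graded_dual K)"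
    "\<And>x y. x \<in> carrier K \<Longrightarrow> y \<in> carrier K \<Longrightarrow>
      lsum (\<lambda>(f, g). f x * g y) (comult (graded_dual K) \<phi>) = \<phi> (x \<otimes>\<^bsub>K\<^esub> y)"
proof -
  let ?Q = "\<lambda>t. keys t \<subseteq> carrier (graded_dual K) \<times> carrier (graded_dual K) \<and>
    (\<forall>x\<in>carrier K. \<forall>y\<in>carrier K. lsum (\<lambda>(f, g). f x * g y) t = \<phi> (x \<otimes>\<^bsub>K\<^esub> y))"
  have "comult (graded_dual K) \<phi> = (SOME t. ?Q t)"
    by (simp add: graded_dual_def Let_def lsum_def case_prod_unfold)
  then have "?Q (comult (graded_dual K) \<phi>)"
    using someI[of ?Q t] assms by simp
  then show "keys (comult (graded_dual K) \<phi>) \<subseteq> carrier (graded_dual K) \<times> carrier (graded_dual K)"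
    "\<And>x y. x \<in> carrier K \<Longrightarrow> y \<in> carrier K \<Longrightarrow>
      lsum (\<lambda>(f, g). f x * g y) (comult (graded_dual K) \<phi>) = \<phi> (x \<otimes>\<^bsub>K\<^esub> y)"
    by auto
qed

lemma function_space_dual: "function_space (graded_dual K) (\<lambda>\<phi>. \<phi>)"
proof unfold_locales
  fix \<phi> \<psi> assume "\<phi> \<in> carrier (graded_dual K)" "\<psi> \<in> carrier (graded_dual K)"
  moreover have "{n. \<exists>x\<in>grade K n. \<phi> x + \<psi> x \<noteq> 0}
      \<subseteq> {n. \<exists>x\<in>grade K n. \<phi> x \<noteq> 0} \<union> {n. \<exists>x\<in>grade K n. \<psi> x \<noteq> 0}" by auto
  ultimately show "\<phi> \<oplus>\<^bsub>graded_dual K\<^esub> \<psi> \<in> carrier (graded_dual K)"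
    by (auto simp: mem_dual_iff functional_on_def algebra_simps intro: finite_subset)
next
  fix \<phi> r assume "\<phi> \<in> carrier (graded_dual K)"
  moreover have "{n. \<exists>x\<in>grade K n. r * \<phi> x \<noteq> 0} \<subseteq> {n. \<exists>x\<in>grade K n. \<phi> x \<noteq> 0}" by auto
  ultimately show "r \<odot>\<^bsub>graded_dual K\<^esub> \<phi> \<in> carrier (graded_dual K)"
    by (auto simp: mem_dual_iff functional_on_def algebra_simps intro: finite_subset)
qed (auto simp: mem_dual_iff functional_on_def)

text \<open>Fubini for four finite sums: the sums over the coproducts of two functionals change
  places with those over the coproducts of two vectors.\<close>

lemma lsum_swap4:
  "lsum (\<lambda>p. lsum (\<lambda>q. lsum (\<lambda>r. lsum (h p q r) S) R) Q) T
    = lsum (\<lambda>r. lsum (\<lambda>s. lsum (\<lambda>p. lsum (\<lambda>q. h p q r s) Q) T) S) R"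
proof -
  have "lsum (\<lambda>p. lsum (\<lambda>q. lsum (\<lambda>r. lsum (h p q r) S) R) Q) T
      = lsum (\<lambda>p. lsum (\<lambda>r. lsum (\<lambda>q. lsum (h p q r) S) Q) R) T"
    by (intro lsum_cong lsum_swap)
  also have "\<dots> = lsum (\<lambda>r. lsum (\<lambda>p. lsum (\<lambda>q. lsum (h p q r) S) Q) T) R"
    by (rule lsum_swap)
  also have "\<dots> = lsum (\<lambda>r. lsum (\<lambda>p. lsum (\<lambda>s. lsum (\<lambda>q. h p q r s) Q) S) T) R"
    by (intro lsum_cong lsum_swap)
  also have "\<dots> = lsum (\<lambda>r. lsum (\<lambda>s. lsum (\<lambda>p. lsum (\<lambda>q. h p q r s) Q) T) S) R"
    by (intro lsum_cong lsum_swap)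
  finally show ?thesis .
qed

context free_space
begin

lemma functional_on_lin_ext:
  assumes "functional_on H \<phi>" "\<And>a. a \<in> keys t \<Longrightarrow> f a \<in> carrier H"
  shows "\<phi> (lin_ext f t) = lsum (\<lambda>a. \<phi> (f a)) t"
  using functional_on_leval[OF assms(1), of t f] leval_eq_lin_ext[of t f] assms(2) by simp

lemma functional_on_expand:
  assumes "functional_on H \<phi>" "x \<in> carrier H"
  shows "\<phi> x = lsum (\<lambda>i. \<phi> (single i 1)) x"
  using functional_on_lin_ext[OF assms(1), of x "\<lambda>i. single i 1"] assms(2) by (auto simp: carrier_eq)

end

section \<open>Functionals of bounded degree and the dual basis\<close>

context connected_bialgebra
begin

abbreviation V :: "('k, ('i \<Rightarrow>\<^sub>0 'k) \<Rightarrow> 'k) hopf" where "V \<equiv> graded_dual H"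

sublocale dual: function_space V "\<lambda>\<phi>. \<phi>"
  by (rule function_space_dual)

definition dbasis :: "'i \<Rightarrow> ('i \<Rightarrow>\<^sub>0 'k) \<Rightarrow> 'k"
  where "dbasis i = (\<lambda>x. if x \<in> carrier H then lookup x i else 0)"

lemma dual_functional: "\<phi> \<in> carrier V \<Longrightarrow> functional_on H \<phi>"
  by (simp add: mem_dual_iff)

lemma dual_outside: "\<phi> \<in> carrier V \<Longrightarrow> x \<notin> carrier H \<Longrightarrow> \<phi> x = 0"
  by (simp add: mem_dual_iff)

lemma dual_leval_eqI:
  assumes c: "\<chi> \<in> carrier V" "\<And>a. a \<in> keys t \<Longrightarrow> f a \<in> carrier V"
    and ev: "\<And>x. x \<in> carrier H \<Longrightarrow> \<chi> x = lsum (\<lambda>a. f a x) t"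
  shows "leval V f t = \<chi>"
proof (rule dual.leval_eqI[OF c])
  show "\<chi> x = lsum (\<lambda>a. f a x) t" for x
  proof (cases "x \<in> carrier H")
    case False
    then have "lsum (\<lambda>a. f a x) t = lsum (\<lambda>_. 0) t"
      using dual_outside[OF c(2)] by (intro lsum_cong) auto
    then show ?thesis using dual_outside[OF c(1) False] by simp
  qed (rule ev)
qed

lemma dual_bound: "\<phi> \<in> carrier V \<Longrightarrow> \<exists>N. \<forall>n\<ge>N. \<forall>x\<in>grade H n. \<phi> x = 0"
proof -
  assume "\<phi> \<in> carrier V"
  then have "finite {n. \<exists>x\<in>grade H n. \<phi> x \<noteq> 0}" by (simp add: mem_dual_iff)
  then obtain N where "{n. \<exists>x\<in>grade H n. \<phi> x \<noteq> 0} \<subseteq> {..<N}"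
    using finite_nat_iff_bounded by auto
  then show ?thesis by (intro exI[of _ N]) (auto simp: subset_iff not_less)
qed

lemma mem_dualI:
  assumes "functional_on H \<phi>" "\<And>x. x \<notin> carrier H \<Longrightarrow> \<phi> x = 0"
    "\<And>n x. n \<ge> N \<Longrightarrow> x \<in> grade H n \<Longrightarrow> \<phi> x = 0"
  shows "\<phi> \<in> carrier V"
proof -
  have "n < N" if "x \<in> grade H n" "\<phi> x \<noteq> 0" for n x
    using assms(3)[of n x] that by (cases "n < N") auto
  then have "{n. \<exists>x\<in>grade H n. \<phi> x \<noteq> 0} \<subseteq> {..<N}" by auto
  then show ?thesis using assms(1,2) by (auto simp: mem_dual_iff intro: finite_subset)
qed

lemma dbasis_closed: "dbasis i \<in> carrier V"
proof (rule mem_dualI[where N = "Suc (deg i)"])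
  show "functional_on H (dbasis i)"
    by (auto simp: functional_on_def dbasis_def add_closed smult_closed)
      (simp_all add: add_eq smult_eq lookup_add)
  show "dbasis i x = 0" if "x \<notin> carrier H" for x using that by (simp add: dbasis_def)
  show "dbasis i x = 0" if "n \<ge> Suc (deg i)" "x \<in> grade H n" for n x
    using that by (auto simp: dbasis_def grade_eq in_keys_iff)
qed

lemma finite_below: "finite {i \<in> I. deg i < N}"
proof -
  have "{i \<in> I. deg i < N} = (\<Union>n<N. {i \<in> I. deg i = n})" by auto
  then show ?thesis by (simp add: finite_deg)
qed

lemma dual_finite_support: "\<phi> \<in> carrier V \<Longrightarrow> finite {i \<in> I. \<phi> (single i 1) \<noteq> 0}"
proof -
  assume "\<phi> \<in> carrier V"
  then obtain N where "\<forall>n\<ge>N. \<forall>x\<in>grade H n. \<phi> x = 0" using dual_bound by blast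
  then have "deg i < N" if "i \<in> I" "\<phi> (single i 1) \<noteq> 0" for i
    using single_grade[OF that(1), of 1] that(2) by (cases "deg i < N") (auto simp: not_less)
  then have "{i \<in> I. \<phi> (single i 1) \<noteq> 0} \<subseteq> {i \<in> I. deg i < N}" by auto
  then show ?thesis using finite_below finite_subset by blast
qed

text \<open>Coefficients over the dual basis. Only finitely many are nonzero, because an element of
  the graded dual vanishes in large degrees and the remaining degrees have finitely many basis
  vectors.\<close>

definition dcf :: "(('i \<Rightarrow>\<^sub>0 'k) \<Rightarrow> 'k) \<Rightarrow> ('i \<Rightarrow>\<^sub>0 'k)"
  where "dcf \<phi> = Abs_poly_mapping (\<lambda>i. if i \<in> I then \<phi> (single i 1) else 0)"

lemma lookup_dcf: "\<phi> \<in> carrier V \<Longrightarrow> lookup (dcf \<phi>) i = (if i \<in> I then \<phi> (single i 1) else 0)"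
  unfolding dcf_def using dual_finite_support[of \<phi>]
  by (subst lookup_Abs_poly_mapping) (auto elim: rev_finite_subset)

lemma dual_expand:
  assumes \<phi>: "\<phi> \<in> carrier V"
  shows "\<phi> x = lsum (\<lambda>i. dbasis i x) (dcf \<phi>)"
proof (cases "x \<in> carrier H")
  case True
  let ?A = "keys x \<union> keys (dcf \<phi>)"
  have "\<phi> x = (\<Sum>i\<in>?A. lookup x i * \<phi> (single i 1))"
    using functional_on_expand[OF dual_functional[OF \<phi>] True] by (simp add: lsum_superset[of ?A])
  also have "\<dots> = (\<Sum>i\<in>?A. lookup (dcf \<phi>) i * dbasis i x)"
  proof (rule sum.cong)
    fix i assume "i \<in> ?A"
    show "lookup x i * \<phi> (single i 1) = lookup (dcf \<phi>) i * dbasis i x"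
      using True by (cases "i \<in> I") (auto simp: lookup_dcf[OF \<phi>] dbasis_def carrier_eq in_keys_iff)
  qed simp
  finally show ?thesis by (simp add: lsum_superset[of ?A])
qed (simp add: dual_outside[OF \<phi>] dbasis_def)

sublocale dual: coordinates V "\<lambda>\<phi>. \<phi>" dbasis dcf
proof unfold_locales
  show "leval V dbasis (dcf \<phi>) = \<phi>" if "\<phi> \<in> carrier V" for \<phi>
    using that dual_expand[OF that] by (intro dual.leval_eqI) (auto simp: dbasis_closed)
qed (simp add: dbasis_closed)

text \<open>The coefficients of a functional over the dual basis are its values at basis vectors, so
  evaluation at pairs of vectors separates tensors of functionals. All identities for the dual
  coproduct are proved this way.\<close>

lemma dual_tensor_eqI:
  assumes k: "keys s \<subseteq> carrier V \<times> carrier V" "keys t \<subseteq> carrier V \<times> carrier V"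
    and ev: "\<And>x y. x \<in> carrier H \<Longrightarrow> y \<in> carrier H \<Longrightarrow>
      lsum (\<lambda>(f, g). f x * g y) s = lsum (\<lambda>(f, g). f x * g y) t"
  shows "tensor_eq V s t"
proof (rule dual.tensor_eqI_lookup[OF k])
  fix i j
  have *: "lsum (\<lambda>(a, b). lookup (dcf a) i * lookup (dcf b) j) u
      = (if i \<in> I \<and> j \<in> I then lsum (\<lambda>(f, g). f (single i 1) * g (single j 1)) u else 0)"
    if "keys u \<subseteq> carrier V \<times> carrier V" for u
  proof -
    have "lsum (\<lambda>(a, b). lookup (dcf a) i * lookup (dcf b) j) u = lsum (\<lambda>(a, b).
        (if i \<in> I then a (single i 1) else 0) * (if j \<in> I then b (single j 1) else 0)) u"
      using that by (intro lsum_cong) (auto simp: lookup_dcf)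
    then show ?thesis by (auto simp: case_prod_unfold)
  qed
  show "lsum (\<lambda>(a, b). lookup (dcf a) i * lookup (dcf b) j) s
      = lsum (\<lambda>(a, b). lookup (dcf a) i * lookup (dcf b) j) t"
    unfolding *[OF k(1)] *[OF k(2)] by (auto simp: ev single_carrier)
qed

lemma dual_tensor3_eqI:
  assumes k: "keys s \<subseteq> carrier V \<times> carrier V \<times> carrier V" "keys t \<subseteq> carrier V \<times> carrier V \<times> carrier V"
    and ev: "\<And>x y z. x \<in> carrier H \<Longrightarrow> y \<in> carrier H \<Longrightarrow> z \<in> carrier H \<Longrightarrow>
      lsum (\<lambda>(f, g, h). f x * g y * h z) s = lsum (\<lambda>(f, g, h). f x * g y * h z) t"
  shows "tensor3_eq V s t"
proof (rule dual.tensor3_eqI_lookup[OF k])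
  fix i j l
  have *: "lsum (\<lambda>(a, b, c). lookup (dcf a) i * lookup (dcf b) j * lookup (dcf c) l) u
      = (if i \<in> I \<and> j \<in> I \<and> l \<in> I
         then lsum (\<lambda>(f, g, h). f (single i 1) * g (single j 1) * h (single l 1)) u else 0)"
    if "keys u \<subseteq> carrier V \<times> carrier V \<times> carrier V" for u
  proof -
    have "lsum (\<lambda>(a, b, c). lookup (dcf a) i * lookup (dcf b) j * lookup (dcf c) l) u = lsum (\<lambda>(a, b, c).
        (if i \<in> I then a (single i 1) else 0) * (if j \<in> I then b (single j 1) else 0) *
        (if l \<in> I then c (single l 1) else 0)) u"
      using that by (intro lsum_cong) (auto simp: lookup_dcf)
    then show ?thesis by (auto simp: case_prod_unfold)
  qed
  show "lsum (\<lambda>(a, b, c). lookup (dcf a) i * lookup (dcf b) j * lookup (dcf c) l) s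
      = lsum (\<lambda>(a, b, c). lookup (dcf a) i * lookup (dcf b) j * lookup (dcf c) l) t"
    unfolding *[OF k(1)] *[OF k(2)] by (auto simp: ev single_carrier)
qed

section \<open>The transpose of the product\<close>

lemma functional_mult_expand:
  assumes "functional_on H \<phi>" "x \<in> carrier H" "y \<in> carrier H"
  shows "\<phi> (x \<otimes> y) = lsum (\<lambda>i. lsum (\<lambda>j. \<phi> (single i 1 \<otimes> single j 1)) y) x"
proof -
  have "functional_on H (\<lambda>z. \<phi> (z \<otimes> y))"
    using assms linear_mult_left[of y]
    by (auto simp: functional_on_def linear_on_endo add_eq smult_eq Pi_iff)
  then have "\<phi> (x \<otimes> y) = lsum (\<lambda>i. \<phi> (single i 1 \<otimes> y)) x"
    using functional_on_expand[OF _ assms(2)] by blast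
  also have "\<dots> = lsum (\<lambda>i. lsum (\<lambda>j. \<phi> (single i 1 \<otimes> single j 1)) y) x"
  proof (rule lsum_cong)
    fix i assume "i \<in> keys x"
    then have i: "single i 1 \<in> carrier H" using assms(2) by (auto simp: carrier_eq)
    have "functional_on H (\<lambda>z. \<phi> (single i 1 \<otimes> z))"
      using assms(1) i linear_mult_right[OF i]
      by (auto simp: functional_on_def linear_on_endo add_eq smult_eq Pi_iff)
    then show "\<phi> (single i 1 \<otimes> y) = lsum (\<lambda>j. \<phi> (single i 1 \<otimes> single j 1)) y"
      using functional_on_expand[OF _ assms(3)] by blast
  qed
  finally show ?thesis .
qed

text \<open>The bilinear form \<phi> (x \<otimes> y) has the matrix \<open>?m\<close> on basis
  vectors. As products are homogeneous and \<phi> vanishes from degree N on, only finitely many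
  entries are nonzero; they are the coefficients over pairs of dual basis vectors.\<close>

lemma dual_comult_exists:
  assumes \<phi>: "\<phi> \<in> carrier V"
  shows "\<exists>t. keys t \<subseteq> carrier V \<times> carrier V \<and>
    (\<forall>x\<in>carrier H. \<forall>y\<in>carrier H. lsum (\<lambda>(f, g). f x * g y) t = \<phi> (x \<otimes> y))"
proof -
  obtain N where N: "\<forall>n\<ge>N. \<forall>x\<in>grade H n. \<phi> x = 0" using dual_bound[OF \<phi>] by blast
  define A where "A = {i \<in> I. deg i < N}"
  have A: "finite A" unfolding A_def by (rule finite_below)
  let ?m = "\<lambda>i j. \<phi> (single i 1 \<otimes> single j 1)"
  have zero: "?m i j = 0" if "i \<in> I" "j \<in> I" "\<not> (i \<in> A \<and> j \<in> A)" for i j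
  proof -
    have "single i 1 \<otimes> single j 1 \<in> grade H (deg i + deg j)"
      using that by (intro mult_graded single_grade)
    moreover have "deg i + deg j \<ge> N" using that by (auto simp: A_def)
    ultimately show ?thesis using N by blast
  qed
  define t where "t = (\<Sum>i\<in>A. \<Sum>j\<in>A. single (dbasis i, dbasis j) (?m i j))"
  \<comment> \<open>Rewritten as an extension only to read off the support.\<close>
  have "t = lin_ext (\<lambda>(i, j). tens (dbasis i) (dbasis j)) (\<Sum>i\<in>A. \<Sum>j\<in>A. single (i, j) (?m i j))"
    by (simp add: t_def lin_ext_sum flip: single_eq_pscale)
  then have "keys t \<subseteq> carrier V \<times> carrier V"
    using keys_lin_ext[of "\<lambda>(i, j). tens (dbasis i) (dbasis j)"] dbasis_closed by (fastforce split: prod.splits)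
  moreover have "lsum (\<lambda>(f, g). f x * g y) t = \<phi> (x \<otimes> y)" if xy: "x \<in> carrier H" "y \<in> carrier H" for x y
  proof -
    \<comment> \<open>Index set containing the support of the matrix and those of x and y: both ways
      of evaluating the form become sums over it.\<close>
    let ?A = "A \<union> keys x \<union> keys y"
    have "?A \<subseteq> I" using xy by (auto simp: A_def carrier_eq)
    then have z: "?m i j = 0" if "i \<in> ?A" "j \<in> ?A" "\<not> (i \<in> A \<and> j \<in> A)" for i j
      using that zero by blast
    have "lsum (\<lambda>(f, g). f x * g y) t = (\<Sum>i\<in>A. \<Sum>j\<in>A. lookup x i * (lookup y j * ?m i j))"
      using xy by (simp add: t_def lsum_sum dbasis_def mult_ac)
    also have "\<dots> = (\<Sum>i\<in>A. \<Sum>j\<in>?A. lookup x i * (lookup y j * ?m i j))"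
      by (rule sum.cong[OF HOL.refl], rule sum.mono_neutral_left) (use z A in auto)
    also have "\<dots> = (\<Sum>i\<in>?A. \<Sum>j\<in>?A. lookup x i * (lookup y j * ?m i j))"
      using z A by (intro sum.mono_neutral_left ballI sum.neutral) auto
    also have "\<dots> = lsum (\<lambda>i. lsum (\<lambda>j. ?m i j) y) x"
      using A lsum_superset[of ?A x] lsum_superset[of ?A y] by (simp add: le_supI1 sum_distrib_left)
    finally show ?thesis
      using functional_mult_expand[OF dual_functional[OF \<phi>] xy] by simp
  qed
  ultimately show ?thesis by blast
qed

lemma keys_dual_comult: "\<phi> \<in> carrier V \<Longrightarrow> keys (comult V \<phi>) \<subseteq> carrier V \<times> carrier V"
  using dual_comult_exists[of \<phi>] dual_comult(1)[of _ H \<phi>] by blast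

lemma dual_comult_eval:
  "\<phi> \<in> carrier V \<Longrightarrow> x \<in> carrier H \<Longrightarrow> y \<in> carrier H \<Longrightarrow>
    lsum (\<lambda>(f, g). f x * g y) (comult V \<phi>) = \<phi> (x \<otimes> y)"
  using dual_comult_exists[of \<phi>] dual_comult(2)[of _ H \<phi>] by blast

lemma dual_comult_eval_pair:
  "\<phi> \<in> carrier V \<Longrightarrow> x \<in> carrier H \<Longrightarrow> y \<in> carrier H \<Longrightarrow>
    lsum (\<lambda>p. fst p x * snd p y) (comult V \<phi>) = \<phi> (x \<otimes> y)"
  using dual_comult_eval[of \<phi> x y] by (simp add: case_prod_unfold)

section \<open>The dual algebra\<close>

lemma dual_mult_closed:
  assumes \<phi>: "\<phi> \<in> carrier V" and \<psi>: "\<psi> \<in> carrier V"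
  shows "\<phi> \<otimes>\<^bsub>V\<^esub> \<psi> \<in> carrier V"
proof -
  obtain N M where N: "\<forall>n\<ge>N. \<forall>x\<in>grade H n. \<phi> x = 0" and M: "\<forall>n\<ge>M. \<forall>x\<in>grade H n. \<psi> x = 0"
    using dual_bound[OF \<phi>] dual_bound[OF \<psi>] by blast
  note fn = dual_functional[OF \<phi>] dual_functional[OF \<psi>]
  show ?thesis
  \<comment> \<open>In degree n \<ge> N + M a summand of the coproduct has degrees p and n - p with
    p \<ge> N or n - p \<ge> M, so one of the two values vanishes.\<close>
  proof (rule mem_dualI[where N = "N + M"])
    show "functional_on H (\<phi> \<otimes>\<^bsub>V\<^esub> \<psi>)"
      using tensor_eq_functionals[OF comult_add fn] tensor_eq_functionals[OF comult_pscale fn]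
      by (auto simp: functional_on_def dual_mult add_closed smult_closed)
        (simp_all add: add_eq smult_eq lsum_add)
    show "(\<phi> \<otimes>\<^bsub>V\<^esub> \<psi>) x = 0" if "x \<notin> carrier H" for x using that by (simp add: dual_mult)
    fix n x assume n: "n \<ge> N + M" and x: "x \<in> grade H n"
    obtain t where t: "keys t \<subseteq> (\<Union>p\<le>n. grade H p \<times> grade H (n - p))" "tensor_eq H (comult H x) t"
      using comult_graded[OF x] by blast
    have "lsum (\<lambda>(a, b). \<phi> a * \<psi> b) t = lsum (\<lambda>_. 0) t"
    proof (rule lsum_cong, clarify)
      fix a b assume "(a, b) \<in> keys t"
      then obtain p where p: "a \<in> grade H p" "b \<in> grade H (n - p)" using t(1) by auto
      have "p \<ge> N \<or> n - p \<ge> M" using n by linarith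
      then show "\<phi> a * \<psi> b = 0" using N M p by auto
    qed
    then show "(\<phi> \<otimes>\<^bsub>V\<^esub> \<psi>) x = 0"
      using tensor_eq_functionals[OF t(2) fn] by (simp add: dual_mult)
  qed
qed

text \<open>Coassociativity of H paired with the three functionals, which cannot distinguish
  equivalent representatives in the tensor cube.\<close>

lemma dual_mult_assoc:
  assumes \<phi>: "\<phi> \<in> carrier V" and \<psi>: "\<psi> \<in> carrier V" and \<chi>: "\<chi> \<in> carrier V"
  shows "(\<phi> \<otimes>\<^bsub>V\<^esub> \<psi>) \<otimes>\<^bsub>V\<^esub> \<chi> = \<phi> \<otimes>\<^bsub>V\<^esub> (\<psi> \<otimes>\<^bsub>V\<^esub> \<chi>)"
proof
  fix x
  show "((\<phi> \<otimes>\<^bsub>V\<^esub> \<psi>) \<otimes>\<^bsub>V\<^esub> \<chi>) x = (\<phi> \<otimes>\<^bsub>V\<^esub> (\<psi> \<otimes>\<^bsub>V\<^esub> \<chi>)) x"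
  proof (cases "x \<in> carrier H")
    case True
    note kx = keys_comult[OF True]
    have "((\<phi> \<otimes>\<^bsub>V\<^esub> \<psi>) \<otimes>\<^bsub>V\<^esub> \<chi>) x
      = lsum (\<lambda>(a, c). lsum (\<lambda>(a', b). \<phi> a' * \<psi> b) (comult H a) * \<chi> c) (comult H x)"
      using True kx by (simp add: dual_mult) (intro lsum_cong, auto)
    also have "\<dots> = lsum (\<lambda>(a, b, c). \<phi> a * \<psi> b * \<chi> c)
       (lin_ext (\<lambda>(a, c). lin_ext (\<lambda>(a', b). tens3 a' b c) (comult H a)) (comult H x))"
      by (simp add: lsum_lin_ext case_prod_unfold lsum_mult_right)
    also have "\<dots> = lsum (\<lambda>(a, b, c). \<phi> a * \<psi> b * \<chi> c)
       (lin_ext (\<lambda>(a, c). lin_ext (\<lambda>(b, c'). tens3 a b c') (comult H c)) (comult H x))"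
      by (rule tensor3_eq_functionals[OF coassoc[OF True] dual_functional[OF \<phi>]
            dual_functional[OF \<psi>] dual_functional[OF \<chi>]])
    also have "\<dots> = lsum (\<lambda>(a, c). \<phi> a * lsum (\<lambda>(b, c). \<psi> b * \<chi> c) (comult H c)) (comult H x)"
      by (simp add: lsum_lin_ext case_prod_unfold lsum_mult_left mult.assoc)
    also have "\<dots> = (\<phi> \<otimes>\<^bsub>V\<^esub> (\<psi> \<otimes>\<^bsub>V\<^esub> \<chi>)) x"
      using True kx by (simp add: dual_mult) (intro lsum_cong, auto)
    finally show ?thesis .
  qed (simp add: dual_mult)
qed

lemma dual_one_closed: "\<one>\<^bsub>V\<^esub> \<in> carrier V"
  by (rule mem_dualI[where N = 1])
    (auto simp: dual_one functional_on_def add_closed smult_closed counit_graded,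
     auto simp: add_eq smult_eq counit_add counit_pscale)

lemma dual_mult_one:
  assumes \<phi>: "\<phi> \<in> carrier V"
  shows "\<one>\<^bsub>V\<^esub> \<otimes>\<^bsub>V\<^esub> \<phi> = \<phi>" "\<phi> \<otimes>\<^bsub>V\<^esub> \<one>\<^bsub>V\<^esub> = \<phi>"
proof -
  note fn = dual_functional[OF \<phi>]
  have "lsum (\<lambda>(a, b). \<one>\<^bsub>V\<^esub> a * \<phi> b) (comult H x) = \<phi> x" if x: "x \<in> carrier H" for x
  proof -
    have kx: "keys (comult H x) \<subseteq> carrier H \<times> carrier H" by (rule keys_comult[OF x])
    have "lsum (\<lambda>(a, b). \<one>\<^bsub>V\<^esub> a * \<phi> b) (comult H x)
        = lsum (\<lambda>p. \<phi> (case p of (a, b) \<Rightarrow> pscale (counit H a) b)) (comult H x)"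
      using kx fn by (intro lsum_cong) (auto simp: dual_one functional_on_def smult_eq)
    also have "\<dots> = \<phi> (lin_ext (\<lambda>(a, b). pscale (counit H a) b) (comult H x))"
      using kx by (intro functional_on_lin_ext[OF fn, symmetric])
        (auto intro: free.subspace_scale[OF subspace_carrier])
    finally show ?thesis by (simp add: counit_left x)
  qed
  then show "\<one>\<^bsub>V\<^esub> \<otimes>\<^bsub>V\<^esub> \<phi> = \<phi>"
    by (auto simp: dual_mult dual_outside[OF \<phi>] intro!: ext)
  have "lsum (\<lambda>(a, b). \<phi> a * \<one>\<^bsub>V\<^esub> b) (comult H x) = \<phi> x" if x: "x \<in> carrier H" for x
  proof -
    have kx: "keys (comult H x) \<subseteq> carrier H \<times> carrier H" by (rule keys_comult[OF x])
    have "lsum (\<lambda>(a, b). \<phi> a * \<one>\<^bsub>V\<^esub> b) (comult H x)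
        = lsum (\<lambda>p. \<phi> (case p of (a, b) \<Rightarrow> pscale (counit H b) a)) (comult H x)"
      using kx fn by (intro lsum_cong) (auto simp: dual_one functional_on_def smult_eq)
    also have "\<dots> = \<phi> (lin_ext (\<lambda>(a, b). pscale (counit H b) a) (comult H x))"
      using kx by (intro functional_on_lin_ext[OF fn, symmetric])
        (auto intro: free.subspace_scale[OF subspace_carrier])
    finally show ?thesis by (simp add: counit_right x)
  qed
  then show "\<phi> \<otimes>\<^bsub>V\<^esub> \<one>\<^bsub>V\<^esub> = \<phi>"
    by (auto simp: dual_mult dual_outside[OF \<phi>] intro!: ext)
qed

lemma dual_ring: "ring V"
proof (rule ringI)
  show "abelian_group V" by (rule dual.abelian_group)
  show "monoid V"
    by (rule monoidI) (simp_all add: dual_mult_closed dual_one_closed dual_mult_assoc dual_mult_one)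
  fix \<phi> \<psi> \<chi>
  show "(\<phi> \<oplus>\<^bsub>V\<^esub> \<psi>) \<otimes>\<^bsub>V\<^esub> \<chi> = \<phi> \<otimes>\<^bsub>V\<^esub> \<chi> \<oplus>\<^bsub>V\<^esub> \<psi> \<otimes>\<^bsub>V\<^esub> \<chi>"
    and "\<chi> \<otimes>\<^bsub>V\<^esub> (\<phi> \<oplus>\<^bsub>V\<^esub> \<psi>) = \<chi> \<otimes>\<^bsub>V\<^esub> \<phi> \<oplus>\<^bsub>V\<^esub> \<chi> \<otimes>\<^bsub>V\<^esub> \<psi>"
    by (auto simp: dual_mult case_prod_unfold algebra_simps lsum_fun_add)
qed

lemma dual_unital_algebra: "unital_algebra V"
proof -
  have "(r \<odot>\<^bsub>V\<^esub> \<phi>) \<otimes>\<^bsub>V\<^esub> \<psi> = r \<odot>\<^bsub>V\<^esub> (\<phi> \<otimes>\<^bsub>V\<^esub> \<psi>)" "\<phi> \<otimes>\<^bsub>V\<^esub> (r \<odot>\<^bsub>V\<^esub> \<psi>) = r \<odot>\<^bsub>V\<^esub> (\<phi> \<otimes>\<^bsub>V\<^esub> \<psi>)"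
    for r \<phi> \<psi>
    by (auto simp: dual_mult case_prod_unfold mult.assoc mult.left_commute[of _ r] lsum_mult_left intro!: ext)
  then show ?thesis by (simp add: unital_algebra_def dual.module dual_ring)
qed

section \<open>The dual coalgebra\<close>

lemma keys_add_subset: "keys s \<subseteq> A \<Longrightarrow> keys t \<subseteq> A \<Longrightarrow> keys (s + t) \<subseteq> A"
  using Poly_Mapping.keys_add[of s t] by blast

lemma keys_pscale: "keys (pscale r t) \<subseteq> keys t"
  by (auto simp: in_keys_iff)

text \<open>Evaluated at x, y, z, the iterated coproducts give \<phi> of the two bracketings of the
  product, so associativity of H suffices.\<close>

lemma dual_coassoc:
  assumes \<phi>: "\<phi> \<in> carrier V"
  shows "tensor3_eq V
    (lin_ext (\<lambda>(a, c). lin_ext (\<lambda>(a', b). tens3 a' b c) (comult V a)) (comult V \<phi>))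
    (lin_ext (\<lambda>(a, c). lin_ext (\<lambda>(b, c'). tens3 a b c') (comult V c)) (comult V \<phi>))"
proof (rule dual_tensor3_eqI)
  note k\<phi> = keys_dual_comult[OF \<phi>]
  have k1: "keys (lin_ext (\<lambda>(a', b). tens3 a' b c) (comult V a)) \<subseteq> carrier V \<times> carrier V \<times> carrier V"
    "keys (lin_ext (\<lambda>(a', b). tens3 c a' b) (comult V a)) \<subseteq> carrier V \<times> carrier V \<times> carrier V"
    if "a \<in> carrier V" "c \<in> carrier V" for a c
    using keys_dual_comult[OF that(1)] that(2)
    by (auto dest!: subsetD[OF keys_lin_ext] split: prod.splits)
  show "keys (lin_ext (\<lambda>(a, c). lin_ext (\<lambda>(a', b). tens3 a' b c) (comult V a)) (comult V \<phi>))
      \<subseteq> carrier V \<times> carrier V \<times> carrier V"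
    using k\<phi> k1(1) by (intro order_trans[OF keys_lin_ext] UN_least) auto
  show "keys (lin_ext (\<lambda>(a, c). lin_ext (\<lambda>(b, c'). tens3 a b c') (comult V c)) (comult V \<phi>))
      \<subseteq> carrier V \<times> carrier V \<times> carrier V"
    using k\<phi> k1(2) by (intro order_trans[OF keys_lin_ext] UN_least) auto
  fix x y z assume xyz: "x \<in> carrier H" "y \<in> carrier H" "z \<in> carrier H"
  have "lsum (\<lambda>(f, g, h). f x * g y * h z)
      (lin_ext (\<lambda>(a, c). lin_ext (\<lambda>(a', b). tens3 a' b c) (comult V a)) (comult V \<phi>))
    = lsum (\<lambda>p. lsum (\<lambda>(a', b). a' x * b y) (comult V (fst p)) * snd p z) (comult V \<phi>)"
    by (simp add: lsum_lin_ext case_prod_unfold lsum_mult_right)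
  also have "\<dots> = lsum (\<lambda>(a, c). a (x \<otimes> y) * c z) (comult V \<phi>)"
    using k\<phi> xyz by (intro lsum_cong) (auto simp: dual_comult_eval)
  also have "\<dots> = \<phi> (x \<otimes> y \<otimes> z)"
    using \<phi> xyz by (intro dual_comult_eval) (auto simp: mult_closed)
  also have "\<dots> = \<phi> (x \<otimes> (y \<otimes> z))"
    using xyz by (simp add: mult_assoc)
  also have "\<dots> = lsum (\<lambda>(a, c). a x * c (y \<otimes> z)) (comult V \<phi>)"
    using \<phi> xyz by (intro dual_comult_eval[symmetric]) (auto simp: mult_closed)
  also have "\<dots> = lsum (\<lambda>p. fst p x * lsum (\<lambda>(b, c'). b y * c' z) (comult V (snd p))) (comult V \<phi>)"
    using k\<phi> xyz by (intro lsum_cong) (auto simp: dual_comult_eval)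
  also have "\<dots> = lsum (\<lambda>(f, g, h). f x * g y * h z)
      (lin_ext (\<lambda>(a, c). lin_ext (\<lambda>(b, c'). tens3 a b c') (comult V c)) (comult V \<phi>))"
    by (simp add: lsum_lin_ext case_prod_unfold lsum_mult_left mult.assoc)
  finally show "lsum (\<lambda>(f, g, h). f x * g y * h z)
      (lin_ext (\<lambda>(a, c). lin_ext (\<lambda>(a', b). tens3 a' b c) (comult V a)) (comult V \<phi>)) =
    lsum (\<lambda>(f, g, h). f x * g y * h z)
      (lin_ext (\<lambda>(a, c). lin_ext (\<lambda>(b, c'). tens3 a b c') (comult V c)) (comult V \<phi>))" .
qed

lemma dual_counital:
  assumes \<phi>: "\<phi> \<in> carrier V"
  shows "leval V (\<lambda>(a, b). counit V a \<odot>\<^bsub>V\<^esub> b) (comult V \<phi>) = \<phi>"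
    "leval V (\<lambda>(a, b). counit V b \<odot>\<^bsub>V\<^esub> a) (comult V \<phi>) = \<phi>"
proof -
  note k\<phi> = keys_dual_comult[OF \<phi>]
  have cl: "(\<lambda>x. r * a x) \<in> carrier V" if "a \<in> carrier V" for r a
    using dual.smult_closed[OF that] by simp
  have ev: "lsum (\<lambda>p. snd p \<one> * fst p x) (comult V \<phi>) = \<phi> x" if "x \<in> carrier H" for x
    using dual_comult_eval_pair[OF \<phi> that one_closed] that by (simp add: mult_one mult.commute)
  show "leval V (\<lambda>(a, b). counit V a \<odot>\<^bsub>V\<^esub> b) (comult V \<phi>) = \<phi>"
    using k\<phi> cl dual_comult_eval_pair[OF \<phi> one_closed]
    by (intro dual_leval_eqI \<phi>) (auto simp: mult_one case_prod_unfold)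
  show "leval V (\<lambda>(a, b). counit V b \<odot>\<^bsub>V\<^esub> a) (comult V \<phi>) = \<phi>"
    using k\<phi> cl ev by (intro dual_leval_eqI \<phi>) (auto simp: case_prod_unfold)
qed

lemma dual_counital_coalgebra: "counital_coalgebra V"
  unfolding counital_coalgebra_def
proof (intro conjI ballI allI)
  fix \<phi> assume \<phi>: "\<phi> \<in> carrier V"
  show "keys (comult V \<phi>) \<subseteq> carrier V \<times> carrier V" by (rule keys_dual_comult[OF \<phi>])
  show "tensor3_eq V
    (lin_ext (\<lambda>(a, c). lin_ext (\<lambda>(a', b). tens3 a' b c) (comult V a)) (comult V \<phi>))
    (lin_ext (\<lambda>(a, c). lin_ext (\<lambda>(b, c'). tens3 a b c') (comult V c)) (comult V \<phi>))"
    by (rule dual_coassoc[OF \<phi>])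
  show "leval V (\<lambda>(a, b). counit V a \<odot>\<^bsub>V\<^esub> b) (comult V \<phi>) = \<phi>"
    "leval V (\<lambda>(a, b). counit V b \<odot>\<^bsub>V\<^esub> a) (comult V \<phi>) = \<phi>"
    by (rule dual_counital[OF \<phi>])+
  show "tensor_eq V (comult V (r \<odot>\<^bsub>V\<^esub> \<phi>)) (pscale r (comult V \<phi>))" for r
  proof (rule dual_tensor_eqI)
    show "keys (comult V (r \<odot>\<^bsub>V\<^esub> \<phi>)) \<subseteq> carrier V \<times> carrier V"
      by (intro keys_dual_comult dual.smult_closed \<phi>)
    show "keys (pscale r (comult V \<phi>)) \<subseteq> carrier V \<times> carrier V"
      by (rule order_trans[OF keys_pscale keys_dual_comult[OF \<phi>]])
  qed (use \<phi> dual.smult_closed[OF \<phi>, of r] in \<open>simp add: dual_comult_eval\<close>)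
  fix \<psi> assume \<psi>: "\<psi> \<in> carrier V"
  show "tensor_eq V (comult V (\<phi> \<oplus>\<^bsub>V\<^esub> \<psi>)) (comult V \<phi> + comult V \<psi>)"
  proof (rule dual_tensor_eqI)
    show "keys (comult V (\<phi> \<oplus>\<^bsub>V\<^esub> \<psi>)) \<subseteq> carrier V \<times> carrier V"
      by (intro keys_dual_comult dual.add_closed \<phi> \<psi>)
    show "keys (comult V \<phi> + comult V \<psi>) \<subseteq> carrier V \<times> carrier V"
      by (intro keys_add_subset keys_dual_comult \<phi> \<psi>)
  qed (use \<phi> \<psi> dual.add_closed[OF \<phi> \<psi>] in \<open>simp add: dual_comult_eval lsum_add\<close>)
next
  show "functional_on V (counit V)" by (simp add: functional_on_def)
qed

section \<open>Compatibility of the dual product and coproduct\<close>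

lemma comult_one: "tensor_eq H (comult H \<one>) (tens \<one> \<one>)"
  using bialgebra by (simp add: bialgebra_def)

lemma counit_one: "counit H \<one> = 1"
  using bialgebra by (simp add: bialgebra_def)

lemma counit_mult: "x \<in> carrier H \<Longrightarrow> y \<in> carrier H \<Longrightarrow> counit H (x \<otimes> y) = counit H x * counit H y"
  using bialgebra by (simp add: bialgebra_def)

lemma comult_mult: "x \<in> carrier H \<Longrightarrow> y \<in> carrier H \<Longrightarrow> tensor_eq H (comult H (x \<otimes> y))
       (lin_ext (\<lambda>(a, b). lin_ext (\<lambda>(c, d). tens (a \<otimes> c) (b \<otimes> d)) (comult H y)) (comult H x))"
  using bialgebra by (simp add: bialgebra_def)

text \<open>The axiom is self-dual: at a pair x, y both sides equal the pairing of \<phi> and \<psi>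
  with the coproduct of the product of x and y.\<close>

lemma dual_comult_mult:
  assumes \<phi>: "\<phi> \<in> carrier V" and \<psi>: "\<psi> \<in> carrier V"
  shows "tensor_eq V (comult V (\<phi> \<otimes>\<^bsub>V\<^esub> \<psi>))
     (lin_ext (\<lambda>(a, b). lin_ext (\<lambda>(c, d). tens (a \<otimes>\<^bsub>V\<^esub> c) (b \<otimes>\<^bsub>V\<^esub> d)) (comult V \<psi>)) (comult V \<phi>))"
proof (rule dual_tensor_eqI)
  show "keys (comult V (\<phi> \<otimes>\<^bsub>V\<^esub> \<psi>)) \<subseteq> carrier V \<times> carrier V"
    by (intro keys_dual_comult dual_mult_closed \<phi> \<psi>)
  have "keys (lin_ext (\<lambda>(c, d). tens (a \<otimes>\<^bsub>V\<^esub> c) (b \<otimes>\<^bsub>V\<^esub> d)) (comult V \<psi>)) \<subseteq> carrier V \<times> carrier V"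
    if "(a, b) \<in> keys (comult V \<phi>)" for a b
    using keys_dual_comult[OF \<psi>] keys_dual_comult[OF \<phi>] that
    by (intro order_trans[OF keys_lin_ext] UN_least) (auto intro!: dual_mult_closed)
  then show "keys (lin_ext (\<lambda>(a, b). lin_ext (\<lambda>(c, d). tens (a \<otimes>\<^bsub>V\<^esub> c) (b \<otimes>\<^bsub>V\<^esub> d)) (comult V \<psi>)) (comult V \<phi>))
      \<subseteq> carrier V \<times> carrier V"
    by (intro order_trans[OF keys_lin_ext] UN_least) auto
  fix x y assume xy: "x \<in> carrier H" "y \<in> carrier H"
  note kx = keys_comult[OF xy(1)] and ky = keys_comult[OF xy(2)]
  have "lsum (\<lambda>(f, g). f x * g y) (comult V (\<phi> \<otimes>\<^bsub>V\<^esub> \<psi>)) = (\<phi> \<otimes>\<^bsub>V\<^esub> \<psi>) (x \<otimes> y)"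
    by (intro dual_comult_eval dual_mult_closed \<phi> \<psi> xy)
  also have "\<dots> = lsum (\<lambda>(a, b). \<phi> a * \<psi> b)
      (lin_ext (\<lambda>(a, b). lin_ext (\<lambda>(c, d). tens (a \<otimes> c) (b \<otimes> d)) (comult H y)) (comult H x))"
    using tensor_eq_functionals[OF comult_mult[OF xy] dual_functional[OF \<phi>] dual_functional[OF \<psi>]]
    by (simp add: dual_mult mult_closed xy)
  also have "\<dots> = lsum (\<lambda>p. lsum (\<lambda>q. \<phi> (fst p \<otimes> fst q) * \<psi> (snd p \<otimes> snd q)) (comult H y)) (comult H x)"
    by (simp add: lsum_lin_ext case_prod_unfold)
  also have "\<dots> = lsum (\<lambda>p. lsum (\<lambda>q.
      lsum (\<lambda>f. fst f (fst p) * snd f (fst q)) (comult V \<phi>) *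
      lsum (\<lambda>g. fst g (snd p) * snd g (snd q)) (comult V \<psi>)) (comult H y)) (comult H x)"
  proof (intro lsum_cong)
    fix p q assume "p \<in> keys (comult H x)" "q \<in> keys (comult H y)"
    then have "fst p \<in> carrier H" "snd p \<in> carrier H" "fst q \<in> carrier H" "snd q \<in> carrier H"
      using kx ky by auto
    then show "\<phi> (fst p \<otimes> fst q) * \<psi> (snd p \<otimes> snd q)
      = lsum (\<lambda>f. fst f (fst p) * snd f (fst q)) (comult V \<phi>) *
      lsum (\<lambda>g. fst g (snd p) * snd g (snd q)) (comult V \<psi>)"
      by (simp add: dual_comult_eval_pair \<phi> \<psi>)
  qed
  also have "\<dots> = lsum (\<lambda>p. lsum (\<lambda>q. lsum (\<lambda>f. lsum (\<lambda>g.
      fst f (fst p) * snd f (fst q) * (fst g (snd p) * snd g (snd q))) (comult V \<psi>)) (comult V \<phi>))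
      (comult H y)) (comult H x)"
    by (simp add: lsum_mult)
  \<comment> \<open>With the sums over vectors innermost, the factors regroup into values of dual
    products at x and at y.\<close>
  also have "\<dots> = lsum (\<lambda>f. lsum (\<lambda>g. lsum (\<lambda>p. lsum (\<lambda>q.
      fst f (fst p) * snd f (fst q) * (fst g (snd p) * snd g (snd q))) (comult H y)) (comult H x))
      (comult V \<psi>)) (comult V \<phi>)"
    by (rule lsum_swap4)
  also have "\<dots> = lsum (\<lambda>f. lsum (\<lambda>g. lsum (\<lambda>p. fst f (fst p) * fst g (snd p)) (comult H x) *
      lsum (\<lambda>q. snd f (fst q) * snd g (snd q)) (comult H y)) (comult V \<psi>)) (comult V \<phi>)"
    by (simp add: lsum_mult mult_ac)
  also have "\<dots> = lsum (\<lambda>f. lsum (\<lambda>g. (fst f \<otimes>\<^bsub>V\<^esub> fst g) x * (snd f \<otimes>\<^bsub>V\<^esub> snd g) y) (comult V \<psi>)) (comult V \<phi>)"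
    using xy by (simp add: dual_mult case_prod_unfold)
  also have "\<dots> = lsum (\<lambda>(f, g). f x * g y)
    (lin_ext (\<lambda>(a, b). lin_ext (\<lambda>(c, d). tens (a \<otimes>\<^bsub>V\<^esub> c) (b \<otimes>\<^bsub>V\<^esub> d)) (comult V \<psi>)) (comult V \<phi>))"
    by (simp add: lsum_lin_ext case_prod_unfold)
  finally show "lsum (\<lambda>(f, g). f x * g y) (comult V (\<phi> \<otimes>\<^bsub>V\<^esub> \<psi>)) = lsum (\<lambda>(f, g). f x * g y)
    (lin_ext (\<lambda>(a, b). lin_ext (\<lambda>(c, d). tens (a \<otimes>\<^bsub>V\<^esub> c) (b \<otimes>\<^bsub>V\<^esub> d)) (comult V \<psi>)) (comult V \<phi>))" .
qed

lemma dual_bialgebra: "bialgebra V"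
  unfolding bialgebra_def
proof (intro conjI ballI)
  show "unital_algebra V" by (rule dual_unital_algebra)
  show "counital_coalgebra V" by (rule dual_counital_coalgebra)
  show "counit V \<one>\<^bsub>V\<^esub> = 1" by (simp add: dual_one one_closed counit_one)
  show "tensor_eq V (comult V \<one>\<^bsub>V\<^esub>) (tens \<one>\<^bsub>V\<^esub> \<one>\<^bsub>V\<^esub>)"
  proof (rule dual_tensor_eqI)
    show "keys (comult V \<one>\<^bsub>V\<^esub>) \<subseteq> carrier V \<times> carrier V" by (intro keys_dual_comult dual_one_closed)
    show "keys (tens \<one>\<^bsub>V\<^esub> \<one>\<^bsub>V\<^esub> :: _ \<Rightarrow>\<^sub>0 'k) \<subseteq> carrier V \<times> carrier V" by (simp add: dual_one_closed)
    show "lsum (\<lambda>(f, g). f x * g y) (comult V \<one>\<^bsub>V\<^esub>) = lsum (\<lambda>(f, g). f x * g y) (tens \<one>\<^bsub>V\<^esub> \<one>\<^bsub>V\<^esub>)"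
      if "x \<in> carrier H" "y \<in> carrier H" for x y
      using that dual_comult_eval[OF dual_one_closed that]
      by (simp add: dual_one mult_closed counit_mult)
  qed
  fix \<phi> \<psi> assume c: "\<phi> \<in> carrier V" "\<psi> \<in> carrier V"
  show "counit V (\<phi> \<otimes>\<^bsub>V\<^esub> \<psi>) = counit V \<phi> * counit V \<psi>"
    using tensor_eq_functionals[OF comult_one dual_functional[OF c(1)] dual_functional[OF c(2)]]
    by (simp add: dual_mult one_closed)
  show "tensor_eq V (comult V (\<phi> \<otimes>\<^bsub>V\<^esub> \<psi>))
     (lin_ext (\<lambda>(a, b). lin_ext (\<lambda>(c, d). tens (a \<otimes>\<^bsub>V\<^esub> c) (b \<otimes>\<^bsub>V\<^esub> d)) (comult V \<psi>)) (comult V \<phi>))"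
    by (rule dual_comult_mult[OF c])
qed

section \<open>The dual antipode\<close>

definition dual_antip :: "(('i \<Rightarrow>\<^sub>0 'k) \<Rightarrow> 'k) \<Rightarrow> (('i \<Rightarrow>\<^sub>0 'k) \<Rightarrow> 'k)"
  where "dual_antip \<phi> = (\<lambda>x. if x \<in> carrier H then \<phi> (antip x) else 0)"

lemma dual_antip_closed:
  assumes \<phi>: "\<phi> \<in> carrier V"
  shows "dual_antip \<phi> \<in> carrier V"
proof -
  obtain N where N: "\<forall>n\<ge>N. \<forall>x\<in>grade H n. \<phi> x = 0" using dual_bound[OF \<phi>] by blast
  show ?thesis
  proof (rule mem_dualI[where N = N])
    show "functional_on H (dual_antip \<phi>)"
      using dual_functional[OF \<phi>] linear_antip
      by (auto simp: functional_on_def dual_antip_def linear_on_def add_closed smult_closed Pi_iff)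
    show "dual_antip \<phi> x = 0" if "x \<notin> carrier H" for x using that by (simp add: dual_antip_def)
    show "dual_antip \<phi> x = 0" if "n \<ge> N" "x \<in> grade H n" for n x
      using that N antip_grade by (simp add: dual_antip_def)
  qed
qed

text \<open>Exchanging the sum over the coproduct of \<phi> with the sum over the coproduct of x
  turns dual convolution into \<phi> applied to the convolution identity for
  \<open>antip\<close>.\<close>

lemma dual_antip_conv:
  assumes \<phi>: "\<phi> \<in> carrier V" and x: "x \<in> carrier H"
  shows "lsum (\<lambda>(f, g). (dual_antip f \<otimes>\<^bsub>V\<^esub> g) x) (comult V \<phi>) = counit H x * \<phi> \<one>"
    "lsum (\<lambda>(f, g). (f \<otimes>\<^bsub>V\<^esub> dual_antip g) x) (comult V \<phi>) = counit H x * \<phi> \<one>"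
proof -
  note fn = dual_functional[OF \<phi>] and kx = keys_comult[OF x]
  have uc: "\<phi> (unit_counit x) = counit H x * \<phi> \<one>"
    using fn one_closed by (simp add: unit_counit_def functional_on_def smult_eq)
  have "lsum (\<lambda>(f, g). (dual_antip f \<otimes>\<^bsub>V\<^esub> g) x) (comult V \<phi>)
      = lsum (\<lambda>f. lsum (\<lambda>p. dual_antip (fst f) (fst p) * snd f (snd p)) (comult H x)) (comult V \<phi>)"
    using x by (simp add: dual_mult case_prod_unfold)
  also have "\<dots> = lsum (\<lambda>p. lsum (\<lambda>f. dual_antip (fst f) (fst p) * snd f (snd p)) (comult V \<phi>)) (comult H x)"
    by (rule lsum_swap)
  also have "\<dots> = lsum (\<lambda>p. \<phi> (case p of (a, b) \<Rightarrow> antip a \<otimes> b)) (comult H x)"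
    using kx by (intro lsum_cong)
      (auto simp: dual_antip_def dual_comult_eval_pair[OF \<phi> antip_closed])
  also have "\<dots> = \<phi> (conv antip (\<lambda>x. x) x)"
    unfolding conv_def using kx
    by (intro functional_on_lin_ext[OF fn, symmetric]) (auto intro!: mult_closed antip_closed)
  finally show "lsum (\<lambda>(f, g). (dual_antip f \<otimes>\<^bsub>V\<^esub> g) x) (comult V \<phi>) = counit H x * \<phi> \<one>"
    by (simp add: conv_antip_left x uc)
  have "lsum (\<lambda>(f, g). (f \<otimes>\<^bsub>V\<^esub> dual_antip g) x) (comult V \<phi>)
      = lsum (\<lambda>f. lsum (\<lambda>p. fst f (fst p) * dual_antip (snd f) (snd p)) (comult H x)) (comult V \<phi>)"
    using x by (simp add: dual_mult case_prod_unfold)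
  also have "\<dots> = lsum (\<lambda>p. lsum (\<lambda>f. fst f (fst p) * dual_antip (snd f) (snd p)) (comult V \<phi>)) (comult H x)"
    by (rule lsum_swap)
  also have "\<dots> = lsum (\<lambda>p. \<phi> (case p of (a, b) \<Rightarrow> a \<otimes> antip b)) (comult H x)"
    using kx by (intro lsum_cong)
      (auto simp: dual_antip_def dual_comult_eval_pair[OF \<phi> _ antip_closed])
  also have "\<dots> = \<phi> (conv (\<lambda>x. x) antip x)"
    unfolding conv_def using kx
    by (intro functional_on_lin_ext[OF fn, symmetric]) (auto intro!: mult_closed antip_closed)
  finally show "lsum (\<lambda>(f, g). (f \<otimes>\<^bsub>V\<^esub> dual_antip g) x) (comult V \<phi>) = counit H x * \<phi> \<one>"
    by (simp add: conv_antip_right x uc)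
qed

lemma is_antipode_dual_antip: "is_antipode V dual_antip"
  unfolding is_antipode_def
proof (intro conjI ballI)
  show "linear_on V V dual_antip"
    by (auto simp: linear_on_def dual_antip_closed) (auto simp: dual_antip_def)
  fix \<phi> assume \<phi>: "\<phi> \<in> carrier V"
  note k\<phi> = keys_dual_comult[OF \<phi>]
  have c: "counit V \<phi> \<odot>\<^bsub>V\<^esub> \<one>\<^bsub>V\<^esub> \<in> carrier V" by (intro dual.smult_closed dual_one_closed)
  have cl: "dual_antip (fst p) \<otimes>\<^bsub>V\<^esub> snd p \<in> carrier V" "fst p \<otimes>\<^bsub>V\<^esub> dual_antip (snd p) \<in> carrier V"
    if "p \<in> keys (comult V \<phi>)" for p
    using that k\<phi> by (auto intro!: dual_mult_closed dual_antip_closed)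
  show "leval V (\<lambda>(a, b). dual_antip a \<otimes>\<^bsub>V\<^esub> b) (comult V \<phi>) = counit V \<phi> \<odot>\<^bsub>V\<^esub> \<one>\<^bsub>V\<^esub>"
    "leval V (\<lambda>(a, b). a \<otimes>\<^bsub>V\<^esub> dual_antip b) (comult V \<phi>) = counit V \<phi> \<odot>\<^bsub>V\<^esub> \<one>\<^bsub>V\<^esub>"
    unfolding case_prod_unfold using cl dual_antip_conv[OF \<phi>]
    by (intro dual_leval_eqI c; simp add: dual_one case_prod_unfold)+
qed

lemma dual_hopf_algebra: "hopf_algebra V"
  using dual_bialgebra is_antipode_dual_antip by (auto simp: hopf_algebra_def)

end

section \<open>The annihilator of a Hopf subalgebra\<close>

context function_space
begin

text \<open>Biorthogonality forces the coefficients and hence uniqueness; finiteness makes the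
  candidate combination well defined, and separation shows that it represents x.\<close>

lemma is_basisI:
  assumes e: "\<And>i. i \<in> T \<Longrightarrow> e i \<in> carrier H"
    and c: "\<And>i. i \<in> T \<Longrightarrow> functional_on H (c i)"
    and dual: "\<And>i j. i \<in> T \<Longrightarrow> j \<in> T \<Longrightarrow> c i (e j) = (if i = j then 1 else 0)"
    and fin: "\<And>x. x \<in> carrier H \<Longrightarrow> finite {i \<in> T. c i x \<noteq> 0}"
    and sep: "\<And>x y. x \<in> carrier H \<Longrightarrow> y \<in> carrier H \<Longrightarrow> (\<And>i. i \<in> T \<Longrightarrow> c i x = c i y) \<Longrightarrow> x = y"
  shows "is_basis H (e ` T)"
  unfolding is_basis_def
proof (intro conjI ballI)
  show sub: "e ` T \<subseteq> carrier H" using e by auto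
  \<comment> \<open>Coefficients are indexed by the vectors themselves, so \<open>e\<close> has to
    be injective; this follows from 1 \<noteq> 0 among the biorthogonal values.\<close>
  have inj: "inj_on e T"
  proof (rule inj_onI)
    fix i j assume ij: "i \<in> T" "j \<in> T" "e i = e j"
    then have "c i (e j) = 1" using dual[of i i] by simp
    then show "i = j" using ij dual[of i j] by (auto split: if_splits)
  qed
  have coord: "c i (leval H (\<lambda>b. b) t) = lookup t (e i)" if "keys t \<subseteq> e ` T" "i \<in> T" for t i
  proof -
    have "c i (leval H (\<lambda>b. b) t) = lsum (c i) t"
      using that sub by (intro functional_on_leval c) auto
    also have "\<dots> = (\<Sum>b\<in>keys t. if b = e i then lookup t b else 0)"
      unfolding lsum_def using that dual inj_onD[OF inj]
      by (intro sum.cong) (auto dest!: subsetD split: if_splits)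
    also have "\<dots> = lookup t (e i)" by (simp add: in_keys_iff)
    finally show ?thesis .
  qed
  fix x assume x: "x \<in> carrier H"
  define t where "t = Abs_poly_mapping (\<lambda>b. if b \<in> e ` T then c (the_inv_into T e b) x else 0)"
  have "{b. (if b \<in> e ` T then c (the_inv_into T e b) x else 0) \<noteq> 0} \<subseteq> e ` {i \<in> T. c i x \<noteq> 0}"
    using the_inv_into_f_f[OF inj] by auto
  note fin' = finite_subset[OF this finite_imageI[OF fin[OF x]]]
  have lt: "lookup t b = (if b \<in> e ` T then c (the_inv_into T e b) x else 0)" for b
    by (simp only: t_def lookup_Abs_poly_mapping[OF fin'])
  have kt: "keys t \<subseteq> e ` T" by (auto simp: in_keys_iff lt split: if_splits)
  show "\<exists>!t. keys t \<subseteq> e ` T \<and> leval H (\<lambda>b. b) t = x"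
  proof (rule ex1I[of _ t])
    have "leval H (\<lambda>b. b) t = x"
    proof (rule sep)
      show "leval H (\<lambda>b. b) t \<in> carrier H" using kt sub by (intro leval_closed) auto
      show "c i (leval H (\<lambda>b. b) t) = c i x" if "i \<in> T" for i
        using that by (simp add: coord[OF kt] lt the_inv_into_f_f[OF inj])
    qed (rule x)
    then show "keys t \<subseteq> e ` T \<and> leval H (\<lambda>b. b) t = x" using kt by simp
  next
    fix u assume u: "keys u \<subseteq> e ` T \<and> leval H (\<lambda>b. b) u = x"
    show "u = t"
    proof (rule poly_mapping_eqI)
      fix b
      show "lookup u b = lookup t b"
      proof (cases "b \<in> e ` T")
        case True
        then obtain i where "i \<in> T" "b = e i" by auto
        then show ?thesis using coord[of u i] u by (simp add: lt the_inv_into_f_f[OF inj])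
      next
        case False
        then have "b \<notin> keys u" using u by auto
        then show ?thesis using False by (simp add: lt in_keys_iff)
      qed
    qed
  qed
qed

end

section \<open>Hopf subspaces with a graded projection\<close>

locale graded_hopf_subspace = connected_bialgebra H I deg
  for H :: "('k::field, 'i \<Rightarrow>\<^sub>0 'k) hopf" (structure) and I deg +
  fixes D :: "('i \<Rightarrow>\<^sub>0 'k) set" and pr :: "('i \<Rightarrow>\<^sub>0 'k) \<Rightarrow> ('i \<Rightarrow>\<^sub>0 'k)"
  assumes subspace_D: "free.subspace D" and D_subset: "D \<subseteq> carrier H"
    and one_D: "\<one> \<in> D"
    and mult_D: "x \<in> D \<Longrightarrow> y \<in> D \<Longrightarrow> x \<otimes> y \<in> D"
    and comult_D: "x \<in> D \<Longrightarrow> \<exists>t. keys t \<subseteq> D \<times> D \<and> tensor_eq H (comult H x) t"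
    and linear_pr: "linear_on H H pr"
    and pr_D: "x \<in> carrier H \<Longrightarrow> pr x \<in> D"
    and pr_id: "x \<in> D \<Longrightarrow> pr x = x"
    and pr_grade: "x \<in> grade H n \<Longrightarrow> pr x \<in> grade H n"
begin

lemma D_carrier: "x \<in> D \<Longrightarrow> x \<in> carrier H"
  using D_subset by blast

lemma hopf_subalgebra: "hopf_subalgebra D H"
  unfolding hopf_subalgebra_def
proof (intro conjI ballI)
  note cl = free.subspace_0[OF subspace_D] free.subspace_add[OF subspace_D]
    free.subspace_scale[OF subspace_D] free.subspace_neg[OF subspace_D]
  show "hopf_algebra H" by (rule hopf_algebra)
  show "submodule D ring_of_type_algebra H"
    by (rule module.submoduleI[OF module])
      (auto simp: D_subset a_minus_eq D_carrier zero_eq add_eq smult_eq intro: cl)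
  show "subring D H"
    by (rule ring.subringI[OF ring])
      (auto simp: D_subset a_minus_eq D_carrier zero_eq add_eq smult_eq one_D mult_D intro: cl)
  show "\<exists>t. keys t \<subseteq> D \<times> D \<and> tensor_eq H (comult H x) t" if "x \<in> D" for x
    using that by (rule comult_D)
  show "\<exists>S. is_antipode H S \<and> S ` D \<subseteq> D"
    using is_antipode_antip antip_subspace[OF subspace_D one_D mult_D comult_D] by blast
qed

section \<open>The annihilator as a Hopf ideal\<close>

definition ann :: "(('i \<Rightarrow>\<^sub>0 'k) \<Rightarrow> 'k) set"
  where "ann = {\<phi> \<in> carrier V. \<forall>x\<in>D. \<phi> x = 0}"

text \<open>Plays two roles: the transpose of the projection on functionals of H, and the extension
  to H of a functional given on D alone.\<close>

definition dpr :: "(('i \<Rightarrow>\<^sub>0 'k) \<Rightarrow> 'k) \<Rightarrow> (('i \<Rightarrow>\<^sub>0 'k) \<Rightarrow> 'k)"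
  where "dpr \<phi> = (\<lambda>x. if x \<in> carrier H then \<phi> (pr x) else 0)"

abbreviation K :: "('k, 'i \<Rightarrow>\<^sub>0 'k) hopf" where "K \<equiv> sub_hopf H D"
abbreviation W :: "('k, ('i \<Rightarrow>\<^sub>0 'k) \<Rightarrow> 'k) hopf" where "W \<equiv> graded_dual K"
abbreviation Q :: "('k, (('i \<Rightarrow>\<^sub>0 'k) \<Rightarrow> 'k) set) hopf" where "Q \<equiv> quot_hopf V ann"

lemma sub_hopf_simps [simp]:
  "carrier K = D" "x \<oplus>\<^bsub>K\<^esub> y = x \<oplus> y" "r \<odot>\<^bsub>K\<^esub> x = r \<odot> x" "x \<otimes>\<^bsub>K\<^esub> y = x \<otimes> y" "\<one>\<^bsub>K\<^esub> = \<one>"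
  "counit K = counit H" "grade K n = grade H n \<inter> D"
  by (simp_all add: sub_hopf_def)

lemma comult_K:
  assumes "x \<in> D"
  shows "keys (comult K x) \<subseteq> D \<times> D" "tensor_eq H (comult H x) (comult K x)"
proof -
  have "comult K x = (SOME t. keys t \<subseteq> D \<times> D \<and> tensor_eq H (comult H x) t)"
    by (simp add: sub_hopf_def)
  then have "keys (comult K x) \<subseteq> D \<times> D \<and> tensor_eq H (comult H x) (comult K x)"
    using someI_ex[OF comult_D[OF assms]] by simp
  then show "keys (comult K x) \<subseteq> D \<times> D" "tensor_eq H (comult H x) (comult K x)" by simp_all
qed

lemma pr_closed: "x \<in> carrier H \<Longrightarrow> pr x \<in> carrier H"
  by (simp add: pr_D D_carrier)

text \<open>The projection preserves degrees, so composing with it keeps the bound beyond which the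
  functional vanishes.\<close>

lemma extend_closed:
  assumes \<psi>: "functional_on K \<psi>" and z: "\<And>n x. n \<ge> N \<Longrightarrow> x \<in> grade K n \<Longrightarrow> \<psi> x = 0"
  shows "dpr \<psi> \<in> carrier V"
proof (rule mem_dualI[where N = N])
  show "functional_on H (dpr \<psi>)"
    using \<psi> linear_pr by (auto simp: functional_on_def dpr_def linear_on_def add_closed smult_closed pr_D)
  show "dpr \<psi> x = 0" if "x \<notin> carrier H" for x using that by (simp add: dpr_def)
  show "dpr \<psi> x = 0" if "n \<ge> N" "x \<in> grade H n" for n x
    using that z[of n "pr x"] pr_grade[of x n] pr_D[of x] by (auto simp: dpr_def)
qed

lemma functional_on_sub: "functional_on H \<phi> \<Longrightarrow> functional_on K \<phi>"
  by (auto simp: functional_on_def D_carrier)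

lemma dpr_closed:
  assumes "\<phi> \<in> carrier V"
  shows "dpr \<phi> \<in> carrier V"
proof -
  obtain N where "\<forall>n\<ge>N. \<forall>x\<in>grade H n. \<phi> x = 0" using dual_bound[OF assms] by blast
  then show ?thesis
    by (intro extend_closed[where N = N] functional_on_sub dual_functional[OF assms]) auto
qed

lemma ann_closed: "\<phi> \<in> ann \<Longrightarrow> \<phi> \<in> carrier V"
  by (simp add: ann_def)

lemma minus_dpr_ann: "\<phi> \<in> carrier V \<Longrightarrow> \<phi> \<ominus>\<^bsub>V\<^esub> dpr \<phi> \<in> ann"
  by (simp add: ann_def dual.minus_closed dpr_closed dual.crd_minus) (simp add: dpr_def D_carrier pr_id)

lemma dual_mult_D:
  assumes "\<phi> \<in> carrier V" "\<psi> \<in> carrier V" "x \<in> D"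
  shows "(\<phi> \<otimes>\<^bsub>V\<^esub> \<psi>) x = lsum (\<lambda>(a, b). \<phi> a * \<psi> b) (comult K x)"
  using tensor_eq_functionals[OF comult_K(2)[OF assms(3)] dual_functional[OF assms(1)]
      dual_functional[OF assms(2)]] D_carrier[OF assms(3)]
  by (simp add: dual_mult)

text \<open>At a vector of D the coproduct may be represented by pairs from D, and on each such pair
  the factor in the annihilator vanishes.\<close>

lemma ann_mult:
  assumes "\<phi> \<in> carrier V" "\<psi> \<in> carrier V" "\<phi> \<in> ann \<or> \<psi> \<in> ann"
  shows "\<phi> \<otimes>\<^bsub>V\<^esub> \<psi> \<in> ann"
proof -
  have "lsum (\<lambda>(a, b). \<phi> a * \<psi> b) (comult K x) = 0" if x: "x \<in> D" for x
  proof -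
    have "lsum (\<lambda>(a, b). \<phi> a * \<psi> b) (comult K x) = lsum (\<lambda>_. 0) (comult K x)"
      using comult_K(1)[OF x] assms(3) by (intro lsum_cong) (auto simp: ann_def)
    then show ?thesis by simp
  qed
  then show ?thesis using assms by (simp add: ann_def dual_mult_closed dual_mult_D)
qed

lemma ann_submodule: "submodule ann ring_of_type_algebra V"
proof (rule module.submoduleI[OF dual.module])
  show "\<ominus>\<^bsub>V\<^esub> a \<in> ann" if "a \<in> ann" for a
    using that dual.a_minus_eq[of a] dual.smult_closed[of a "- 1"] by (auto simp: ann_def)
  show "a \<oplus>\<^bsub>V\<^esub> b \<in> ann" if "a \<in> ann" "b \<in> ann" for a b
    using that dual.add_closed[of a b] by (auto simp: ann_def)
  show "a \<odot>\<^bsub>V\<^esub> b \<in> ann" if "b \<in> ann" for a b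
    using that dual.smult_closed[of b a] by (auto simp: ann_def)
  show "\<zero>\<^bsub>V\<^esub> \<in> ann" using dual.zero_closed by (auto simp: ann_def)
qed (auto simp: ann_def)

lemma ann_ideal: "ideal ann V"
  using ann_submodule
  by (intro idealI dual_ring) (auto simp: submodule_def ann_closed intro: ann_mult)

text \<open>Writing \<open>\<pi>\<close> for the transpose \<^term>\<open>dpr\<close> of the projection,
  \<open>f \<otimes> g = (f - \<pi> f) \<otimes> g + \<pi> f \<otimes> (g - \<pi> g) + \<pi> f \<otimes> \<pi> g\<close>, and \<open>\<pi> \<otimes> \<pi>\<close> annihilates
  the coproduct of the functionals that vanish on \<open>D\<close>.\<close>

lemma ann_comult:
  assumes \<phi>: "\<phi> \<in> ann"
  shows "\<exists>t. keys t \<subseteq> ann \<times> carrier V \<union> carrier V \<times> ann \<and> tensor_eq V (comult V \<phi>) t"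
proof -
  note \<phi>V = ann_closed[OF \<phi>] and k\<phi> = keys_dual_comult[OF ann_closed[OF \<phi>]]
  define t where "t = lin_ext (\<lambda>(f, g). tens (f \<ominus>\<^bsub>V\<^esub> dpr f) g + tens (dpr f) (g \<ominus>\<^bsub>V\<^esub> dpr g)) (comult V \<phi>)"
  have kt: "keys t \<subseteq> ann \<times> carrier V \<union> carrier V \<times> ann"
    unfolding t_def
  proof (intro order_trans[OF keys_lin_ext] UN_least)
    fix p assume "p \<in> keys (comult V \<phi>)"
    then obtain f g where p: "p = (f, g)" "f \<in> carrier V" "g \<in> carrier V" using k\<phi> by auto
    show "keys (case p of (f, g) \<Rightarrow> (tens (f \<ominus>\<^bsub>V\<^esub> dpr f) g :: _ \<Rightarrow>\<^sub>0 'k) + tens (dpr f) (g \<ominus>\<^bsub>V\<^esub> dpr g))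
        \<subseteq> ann \<times> carrier V \<union> carrier V \<times> ann"
      unfolding p(1) prod.case
      by (rule keys_add_subset) (use p in \<open>auto simp: minus_dpr_ann dpr_closed\<close>)
  qed
  have "tensor_eq V (comult V \<phi>) t"
  proof (rule dual_tensor_eqI[OF k\<phi>])
    show "keys t \<subseteq> carrier V \<times> carrier V" using kt ann_closed by blast
    fix x y assume xy: "x \<in> carrier H" "y \<in> carrier H"
    have "lsum (\<lambda>(f, g). f x * g y) (comult V \<phi>) - lsum (\<lambda>(f, g). f x * g y) t
      = lsum (\<lambda>(f, g). f x * g y - ((f x - dpr f x) * g y + dpr f x * (g y - dpr g y))) (comult V \<phi>)"
      unfolding t_def lsum_lin_ext lsum_fun_diff[symmetric] using k\<phi>
      by (intro lsum_cong) (auto simp: lsum_add dual.crd_minus dpr_closed)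
    also have "\<dots> = lsum (\<lambda>(f, g). f (pr x) * g (pr y)) (comult V \<phi>)"
      using xy by (intro lsum_cong) (auto simp: dpr_def algebra_simps)
    also have "\<dots> = \<phi> (pr x \<otimes> pr y)"
      using xy by (intro dual_comult_eval \<phi>V pr_closed)
    also have "\<dots> = 0"
      using \<phi> xy by (auto simp: ann_def intro!: mult_D pr_D)
    finally show "lsum (\<lambda>(f, g). f x * g y) (comult V \<phi>) = lsum (\<lambda>(f, g). f x * g y) t" by simp
  qed
  then show ?thesis using kt by blast
qed

lemma antip_D: "x \<in> D \<Longrightarrow> antip x \<in> D"
  by (rule antip_subspace[OF subspace_D one_D mult_D comult_D])

lemma hopf_ideal_ann: "hopf_ideal ann V"
  unfolding hopf_ideal_def
proof (intro conjI ballI)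
  show "\<exists>S. is_antipode V S \<and> S ` ann \<subseteq> ann"
    using is_antipode_dual_antip
    by (intro exI[of _ dual_antip]) (auto simp: ann_def dual_antip_closed, auto simp: dual_antip_def antip_D)
qed (simp_all add: dual_hopf_algebra ann_submodule ann_ideal ann_comult, simp add: ann_def one_D)

section \<open>Restriction identifies the quotient with the dual of the subspace\<close>

lemma coset_eq:
  assumes "\<phi> \<in> carrier V"
  shows "ann +>\<^bsub>V\<^esub> \<phi> = {\<psi> \<in> carrier V. \<forall>x\<in>D. \<psi> x = \<phi> x}"
proof -
  have "ann +>\<^bsub>V\<^esub> \<phi> = {h \<oplus>\<^bsub>V\<^esub> \<phi> | h. h \<in> ann}"
    by (auto simp: a_r_coset_def r_coset_def)
  also have "\<dots> = {\<psi> \<in> carrier V. \<forall>x\<in>D. \<psi> x = \<phi> x}"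
  proof (intro equalityI subsetI)
    fix \<psi> assume "\<psi> \<in> {h \<oplus>\<^bsub>V\<^esub> \<phi> | h. h \<in> ann}"
    then obtain h where h: "h \<in> ann" "\<psi> = h \<oplus>\<^bsub>V\<^esub> \<phi>" by blast
    then show "\<psi> \<in> {\<psi> \<in> carrier V. \<forall>x\<in>D. \<psi> x = \<phi> x}"
      using dual.add_closed[OF ann_closed[OF h(1)] assms] by (simp add: ann_def)
  next
    fix \<psi> assume \<psi>: "\<psi> \<in> {\<psi> \<in> carrier V. \<forall>x\<in>D. \<psi> x = \<phi> x}"
    then have "\<psi> \<ominus>\<^bsub>V\<^esub> \<phi> \<in> ann" using assms by (simp add: ann_def dual.minus_closed dual.crd_minus)
    moreover have "\<psi> = (\<psi> \<ominus>\<^bsub>V\<^esub> \<phi>) \<oplus>\<^bsub>V\<^esub> \<phi>" using \<psi> assms by (auto simp: dual.crd_minus)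
    ultimately show "\<psi> \<in> {h \<oplus>\<^bsub>V\<^esub> \<phi> | h. h \<in> ann}" by blast
  qed
  finally show ?thesis .
qed

definition res :: "(('i \<Rightarrow>\<^sub>0 'k) \<Rightarrow> 'k) \<Rightarrow> (('i \<Rightarrow>\<^sub>0 'k) \<Rightarrow> 'k)"
  where "res \<phi> = (\<lambda>x. if x \<in> D then \<phi> x else 0)"

definition \<Theta> :: "(('i \<Rightarrow>\<^sub>0 'k) \<Rightarrow> 'k) set \<Rightarrow> (('i \<Rightarrow>\<^sub>0 'k) \<Rightarrow> 'k)"
  where "\<Theta> A = res (SOME \<phi>. \<phi> \<in> A)"

text \<open>Makes the choice inside \<Theta>, and inside the counit and coproduct of the quotient,
  harmless: any two members of a coset agree on D.\<close>

lemma some_coset: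
  assumes "\<phi> \<in> carrier V"
  shows "(SOME \<psi>. \<psi> \<in> ann +>\<^bsub>V\<^esub> \<phi>) \<in> carrier V" "x \<in> D \<Longrightarrow> (SOME \<psi>. \<psi> \<in> ann +>\<^bsub>V\<^esub> \<phi>) x = \<phi> x"
proof -
  have "\<phi> \<in> ann +>\<^bsub>V\<^esub> \<phi>" using assms by (simp add: coset_eq)
  then have "(SOME \<psi>. \<psi> \<in> ann +>\<^bsub>V\<^esub> \<phi>) \<in> ann +>\<^bsub>V\<^esub> \<phi>" by (rule someI[where P = "\<lambda>\<psi>. \<psi> \<in> ann +>\<^bsub>V\<^esub> \<phi>"])
  then show "(SOME \<psi>. \<psi> \<in> ann +>\<^bsub>V\<^esub> \<phi>) \<in> carrier V" "x \<in> D \<Longrightarrow> (SOME \<psi>. \<psi> \<in> ann +>\<^bsub>V\<^esub> \<phi>) x = \<phi> x"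
    using assms by (simp_all add: coset_eq)
qed

lemma Theta_coset: "\<phi> \<in> carrier V \<Longrightarrow> \<Theta> (ann +>\<^bsub>V\<^esub> \<phi>) = res \<phi>"
  by (auto simp: \<Theta>_def res_def some_coset)

lemma coset_eq_iff:
  "\<phi> \<in> carrier V \<Longrightarrow> \<psi> \<in> carrier V \<Longrightarrow> ann +>\<^bsub>V\<^esub> \<phi> = ann +>\<^bsub>V\<^esub> \<psi> \<longleftrightarrow> (\<forall>x\<in>D. \<phi> x = \<psi> x)"
  by (auto simp: coset_eq)

lemma res_eq_iff: "res \<phi> = res \<psi> \<longleftrightarrow> (\<forall>x\<in>D. \<phi> x = \<psi> x)"
  unfolding res_def fun_eq_iff by auto

lemma res_closed:
  assumes "\<phi> \<in> carrier V"
  shows "res \<phi> \<in> carrier W"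
proof -
  have "{n. \<exists>x\<in>grade H n \<inter> D. res \<phi> x \<noteq> 0} \<subseteq> {n. \<exists>x\<in>grade H n. \<phi> x \<noteq> 0}"
    by (auto simp: res_def)
  then have "finite {n. \<exists>x\<in>grade H n \<inter> D. res \<phi> x \<noteq> 0}"
    using assms by (auto simp: mem_dual_iff intro: finite_subset)
  moreover have "functional_on K (res \<phi>)"
    using dual_functional[OF assms] free.subspace_add[OF subspace_D] free.subspace_scale[OF subspace_D]
    by (auto simp: functional_on_def res_def D_carrier add_eq smult_eq)
  ultimately show ?thesis by (simp add: mem_dual_iff) (simp add: res_def)
qed

text \<open>Surjectivity of restriction: the extension through the projection lies in the graded
  dual, and it restricts back because the projection fixes D.\<close>

lemma extend_dual:
  assumes "\<psi> \<in> carrier W"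
  shows "dpr \<psi> \<in> carrier V" "res (dpr \<psi>) = \<psi>"
proof -
  have "finite {n. \<exists>x\<in>grade K n. \<psi> x \<noteq> 0}" using assms by (simp only: mem_dual_iff)
  then obtain N where "{n. \<exists>x\<in>grade K n. \<psi> x \<noteq> 0} \<subseteq> {..<N}"
    using finite_nat_iff_bounded by auto
  then have "\<psi> x = 0" if "n \<ge> N" "x \<in> grade K n" for n x
    using that by (auto simp: subset_iff not_less[symmetric])
  then show "dpr \<psi> \<in> carrier V"
    using assms by (intro extend_closed[where N = N]) (auto simp only: mem_dual_iff)
  show "res (dpr \<psi>) = \<psi>"
    using assms by (auto simp: res_def dpr_def mem_dual_iff D_carrier pr_id)
qed

lemma linear_res: "linear_on V W res"
  by (auto simp: linear_on_def res_closed) (auto simp: res_def)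

text \<open>No basis of D is at hand, so tensors over the dual of D are lifted to tensors over the
  dual of H, compared there by evaluation, and pushed back by restriction. Lifted functionals see
  their arguments only through the projection, so values on D suffice.\<close>

lemma sub_tensor_eqI:
  assumes k: "keys s \<subseteq> carrier W \<times> carrier W" "keys t \<subseteq> carrier W \<times> carrier W"
    and ev: "\<And>x y. x \<in> D \<Longrightarrow> y \<in> D \<Longrightarrow> lsum (\<lambda>(f, g). f x * g y) s = lsum (\<lambda>(f, g). f x * g y) t"
  shows "tensor_eq W s t"
proof -
  let ?e = "lin_ext (\<lambda>(f, g). tens (dpr f) (dpr g)) :: _ \<Rightarrow> _ \<Rightarrow>\<^sub>0 'k"
  let ?r = "lin_ext (\<lambda>(f, g). tens (res f) (res g)) :: _ \<Rightarrow> _ \<Rightarrow>\<^sub>0 'k"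
  have ke: "keys (?e u) \<subseteq> carrier V \<times> carrier V" if "keys u \<subseteq> carrier W \<times> carrier W" for u
    using that by (intro order_trans[OF keys_lin_ext] UN_least) (auto simp: extend_dual)
  have "tensor_eq V (?e s) (?e t)"
    by (rule dual_tensor_eqI[OF ke[OF k(1)] ke[OF k(2)]])
      (use ev in \<open>simp add: lsum_lin_ext case_prod_unfold dpr_def pr_D\<close>)
  then have "tensor_eq W (?r (?e s)) (?r (?e t))"
    by (rule tensor_eq_push[OF _ linear_res])
  moreover have "?r (?e u) = u" if "keys u \<subseteq> carrier W \<times> carrier W" for u
  proof -
    have "?r (?e u) = lin_ext (\<lambda>(f, g). tens f g) u"
      unfolding lin_ext_lin_ext using that by (intro lin_ext_cong) (auto simp: extend_dual)
    then show ?thesis by simp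
  qed
  ultimately show ?thesis using k by simp
qed

lemma quot_carrier: "carrier Q = (\<lambda>\<phi>. ann +>\<^bsub>V\<^esub> \<phi>) ` carrier V"
  by (auto simp: quot_hopf_def FactRing_def A_RCOSETS_def')

lemma quot_add: "\<phi> \<in> carrier V \<Longrightarrow> \<psi> \<in> carrier V \<Longrightarrow>
    (ann +>\<^bsub>V\<^esub> \<phi>) \<oplus>\<^bsub>Q\<^esub> (ann +>\<^bsub>V\<^esub> \<psi>) = ann +>\<^bsub>V\<^esub> (\<phi> \<oplus>\<^bsub>V\<^esub> \<psi>)"
  using ring_hom_add[OF ideal.rcos_ring_hom[OF ann_ideal]] by (simp add: quot_hopf_def)

lemma quot_mult: "\<phi> \<in> carrier V \<Longrightarrow> \<psi> \<in> carrier V \<Longrightarrow>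
    (ann +>\<^bsub>V\<^esub> \<phi>) \<otimes>\<^bsub>Q\<^esub> (ann +>\<^bsub>V\<^esub> \<psi>) = ann +>\<^bsub>V\<^esub> (\<phi> \<otimes>\<^bsub>V\<^esub> \<psi>)"
  using ring_hom_mult[OF ideal.rcos_ring_hom[OF ann_ideal]] by (simp add: quot_hopf_def)

lemma quot_one: "\<one>\<^bsub>Q\<^esub> = ann +>\<^bsub>V\<^esub> \<one>\<^bsub>V\<^esub>"
  by (simp add: quot_hopf_def FactRing_def)

lemma quot_zero: "\<zero>\<^bsub>Q\<^esub> = ann +>\<^bsub>V\<^esub> \<zero>\<^bsub>V\<^esub>"
proof -
  have "\<zero>\<^bsub>Q\<^esub> = ann" by (simp add: quot_hopf_def FactRing_def)
  also have "\<dots> = ann +>\<^bsub>V\<^esub> \<zero>\<^bsub>V\<^esub>" using dual.zero_closed by (simp add: coset_eq) (simp add: ann_def)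
  finally show ?thesis .
qed

text \<open>The multiple of a coset is defined as a union over its members, all of which contribute
  the same coset.\<close>

lemma quot_smult:
  assumes \<phi>: "\<phi> \<in> carrier V"
  shows "r \<odot>\<^bsub>Q\<^esub> (ann +>\<^bsub>V\<^esub> \<phi>) = ann +>\<^bsub>V\<^esub> (r \<odot>\<^bsub>V\<^esub> \<phi>)"
proof -
  have *: "ann +>\<^bsub>V\<^esub> (r \<odot>\<^bsub>V\<^esub> \<psi>) = ann +>\<^bsub>V\<^esub> (r \<odot>\<^bsub>V\<^esub> \<phi>)" if "\<psi> \<in> ann +>\<^bsub>V\<^esub> \<phi>" for \<psi>
    using that dual.smult_closed[of \<psi> r] dual.smult_closed[OF \<phi>, of r]
    by (simp add: coset_eq \<phi>)
  have "r \<odot>\<^bsub>Q\<^esub> (ann +>\<^bsub>V\<^esub> \<phi>) = (\<Union>\<psi>\<in>ann +>\<^bsub>V\<^esub> \<phi>. ann +>\<^bsub>V\<^esub> (r \<odot>\<^bsub>V\<^esub> \<psi>))"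
    by (simp add: quot_hopf_def)
  also have "\<dots> = (\<Union>\<psi>\<in>ann +>\<^bsub>V\<^esub> \<phi>. ann +>\<^bsub>V\<^esub> (r \<odot>\<^bsub>V\<^esub> \<phi>))"
    using * by (intro SUP_cong HOL.refl)
  also have "\<dots> = ann +>\<^bsub>V\<^esub> (r \<odot>\<^bsub>V\<^esub> \<phi>)"
    using coset_eq[OF \<phi>] \<phi> by auto
  finally show ?thesis .
qed

lemma bij_Theta: "bij_betw \<Theta> (carrier Q) (carrier W)"
proof (rule bij_betw_imageI)
  show "inj_on \<Theta> (carrier Q)"
    by (auto simp: inj_on_def quot_carrier Theta_coset res_eq_iff coset_eq_iff)
  have "\<psi> \<in> \<Theta> ` carrier Q" if "\<psi> \<in> carrier W" for \<psi>
    using that extend_dual[OF that] Theta_coset[of "dpr \<psi>"]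
    by (auto simp: quot_carrier image_image intro!: image_eqI[of _ _ "dpr \<psi>"])
  then show "\<Theta> ` carrier Q = carrier W"
    by (auto simp: quot_carrier Theta_coset res_closed)
qed

lemma res_add: "res (\<phi> \<oplus>\<^bsub>V\<^esub> \<psi>) = res \<phi> \<oplus>\<^bsub>W\<^esub> res \<psi>" and res_smult: "res (r \<odot>\<^bsub>V\<^esub> \<phi>) = r \<odot>\<^bsub>W\<^esub> res \<phi>"
  by (auto simp: res_def)

lemma linear_Theta: "linear_on Q W \<Theta>"
  unfolding linear_on_def
  by (auto simp del: dual_add dual_smult simp: quot_carrier Theta_coset res_closed quot_add quot_smult
      dual.add_closed dual.smult_closed res_add res_smult)

lemma res_mult:
  assumes "\<phi> \<in> carrier V" "\<psi> \<in> carrier V"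
  shows "res (\<phi> \<otimes>\<^bsub>V\<^esub> \<psi>) = res \<phi> \<otimes>\<^bsub>W\<^esub> res \<psi>"
proof
  fix x
  show "res (\<phi> \<otimes>\<^bsub>V\<^esub> \<psi>) x = (res \<phi> \<otimes>\<^bsub>W\<^esub> res \<psi>) x"
  proof (cases "x \<in> D")
    case True
    then have "res (\<phi> \<otimes>\<^bsub>V\<^esub> \<psi>) x = lsum (\<lambda>(a, b). \<phi> a * \<psi> b) (comult K x)"
      using dual_mult_D[OF assms True] by (simp add: res_def)
    also have "\<dots> = lsum (\<lambda>(a, b). res \<phi> a * res \<psi> b) (comult K x)"
      using comult_K(1)[OF True] by (intro lsum_cong) (auto simp: res_def)
    finally show ?thesis using True by (simp add: dual_mult)
  qed (simp add: res_def dual_mult)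
qed

text \<open>On x, y in D both sides evaluate to \<phi> (x \<otimes> y), the product staying in
  D.\<close>

lemma sub_comult:
  assumes \<phi>: "\<phi> \<in> carrier V"
  shows "tensor_eq W (comult W (res \<phi>)) (lin_ext (\<lambda>(f, g). tens (res f) (res g)) (comult V \<phi>))"
proof -
  let ?t = "lin_ext (\<lambda>(f, g). tens (res f) (res g)) (comult V \<phi>)"
  have kt: "keys ?t \<subseteq> carrier W \<times> carrier W"
    using keys_dual_comult[OF \<phi>]
    by (intro order_trans[OF keys_lin_ext] UN_least) (auto simp: res_closed)
  have ev: "lsum (\<lambda>(f, g). f x * g y) ?t = res \<phi> (x \<otimes>\<^bsub>K\<^esub> y)" if "x \<in> carrier K" "y \<in> carrier K" for x y
    using that dual_comult_eval_pair[OF \<phi>, of x y] mult_D[of x y]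
    by (simp add: lsum_lin_ext case_prod_unfold res_def D_carrier)
  show ?thesis
    by (rule sub_tensor_eqI[OF dual_comult(1)[OF kt ev] kt])
      (use dual_comult(2)[OF kt ev] ev in simp_all)
qed

lemma quot_iso: "graded_hopf_iso Q W \<Theta>"
  unfolding graded_hopf_iso_def
proof (intro conjI ballI allI)
  show "bij_betw \<Theta> (carrier Q) (carrier W)" by (rule bij_Theta)
  show "linear_on Q W \<Theta>" by (rule linear_Theta)
  show "\<Theta> \<one>\<^bsub>Q\<^esub> = \<one>\<^bsub>W\<^esub>"
    by (auto simp: quot_one Theta_coset dual_one_closed) (auto simp: res_def dual_one D_carrier)
  show "\<Theta> ` grade Q n = grade W n" for n
  proof -
    have "\<Theta> ` grade Q n = res ` grade V n"
      by (auto simp: quot_hopf_def dual_grade image_image Theta_coset intro!: image_cong)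
    also have "\<dots> = grade W n"
    proof (intro equalityI subsetI)
      fix \<psi> assume "\<psi> \<in> res ` grade V n"
      then show "\<psi> \<in> grade W n" by (auto simp: dual_grade res_closed) (auto simp: res_def)
    next
      fix \<psi> assume \<psi>: "\<psi> \<in> grade W n"
      then have W: "\<psi> \<in> carrier W" by (simp add: dual_grade)
      \<comment> \<open>The extension of a homogeneous functional is homogeneous because the
        projection preserves degrees.\<close>
      have "dpr \<psi> \<in> grade V n"
        using \<psi> extend_dual(1)[OF W] pr_grade pr_D by (auto simp: dual_grade dpr_def)
      then show "\<psi> \<in> res ` grade V n" using extend_dual(2)[OF W] by (metis image_eqI)
    qed
    finally show ?thesis .
  qed
  fix A assume "A \<in> carrier Q"
  then obtain \<phi> where \<phi>: "\<phi> \<in> carrier V" "A = ann +>\<^bsub>V\<^esub> \<phi>" by (auto simp: quot_carrier)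
  \<comment> \<open>Counit and coproduct of the quotient are computed on this very representative;
    using it on both sides avoids comparing coproducts of different representatives.\<close>
  define \<phi>' where "\<phi>' = (SOME x. x \<in> A)"
  have \<phi>': "\<phi>' \<in> carrier V" "\<And>x. x \<in> D \<Longrightarrow> \<phi>' x = \<phi> x"
    unfolding \<phi>'_def \<phi>(2) using some_coset[OF \<phi>(1)] by auto
  have res': "\<Theta> A = res \<phi>'" by (simp add: \<Theta>_def \<phi>'_def)
  show "counit W (\<Theta> A) = counit Q A"
    using one_D by (simp add: res') (simp add: res_def quot_hopf_def flip: \<phi>'_def)
  have "lin_ext (\<lambda>(a, b). tens (\<Theta> a) (\<Theta> b)) (comult Q A)
      = lin_ext (\<lambda>(f, g). tens (res f) (res g)) (comult V \<phi>')"
    using keys_dual_comult[OF \<phi>'(1)]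
    by (auto simp: quot_hopf_def lin_ext_lin_ext Theta_coset simp flip: \<phi>'_def intro!: lin_ext_cong)
  then show "tensor_eq W (comult W (\<Theta> A)) (lin_ext (\<lambda>(a, b). tens (\<Theta> a) (\<Theta> b)) (comult Q A))"
    using sub_comult[OF \<phi>'(1)] by (simp add: res')
  fix B assume "B \<in> carrier Q"
  then obtain \<psi> where \<psi>: "\<psi> \<in> carrier V" "B = ann +>\<^bsub>V\<^esub> \<psi>" by (auto simp: quot_carrier)
  show "\<Theta> (A \<otimes>\<^bsub>Q\<^esub> B) = \<Theta> A \<otimes>\<^bsub>W\<^esub> \<Theta> B"
    using \<phi> \<psi> by (simp add: quot_mult Theta_coset dual_mult_closed res_mult)
qed

sublocale quot: function_space Q \<Theta>
proof unfold_locales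
  show "\<zero>\<^bsub>Q\<^esub> \<in> carrier Q" using dual.zero_closed by (simp only: quot_zero quot_carrier) blast
  show "\<Theta> \<zero>\<^bsub>Q\<^esub> x = 0" for x
    unfolding quot_zero using Theta_coset[OF dual.zero_closed] by (simp add: res_def)
  fix A B assume AB: "A \<in> carrier Q" "B \<in> carrier Q"
  then obtain \<phi> \<psi> where c: "\<phi> \<in> carrier V" "A = ann +>\<^bsub>V\<^esub> \<phi>" "\<psi> \<in> carrier V" "B = ann +>\<^bsub>V\<^esub> \<psi>"
    by (auto simp: quot_carrier)
  show "A \<oplus>\<^bsub>Q\<^esub> B \<in> carrier Q"
    unfolding c quot_add[OF c(1,3)] quot_carrier using dual.add_closed[OF c(1,3)] by (rule imageI)
  show "\<Theta> (A \<oplus>\<^bsub>Q\<^esub> B) x = \<Theta> A x + \<Theta> B x" for x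
    using linear_Theta AB by (simp add: linear_on_def)
  show "A = B" if "\<And>x. \<Theta> A x = \<Theta> B x"
    using bij_Theta AB that by (auto simp: bij_betw_def inj_on_def fun_eq_iff)
next
  fix A r assume A: "A \<in> carrier Q"
  then obtain \<phi> where c: "\<phi> \<in> carrier V" "A = ann +>\<^bsub>V\<^esub> \<phi>" by (auto simp: quot_carrier)
  show "r \<odot>\<^bsub>Q\<^esub> A \<in> carrier Q"
    unfolding c quot_smult[OF c(1)] quot_carrier using dual.smult_closed[OF c(1)] by (rule imageI)
  show "\<Theta> (r \<odot>\<^bsub>Q\<^esub> A) x = r * \<Theta> A x" for x
    using linear_Theta A by (simp add: linear_on_def)
qed

end

section \<open>Words\<close>

text \<open>Describes m-permutations up to increasing relabelling, which is what the pieces of an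
  m-permutation cut into m-words are.\<close>

definition balanced :: "nat \<Rightarrow> nat list \<Rightarrow> bool"
  where "balanced m u \<longleftrightarrow> (\<forall>a\<in>set u. count_list u a = m)"

text \<open>For m \<ge> 1 each letter of the interval must occur; for m = 0 the empty word would
  belong to every n.\<close>

lemma mperms_iff: "m \<ge> 1 \<Longrightarrow> w \<in> mperms m n \<longleftrightarrow> balanced m w \<and> set w = {1..n}"
proof
  assume m: "m \<ge> 1" and w: "w \<in> mperms m n"
  have "a \<in> set w" if "a \<in> {1..n}" for a
  proof (rule ccontr)
    assume "a \<notin> set w"
    moreover have "count_list w a = m" using w that by (simp add: mperms_def)
    ultimately show False using m by simp
  qed
  then have "set w = {1..n}" using w by (auto simp: mperms_def)
  then show "balanced m w \<and> set w = {1..n}" using w by (auto simp: mperms_def balanced_def)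
qed (auto simp: mperms_def balanced_def)

lemma mperms_set: "m \<ge> 1 \<Longrightarrow> w \<in> mperms m n \<Longrightarrow> set w = {1..n}"
  by (simp add: mperms_iff)

lemma mperms_card: "m \<ge> 1 \<Longrightarrow> w \<in> mperms m n \<Longrightarrow> card (set w) = n"
  by (simp add: mperms_iff)

lemma all_mperms_iff: "m \<ge> 1 \<Longrightarrow> w \<in> all_mperms m \<longleftrightarrow> w \<in> mperms m (card (set w))"
  by (auto simp: all_mperms_def mperms_card)

lemma mperms_eq: "m \<ge> 1 \<Longrightarrow> {w \<in> all_mperms m. card (set w) = n} = mperms m n"
  by (auto simp: all_mperms_def mperms_card)

lemma mperms_length: "w \<in> mperms m n \<Longrightarrow> length w = n * m"
  using sum_count_set[of w "{1..n}"] by (simp add: mperms_def)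

lemma finite_mperms: "finite (mperms m n)"
proof -
  have "mperms m n \<subseteq> {w. set w \<subseteq> {1..n} \<and> length w = n * m}"
    using mperms_length by (auto simp: mperms_def)
  then show ?thesis using finite_lists_length_eq[of "{1..n}" "n * m"] finite_subset by blast
qed

lemma mperms_0: "mperms m 0 = {[]}"
  by (auto simp: mperms_def)

lemma Nil_all_mperms: "[] \<in> all_mperms m"
  using mperms_0[of m] by (auto simp: all_mperms_def)

lemma mword_append: "mword m u \<Longrightarrow> mword m v \<Longrightarrow> mword m (u @ v)"
  by (simp add: mword_def)

lemma balanced_mword: "balanced m u \<Longrightarrow> mword m u"
  unfolding mword_def balanced_def by (metis count_notin dvd_0_right dvd_refl)

text \<open>Two multiples of m that add up to m are m and 0, so each letter lives entirely in one of
  the pieces.\<close>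

lemma balanced_split:
  assumes "balanced m (u @ v)" "mword m u" "mword m v"
  shows "balanced m u" "balanced m v" "set u \<inter> set v = {}"
proof -
  have *: "count_list u a = m \<and> count_list v a = 0 \<or> count_list u a = 0 \<and> count_list v a = m"
    if "a \<in> set u \<union> set v" for a
  proof -
    have s: "count_list u a + count_list v a = m" using assms(1) that by (auto simp: balanced_def)
    obtain i j where "count_list u a = m * i" "count_list v a = m * j"
      using assms(2,3) by (auto simp: mword_def dvd_def) metis
    moreover have "m * (i + j) = m * 1" using s calculation by (simp add: distrib_left)
    then have "m = 0 \<or> i + j = 1" unfolding mult_cancel1 by blast
    ultimately show ?thesis using s by (auto simp: add_is_1)
  qed
  show "balanced m u" "balanced m v" "set u \<inter> set v = {}"
    using * by (auto simp: balanced_def) (metis UnI1 UnI2 count_list_0_iff)+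
qed

lemma count_list_conv_card: "count_list w a = card {j. j < length w \<and> w ! j = a}"
  by (simp add: count_list_eq_length_filter length_filter_conv_card eq_commute)

text \<open>The positions scanned before i number m times the count of smaller letters, plus the
  earlier occurrences of the same letter. There are fewer than m of the latter, so division by m
  discards them and leaves the packed label.\<close>

lemma mstd_balanced:
  assumes "balanced m u"
  shows "mstd m u = pack u"
proof (rule nth_equalityI)
  show "length (mstd m u) = length (pack u)" by (simp add: mstd_def pack_def)
  fix i assume "i < length (mstd m u)"
  then have i: "i < length u" by (simp add: mstd_def)
  then have mem: "u ! i \<in> set u" by simp
  let ?B = "{b \<in> set u. b < u ! i}"
  let ?L = "{j. j < length u \<and> u ! j < u ! i}" and ?E = "{j. j < length u \<and> u ! j = u ! i \<and> j < i}"
  have "?L = (\<Union>b\<in>?B. {j. j < length u \<and> u ! j = b})" by auto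
  then have "card ?L = (\<Sum>b\<in>?B. card {j. j < length u \<and> u ! j = b})"
    by (simp only:) (rule card_UN_disjoint, auto)
  also have "\<dots> = (\<Sum>b\<in>?B. m)"
    using assms by (intro sum.cong) (auto simp: balanced_def simp flip: count_list_conv_card)
  finally have L: "card ?L = m * card ?B" by simp
  have "card ?E < card {j. j < length u \<and> u ! j = u ! i}"
    using i by (intro psubset_card_mono) auto
  also have "\<dots> = m"
    using assms mem by (simp add: balanced_def flip: count_list_conv_card)
  finally have E: "card ?E < m" .
  have un: "{j. j < length u \<and> (u ! j < u ! i \<or> u ! j = u ! i \<and> j < i)} = ?L \<union> ?E" by auto
  have "card (?L \<union> ?E) = card ?L + card ?E" by (rule card_Un_disjoint) auto
  then have "card {j. j < length u \<and> (u ! j < u ! i \<or> u ! j = u ! i \<and> j < i)} = card ?L + card ?E"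
    unfolding un .
  then have "mstd m u ! i = Suc (card ?B)"
    using i E by (simp add: mstd_def L)
  moreover have "{b \<in> set u. b \<le> u ! i} = insert (u ! i) ?B" using mem by auto
  ultimately show "mstd m u ! i = pack u ! i"
    using i by (simp add: pack_def)
qed

lemma balanced_map: "inj_on r (set u) \<Longrightarrow> balanced m (map r u) \<longleftrightarrow> balanced m u"
  by (auto simp: balanced_def count_list_inj_map)

lemma mword_map: 
  assumes "inj_on r (set u)"
  shows "mword m (map r u) \<longleftrightarrow> mword m u"
proof -
  have "mword m w \<longleftrightarrow> (\<forall>a\<in>set w. m dvd count_list w a)" for w
    unfolding mword_def by (metis count_notin dvd_0_right)
  then show ?thesis using assms by (auto simp: count_list_inj_map)
qed

section \<open>Packing as an increasing relabelling\<close>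

lemma pack_map:
  assumes r: "strict_mono_on (set u) r"
  shows "pack (map r u) = pack u"
proof -
  have inj: "inj_on r (set u)" using r by (rule strict_mono_on_imp_inj_on)
  have "card {b \<in> r ` set u. b \<le> r a} = card {b \<in> set u. b \<le> a}" if a: "a \<in> set u" for a
  proof -
    have "{b \<in> r ` set u. b \<le> r a} = r ` {b \<in> set u. b \<le> a}"
      using a r by (auto simp: strict_mono_on_less_eq[OF r])
    then show ?thesis using inj by (simp add: card_image inj_on_def)
  qed
  then show ?thesis by (simp add: pack_def)
qed

text \<open>Separates the relabelling from the word: packing applies a map that depends on the set
  of letters only, so one map serves all shuffles of two given words.\<close>

definition rank :: "nat set \<Rightarrow> nat \<Rightarrow> nat"
  where "rank A a = card {b \<in> A. b \<le> a}"

lemma pack_eq_map_rank: "pack u = map (rank (set u)) u"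
  by (simp add: pack_def rank_def)

lemma strict_mono_rank: "finite A \<Longrightarrow> strict_mono_on A (rank A)"
proof (rule strict_mono_onI)
  fix r s assume *: "finite A" "r \<in> A" "s \<in> A" "r < s"
  then have "{b \<in> A. b \<le> r} \<subseteq> {b \<in> A. b \<le> s}" "s \<in> {b \<in> A. b \<le> s}" "s \<notin> {b \<in> A. b \<le> r}" by auto
  then have "{b \<in> A. b \<le> r} \<subset> {b \<in> A. b \<le> s}" by blast
  then show "rank A r < rank A s" unfolding rank_def using * by (intro psubset_card_mono) auto
qed

lemma inj_on_rank: "finite A \<Longrightarrow> inj_on (rank A) A"
  by (intro strict_mono_on_imp_inj_on strict_mono_rank)

lemma rank_image:
  assumes "finite A"
  shows "rank A ` A = {1..card A}"
proof (rule card_subset_eq)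
  have "rank A a \<le> card A" if "a \<in> A" for a
    unfolding rank_def using assms by (intro card_mono) auto
  moreover have "1 \<le> rank A a" if "a \<in> A" for a
  proof -
    have "{b \<in> A. b \<le> a} \<noteq> {}" using that by auto
    then show ?thesis using assms by (simp add: rank_def Suc_le_eq card_gt_0_iff)
  qed
  ultimately show "rank A ` A \<subseteq> {1..card A}" by auto
  show "card (rank A ` A) = card {1..card A}"
    using inj_on_rank[OF assms] by (simp add: card_image)
qed simp

lemma rank_atLeastAtMost: "a \<in> {1..n} \<Longrightarrow> rank {1..n} a = a"
proof -
  assume "a \<in> {1..n}"
  then have "{b \<in> {1..n}. b \<le> a} = {1..a}" by auto
  then show ?thesis by (simp add: rank_def)
qed

lemma set_pack: "set (pack u) = {1..card (set u)}"
  by (simp add: pack_eq_map_rank rank_image)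

lemma pack_id:
  assumes "set u = {1..n}"
  shows "pack u = u"
  unfolding pack_eq_map_rank using assms by (intro map_idI) (simp only: rank_atLeastAtMost)

lemma pack_mperms:
  assumes "m \<ge> 1" "balanced m u"
  shows "pack u \<in> mperms m (card (set u))"
  using assms by (simp add: mperms_iff set_pack) (simp add: pack_eq_map_rank balanced_map inj_on_rank)

lemma pack_all_mperms: "m \<ge> 1 \<Longrightarrow> balanced m u \<Longrightarrow> pack u \<in> all_mperms m"
  using pack_mperms by (auto simp: all_mperms_def)

lemma card_set_pack [simp]: "card (set (pack u)) = card (set u)"
  by (simp add: set_pack)

lemma pack_eq_Nil [simp]: "pack u = [] \<longleftrightarrow> u = []"
  by (simp add: pack_def)

section \<open>Cuts\<close>

definition cuts :: "nat \<Rightarrow> nat list \<Rightarrow> (nat list \<times> nat list) set"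
  where "cuts m \<alpha> = {(u, v). \<alpha> = u @ v \<and> mword m u \<and> mword m v}"

lemma finite_cuts: "finite (cuts m \<alpha>)"
proof -
  have "cuts m \<alpha> \<subseteq> (\<lambda>n. (take n \<alpha>, drop n \<alpha>)) ` {..length \<alpha>}"
  proof
    fix p assume "p \<in> cuts m \<alpha>"
    then obtain u v where "\<alpha> = u @ v" "p = (u, v)" by (auto simp: cuts_def)
    then show "p \<in> (\<lambda>n. (take n \<alpha>, drop n \<alpha>)) ` {..length \<alpha>}"
      by (intro image_eqI[of _ _ "length u"]) auto
  qed
  then show ?thesis using finite_subset by blast
qed

lemma cuts_subset: "(u, v) \<in> cuts m \<alpha> \<Longrightarrow> set u \<subseteq> set \<alpha> \<and> set v \<subseteq> set \<alpha>"
  by (auto simp: cuts_def)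

lemma cuts_balanced:
  assumes "balanced m \<alpha>" "(u, v) \<in> cuts m \<alpha>"
  shows "balanced m u" "balanced m v" "set u \<inter> set v = {}"
  using assms balanced_split[of m u v] by (auto simp: cuts_def)

lemma cuts_map:
  assumes "inj_on r (set u)"
  shows "cuts m (map r u) = (\<lambda>(a, b). (map r a, map r b)) ` cuts m u"
proof (intro equalityI subsetI)
  fix p assume "p \<in> cuts m (map r u)"
  then obtain x y where p: "p = (x, y)" "map r u = x @ y" "mword m x" "mword m y"
    by (auto simp: cuts_def)
  from p(2) obtain a b where ab: "u = a @ b" "x = map r a" "y = map r b"
    by (auto simp: map_eq_append_conv)
  then have "inj_on r (set a)" "inj_on r (set b)" using assms by (auto intro: inj_on_subset)
  then have "(a, b) \<in> cuts m u" using p(3,4) ab by (simp add: cuts_def mword_map)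
  then show "p \<in> (\<lambda>(a, b). (map r a, map r b)) ` cuts m u" using p(1) ab by force
next
  fix p assume "p \<in> (\<lambda>(a, b). (map r a, map r b)) ` cuts m u"
  then obtain a b where ab: "(a, b) \<in> cuts m u" "p = (map r a, map r b)" by auto
  then have "inj_on r (set a)" "inj_on r (set b)" using assms by (auto simp: cuts_def intro: inj_on_subset)
  then show "p \<in> cuts m (map r u)" using ab by (auto simp: cuts_def mword_map)
qed

text \<open>An increasing relabelling matches the cuts bijectively, and corresponding pieces pack to
  the same words. For packing itself this says that a piece may be packed before or after it is
  cut.\<close>

lemma sum_cuts_map:
  assumes r: "strict_mono_on (set u) r"
  shows "(\<Sum>(a, b)\<in>cuts m (map r u). f (pack a) (pack b)) = (\<Sum>(a, b)\<in>cuts m u. f (pack a) (pack b))"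
proof -
  have inj: "inj_on r (set u)" using r by (rule strict_mono_on_imp_inj_on)
  have injm: "inj_on (\<lambda>(a, b). (map r a, map r b)) (cuts m u)"
  proof (rule inj_onI, clarsimp)
    fix a b c d assume "(a, b) \<in> cuts m u" "(c, d) \<in> cuts m u" and e: "map r a = map r c" "map r b = map r d"
    then have "set a \<union> set c \<subseteq> set u" "set b \<union> set d \<subseteq> set u" using cuts_subset by blast+
    then have "inj_on r (set a \<union> set c)" "inj_on r (set b \<union> set d)"
      using inj by (blast intro: inj_on_subset)+
    then show "a = c \<and> b = d" using e by (simp add: inj_on_map_eq_map)
  qed
  have "(\<Sum>(a, b)\<in>cuts m (map r u). f (pack a) (pack b))
      = (\<Sum>(a, b)\<in>cuts m u. f (pack (map r a)) (pack (map r b)))"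
    unfolding cuts_map[OF inj] by (subst sum.reindex[OF injm]) (auto intro!: sum.cong)
  also have "\<dots> = (\<Sum>(a, b)\<in>cuts m u. f (pack a) (pack b))"
  proof (rule sum.cong, simp, clarify)
    fix a b assume "(a, b) \<in> cuts m u"
    then have "strict_mono_on (set a) r" "strict_mono_on (set b) r"
      using r by (auto simp: cuts_def monotone_on_def)
    then show "f (pack (map r a)) (pack (map r b)) = f (pack a) (pack b)" by (simp add: pack_map)
  qed
  finally show ?thesis .
qed

lemma sum_cuts_pack: "(\<Sum>(a, b)\<in>cuts m (pack u). f (pack a) (pack b)) = (\<Sum>(a, b)\<in>cuts m u. f (pack a) (pack b))"
  unfolding pack_eq_map_rank[of u] by (rule sum_cuts_map) (simp add: strict_mono_rank)

text \<open>Both sides range over the factorizations of \<alpha> into three m-words.\<close>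

lemma sum_cuts_assoc:
  "(\<Sum>(u, c)\<in>cuts m \<alpha>. \<Sum>(a, b)\<in>cuts m u. f a b c) = (\<Sum>(a, v)\<in>cuts m \<alpha>. \<Sum>(b, c)\<in>cuts m v. f a b c)"
proof -
  have "(\<Sum>(u, c)\<in>cuts m \<alpha>. \<Sum>(a, b)\<in>cuts m u. f a b c)
      = (\<Sum>((u, c), (a, b))\<in>(SIGMA p:cuts m \<alpha>. cuts m (fst p)). f a b c)"
    by (simp add: sum.Sigma finite_cuts case_prod_unfold)
  also have "\<dots> = (\<Sum>((a, v), (b, c))\<in>(SIGMA p:cuts m \<alpha>. cuts m (snd p)). f a b c)"
    by (rule sum.reindex_bij_witness[where
          i = "\<lambda>((a, v), (b, c)). ((a @ b, c), (a, b))" and j = "\<lambda>((u, c), (a, b)). ((a, b @ c), (b, c))"])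
      (auto simp: cuts_def intro: mword_append)
  also have "\<dots> = (\<Sum>(a, v)\<in>cuts m \<alpha>. \<Sum>(b, c)\<in>cuts m v. f a b c)"
    by (simp add: sum.Sigma finite_cuts case_prod_unfold)
  finally show ?thesis .
qed

section \<open>Shuffles\<close>

text \<open>A threshold separates the alphabets, so membership in a shuffle is a condition on two
  filters. All later shuffle identities become bijections between words and their filters, without
  recursion on shuffles.\<close>

lemma mem_shuffles_iff:
  assumes "\<forall>x\<in>set xs. x \<le> n" "\<forall>y\<in>set ys. n < (y::nat)"
  shows "zs \<in> shuffles xs ys \<longleftrightarrow> filter (\<lambda>x. x \<le> n) zs = xs \<and> filter (\<lambda>x. n < x) zs = ys"
proof
  assume z: "zs \<in> shuffles xs ys"
  have d: "set xs \<inter> set ys = {}" using assms by force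
  have "set zs = set xs \<union> set ys" using z by (rule set_shuffles)
  then have "filter (\<lambda>x. x \<le> n) zs = filter (\<lambda>x. x \<in> set xs) zs"
    "filter (\<lambda>x. n < x) zs = filter (\<lambda>x. x \<in> set ys) zs"
    using assms by (auto intro!: filter_cong dest: leD)
  then show "filter (\<lambda>x. x \<le> n) zs = xs \<and> filter (\<lambda>x. n < x) zs = ys"
    using filter_shuffles_disjoint1(1)[OF d z] filter_shuffles_disjoint2(1)[OF d z] by simp
next
  assume "filter (\<lambda>x. x \<le> n) zs = xs \<and> filter (\<lambda>x. n < x) zs = ys"
  then show "zs \<in> shuffles xs ys"
    using partition_in_shuffles[of zs "\<lambda>x. x \<le> n"] by (simp add: not_le)
qed

lemma map_shuffles:
  "map r ` shuffles xs ys = shuffles (map r xs) (map r ys)"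
proof -
  have "map r ` (#) x ` A = (#) (r x) ` map r ` A" for x A by (auto simp: image_image)
  then show ?thesis by (induction xs ys rule: shuffles.induct) (simp_all add: image_Un)
qed

text \<open>Truncated subtraction inverts the shift on the letters above n; positivity of the
  letters of \<open>ys\<close> keeps shifted letters strictly above n.\<close>

lemma shift_filter_iff:
  "filter (\<lambda>x. n < x) (zs :: nat list) = map (\<lambda>i. i + n) ys \<longleftrightarrow>
    (\<forall>y\<in>set ys. 0 < y) \<and> ys = map (\<lambda>i. i - n) (filter (\<lambda>x. n < x) zs)"
proof
  assume *: "filter (\<lambda>x. n < x) zs = map (\<lambda>i. i + n) ys"
  have "\<forall>x\<in>set (filter (\<lambda>x. n < x) zs). n < x" by simp
  then have "\<forall>x\<in>set (map (\<lambda>i. i + n) ys). n < x" unfolding * .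
  then show "(\<forall>y\<in>set ys. 0 < y) \<and> ys = map (\<lambda>i. i - n) (filter (\<lambda>x. n < x) zs)"
    unfolding * by (auto simp: o_def intro!: map_idI[symmetric])
next
  assume "(\<forall>y\<in>set ys. 0 < y) \<and> ys = map (\<lambda>i. i - n) (filter (\<lambda>x. n < x) zs)"
  then have "map (\<lambda>i. i + n) ys = map (\<lambda>i. i - n + n) (filter (\<lambda>x. n < x) zs)" by (simp add: o_def)
  also have "\<dots> = filter (\<lambda>x. n < x) zs" by (rule map_idI) auto
  finally show "filter (\<lambda>x. n < x) zs = map (\<lambda>i. i + n) ys" by simp
qed

lemma mem_shifted_shuffle_iff:
  assumes "set \<alpha> = {1..n}" "set \<beta> = {1..k}"
  shows "\<gamma> \<in> shifted_shuffle \<alpha> \<beta> \<longleftrightarrow>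
    filter (\<lambda>x. x \<le> n) \<gamma> = \<alpha> \<and> map (\<lambda>i. i - n) (filter (\<lambda>x. n < x) \<gamma>) = \<beta>"
proof -
  have "\<gamma> \<in> shifted_shuffle \<alpha> \<beta> \<longleftrightarrow>
    filter (\<lambda>x. x \<le> n) \<gamma> = \<alpha> \<and> filter (\<lambda>x. n < x) \<gamma> = map (\<lambda>i. i + n) \<beta>"
    unfolding shifted_shuffle_def using assms by (subst mem_shuffles_iff[where n = n]) auto
  also have "\<dots> \<longleftrightarrow> filter (\<lambda>x. x \<le> n) \<gamma> = \<alpha> \<and> map (\<lambda>i. i - n) (filter (\<lambda>x. n < x) \<gamma>) = \<beta>"
    using assms by (auto simp: shift_filter_iff)
  finally show ?thesis .
qed

lemma finite_shifted_shuffle [simp]: "finite (shifted_shuffle \<alpha> \<beta>)"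
  by (simp add: shifted_shuffle_def)

lemma count_list_filter: "count_list (filter Q w) a = (if Q a then count_list w a else 0)"
  by (induction w) auto

lemma shifted_shuffle_mperms:
  assumes m: "m \<ge> 1" and \<alpha>: "\<alpha> \<in> mperms m n" and \<beta>: "\<beta> \<in> mperms m k" and \<gamma>: "\<gamma> \<in> shifted_shuffle \<alpha> \<beta>"
  shows "\<gamma> \<in> mperms m (n + k)"
proof -
  note s = mperms_set[OF m \<alpha>] mperms_set[OF m \<beta>]
  have f: "filter (\<lambda>x. x \<le> n) \<gamma> = \<alpha>" "filter (\<lambda>x. n < x) \<gamma> = map (\<lambda>i. i + n) \<beta>"
    using \<gamma> mem_shifted_shuffle_iff[OF s] shift_filter_iff[of n \<gamma> \<beta>] s by auto
  have "set \<gamma> = set \<alpha> \<union> set (map (\<lambda>i. i + card (set \<alpha>)) \<beta>)"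
    using \<gamma> unfolding shifted_shuffle_def by (rule set_shuffles)
  then have "set \<gamma> \<subseteq> {1..n + k}" using s by auto
  moreover have "count_list \<gamma> a = m" if "a \<in> {1..n + k}" for a
  proof (cases "a \<le> n")
    case True
    then have "count_list \<gamma> a = count_list \<alpha> a" using f(1) count_list_filter[of "\<lambda>x. x \<le> n" \<gamma> a] by simp
    then show ?thesis using \<alpha> that True by (simp add: mperms_def)
  next
    case False
    then have "count_list \<gamma> a = count_list (map (\<lambda>i. i + n) \<beta>) a"
      using f(2) count_list_filter[of "\<lambda>x. n < x" \<gamma> a] by simp
    also have "\<dots> = count_list \<beta> (a - n)"
      using count_list_map_conv[of "\<lambda>i. i + n" \<beta> "a - n"] False by (simp add: inj_def)
    finally have "count_list \<gamma> a = count_list \<beta> (a - n)" .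
    moreover have "a - n \<in> {1..k}" using that False by auto
    ultimately show ?thesis using \<beta> by (simp add: mperms_def)
  qed
  ultimately show ?thesis by (simp add: mperms_def)
qed

text \<open>Both sides range over the words whose restrictions to three consecutive intervals of
  letters are \<alpha> and the shifts of \<beta> and \<kappa>; the intermediate shuffle is recovered
  as a restriction of the word.\<close>

lemma sum_shifted_shuffle_assoc:
  assumes m: "m \<ge> 1" and \<alpha>: "\<alpha> \<in> mperms m n" and \<beta>: "\<beta> \<in> mperms m k" and \<kappa>: "\<kappa> \<in> mperms m l"
  shows "(\<Sum>\<gamma>\<in>shifted_shuffle \<alpha> \<beta>. \<Sum>\<omega>\<in>shifted_shuffle \<gamma> \<kappa>. f \<omega>)
    = (\<Sum>\<epsilon>\<in>shifted_shuffle \<beta> \<kappa>. \<Sum>\<omega>\<in>shifted_shuffle \<alpha> \<epsilon>. f \<omega>)"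
proof -
  note s = mperms_set[OF m \<alpha>] mperms_set[OF m \<beta>] mperms_set[OF m \<kappa>]
  have s1: "set \<gamma> = {1..n + k}" if "\<gamma> \<in> shifted_shuffle \<alpha> \<beta>" for \<gamma>
    by (rule mperms_set[OF m shifted_shuffle_mperms[OF m \<alpha> \<beta> that]])
  have s2: "set \<epsilon> = {1..k + l}" if "\<epsilon> \<in> shifted_shuffle \<beta> \<kappa>" for \<epsilon>
    by (rule mperms_set[OF m shifted_shuffle_mperms[OF m \<beta> \<kappa> that]])
  let ?cond = "\<lambda>\<omega>. filter (\<lambda>x. x \<le> n) \<omega> = \<alpha> \<and>
    map (\<lambda>i. i - n) (filter (\<lambda>x. n < x \<and> x \<le> n + k) \<omega>) = \<beta> \<and>
    map (\<lambda>i. i - (n + k)) (filter (\<lambda>x. n + k < x) \<omega>) = \<kappa>"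
  have c1: "\<gamma> \<in> shifted_shuffle \<alpha> \<beta> \<and> \<omega> \<in> shifted_shuffle \<gamma> \<kappa> \<longleftrightarrow>
      ?cond \<omega> \<and> \<gamma> = filter (\<lambda>x. x \<le> n + k) \<omega>" for \<gamma> \<omega>
  proof -
    have "\<gamma> \<in> shifted_shuffle \<alpha> \<beta> \<and> \<omega> \<in> shifted_shuffle \<gamma> \<kappa> \<longleftrightarrow>
       \<gamma> \<in> shifted_shuffle \<alpha> \<beta> \<and> filter (\<lambda>x. x \<le> n + k) \<omega> = \<gamma> \<and>
         map (\<lambda>i. i - (n + k)) (filter (\<lambda>x. n + k < x) \<omega>) = \<kappa>"
      using mem_shifted_shuffle_iff[OF s1 s(3)] by auto
    also have "\<dots> \<longleftrightarrow> ?cond \<omega> \<and> \<gamma> = filter (\<lambda>x. x \<le> n + k) \<omega>"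
    proof -
      have "filter (\<lambda>x. x \<le> n) (filter (\<lambda>x. x \<le> n + k) \<omega>) = filter (\<lambda>x. x \<le> n) \<omega>"
        "filter (\<lambda>x. n < x) (filter (\<lambda>x. x \<le> n + k) \<omega>) = filter (\<lambda>x. n < x \<and> x \<le> n + k) \<omega>"
        by (auto intro: filter_cong)
      then show ?thesis unfolding mem_shifted_shuffle_iff[OF s(1,2)] by auto
    qed
    finally show ?thesis .
  qed
  have c2: "\<epsilon> \<in> shifted_shuffle \<beta> \<kappa> \<and> \<omega> \<in> shifted_shuffle \<alpha> \<epsilon> \<longleftrightarrow>
      ?cond \<omega> \<and> \<epsilon> = map (\<lambda>i. i - n) (filter (\<lambda>x. n < x) \<omega>)" for \<epsilon> \<omega>
  proof -
    have "\<epsilon> \<in> shifted_shuffle \<beta> \<kappa> \<and> \<omega> \<in> shifted_shuffle \<alpha> \<epsilon> \<longleftrightarrow>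
       \<epsilon> \<in> shifted_shuffle \<beta> \<kappa> \<and> filter (\<lambda>x. x \<le> n) \<omega> = \<alpha> \<and>
         map (\<lambda>i. i - n) (filter (\<lambda>x. n < x) \<omega>) = \<epsilon>"
      using mem_shifted_shuffle_iff[OF s(1) s2] by auto
    also have "\<dots> \<longleftrightarrow> ?cond \<omega> \<and> \<epsilon> = map (\<lambda>i. i - n) (filter (\<lambda>x. n < x) \<omega>)"
    proof -
      have "filter (\<lambda>x. x \<le> k) (map (\<lambda>i. i - n) (filter (\<lambda>x. n < x) \<omega>))
          = map (\<lambda>i. i - n) (filter (\<lambda>x. n < x \<and> x \<le> n + k) \<omega>)"
        by (auto simp: filter_map o_def intro!: arg_cong[of _ _ "map _"] filter_cong)
      moreover have "map (\<lambda>i. i - k) (filter (\<lambda>x. k < x) (map (\<lambda>i. i - n) (filter (\<lambda>x. n < x) \<omega>)))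
          = map (\<lambda>i. i - (n + k)) (filter (\<lambda>x. n + k < x) \<omega>)"
        by (auto simp: filter_map o_def intro!: arg_cong[of _ _ "map _"] filter_cong)
      ultimately show ?thesis unfolding mem_shifted_shuffle_iff[OF s(2,3)] by auto
    qed
    finally show ?thesis .
  qed
  let ?g = "\<lambda>\<omega>. filter (\<lambda>x. x \<le> n + k) \<omega>" and ?e = "\<lambda>\<omega>. map (\<lambda>i. i - n) (filter (\<lambda>x. n < x) \<omega>)"
  have S1: "(SIGMA \<gamma>:shifted_shuffle \<alpha> \<beta>. shifted_shuffle \<gamma> \<kappa>) = (\<lambda>\<omega>. (?g \<omega>, \<omega>)) ` {\<omega>. ?cond \<omega>}"
    using c1 by (auto simp: Sigma_def)
  have S2: "(SIGMA \<epsilon>:shifted_shuffle \<beta> \<kappa>. shifted_shuffle \<alpha> \<epsilon>) = (\<lambda>\<omega>. (?e \<omega>, \<omega>)) ` {\<omega>. ?cond \<omega>}"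
    using c2 by (auto simp: Sigma_def)
  have "(\<Sum>\<gamma>\<in>shifted_shuffle \<alpha> \<beta>. \<Sum>\<omega>\<in>shifted_shuffle \<gamma> \<kappa>. f \<omega>) = (\<Sum>\<omega>\<in>{\<omega>. ?cond \<omega>}. f \<omega>)"
    by (subst sum.Sigma) (simp_all add: S1 sum.reindex inj_on_def)
  moreover have "(\<Sum>\<epsilon>\<in>shifted_shuffle \<beta> \<kappa>. \<Sum>\<omega>\<in>shifted_shuffle \<alpha> \<epsilon>. f \<omega>) = (\<Sum>\<omega>\<in>{\<omega>. ?cond \<omega>}. f \<omega>)"
    by (subst sum.Sigma) (simp_all add: S2 sum.reindex inj_on_def)
  ultimately show ?thesis by simp
qed

section \<open>Compatibility of cuts with shuffles\<close>

abbreviation low :: "nat \<Rightarrow> nat list \<Rightarrow> nat list"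
  where "low n w \<equiv> filter (\<lambda>x. x \<le> n) w"

abbreviation high :: "nat \<Rightarrow> nat list \<Rightarrow> nat list"
  where "high n w \<equiv> map (\<lambda>i. i - n) (filter (\<lambda>x. n < x) w)"

lemma mem_shifted_iff:
  assumes "\<forall>x\<in>set a. x \<le> n" "\<forall>y\<in>set c. 0 < y"
  shows "u \<in> shuffles a (map (\<lambda>i. i + n) c) \<longleftrightarrow> low n u = a \<and> high n u = c"
proof -
  have "u \<in> shuffles a (map (\<lambda>i. i + n) c) \<longleftrightarrow> low n u = a \<and> filter (\<lambda>x. n < x) u = map (\<lambda>i. i + n) c"
    using assms by (intro mem_shuffles_iff) auto
  also have "\<dots> \<longleftrightarrow> low n u = a \<and> high n u = c"
    using assms by (auto simp: shift_filter_iff)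
  finally show ?thesis .
qed

text \<open>All occurrences of a letter lie on the same side of the threshold, so divisibility of
  the counts can be tested on each side.\<close>

lemma mword_low_high: "mword m u \<longleftrightarrow> mword m (low n u) \<and> mword m (high n u)"
proof -
  have l: "count_list (low n u) x = (if x \<le> n then count_list u x else 0)" for x
    by (rule count_list_filter)
  have h: "count_list (high n u) x = (if 0 < x then count_list u (x + n) else 0)" for x
    by (induction u) auto
  show ?thesis
    unfolding mword_def l h
    by (auto split: if_splits) (metis le_add_diff_inverse2 nle_le not_le zero_less_diff)
qed

text \<open>All shifted letters exceed those of \<open>a\<close>. Hence the rank in the union is the
  rank in \<open>a\<close> on the low letters, and the rank in \<open>c\<close> plus the number of
  letters of \<open>a\<close> on the high ones, which is the shift used by
  \<open>shifted_shuffle\<close>.\<close>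

lemma sum_shuffles_pack:
  assumes "\<forall>x\<in>set a. x \<le> n" "\<forall>y\<in>set c. 0 < y"
  shows "(\<Sum>p\<in>shifted_shuffle (pack a) (pack c). g p) = (\<Sum>u\<in>shuffles a (map (\<lambda>i. i + n) c). g (pack u))"
proof -
  let ?c = "map (\<lambda>i. i + n) c"
  let ?A = "set a \<union> set ?c"
  have "rank ?A x = rank (set a) x" if "x \<in> set a" for x
  proof -
    have "{b \<in> ?A. b \<le> x} = {b \<in> set a. b \<le> x}" using assms that by force
    then show ?thesis by (simp add: rank_def)
  qed
  then have ra: "map (rank ?A) a = pack a" by (simp add: pack_eq_map_rank)
  have "rank ?A (y + n) = rank (set c) y + card (set a)" if "y \<in> set c" for y
  proof -
    have "{b \<in> ?A. b \<le> y + n} = set a \<union> (\<lambda>i. i + n) ` {b \<in> set c. b \<le> y}"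
      using assms that by force
    moreover have "card (set a \<union> (\<lambda>i. i + n) ` {b \<in> set c. b \<le> y}) =
        card (set a) + card ((\<lambda>i. i + n) ` {b \<in> set c. b \<le> y})"
      using assms by (intro card_Un_disjoint) force+
    moreover have "card ((\<lambda>i. i + n) ` {b \<in> set c. b \<le> y}) = card {b \<in> set c. b \<le> y}"
      by (intro card_image inj_onI) simp
    ultimately show ?thesis by (simp add: rank_def)
  qed
  then have rc: "map (rank ?A) ?c = map (\<lambda>i. i + card (set (pack a))) (pack c)"
    by (simp add: pack_eq_map_rank[of c])
  have set: "set u = ?A" if "u \<in> shuffles a ?c" for u using that by (rule set_shuffles)
  have "shifted_shuffle (pack a) (pack c) = map (rank ?A) ` shuffles a ?c"
    unfolding shifted_shuffle_def map_shuffles ra rc ..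
  moreover have "inj_on (map (rank ?A)) (shuffles a ?c)"
  proof (rule inj_onI)
    fix u v assume "u \<in> shuffles a ?c" "v \<in> shuffles a ?c" "map (rank ?A) u = map (rank ?A) v"
    then show "u = v" using set[of u] set[of v] inj_on_rank[of ?A] by (simp add: inj_on_map_eq_map)
  qed
  ultimately have "(\<Sum>p\<in>shifted_shuffle (pack a) (pack c). g p) = (\<Sum>u\<in>shuffles a ?c. g (map (rank ?A) u))"
    by (simp add: sum.reindex)
  also have "\<dots> = (\<Sum>u\<in>shuffles a ?c. g (pack u))"
    using set by (intro sum.cong) (simp_all add: pack_eq_map_rank)
  finally show ?thesis .
qed

text \<open>Cutting a shuffle cuts its low and its high part, and two shuffled pieces concatenate to
  a shuffle. The pairs of pieces in \<open>T\<close> index both sides.\<close>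

lemma sum_cuts_shuffle_words:
  assumes m: "m \<ge> 1" and \<alpha>: "\<alpha> \<in> mperms m n" and \<beta>: "\<beta> \<in> mperms m k"
  shows "(\<Sum>\<gamma>\<in>shifted_shuffle \<alpha> \<beta>. \<Sum>(u, v)\<in>cuts m \<gamma>. h u v)
    = (\<Sum>(a, b)\<in>cuts m \<alpha>. \<Sum>(c, d)\<in>cuts m \<beta>. \<Sum>u\<in>shuffles a (map (\<lambda>i. i + n) c).
        \<Sum>v\<in>shuffles b (map (\<lambda>i. i + n) d). h u v)"
proof -
  note s = mperms_set[OF m \<alpha>] mperms_set[OF m \<beta>]
  define T where "T = {(u, v). (low n u, low n v) \<in> cuts m \<alpha> \<and> (high n u, high n v) \<in> cuts m \<beta>}"
  have l: "(\<gamma> \<in> shifted_shuffle \<alpha> \<beta> \<and> (u, v) \<in> cuts m \<gamma>) \<longleftrightarrow> \<gamma> = u @ v \<and> (u, v) \<in> T" for \<gamma> u v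
    using mword_low_high[of m u n] mword_low_high[of m v n]
    by (auto simp: mem_shifted_shuffle_iff[OF s] T_def cuts_def)
  have L: "(SIGMA \<gamma>:shifted_shuffle \<alpha> \<beta>. cuts m \<gamma>) = (\<lambda>p. (fst p @ snd p, p)) ` T"
  proof (rule Set.set_eqI)
    fix p :: "nat list \<times> nat list \<times> nat list"
    obtain \<gamma> u v where p: "p = (\<gamma>, u, v)" by (cases p) auto
    show "p \<in> (SIGMA \<gamma>:shifted_shuffle \<alpha> \<beta>. cuts m \<gamma>) \<longleftrightarrow> p \<in> (\<lambda>p. (fst p @ snd p, p)) ` T"
      unfolding p mem_Sigma_iff l by force
  qed
  have lhs: "(\<Sum>\<gamma>\<in>shifted_shuffle \<alpha> \<beta>. \<Sum>(u, v)\<in>cuts m \<gamma>. h u v) = (\<Sum>p\<in>T. h (fst p) (snd p))"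
    by (simp add: sum.Sigma finite_cuts case_prod_unfold L sum.reindex inj_on_def)
  let ?S = "\<lambda>a c. shuffles a (map (\<lambda>i. i + n) c)"
  let ?X = "cuts m \<alpha> \<times> cuts m \<beta>"
  let ?Y = "\<lambda>x. ?S (fst (fst x)) (fst (snd x)) \<times> ?S (snd (fst x)) (snd (snd x))"
  have r: "((a, b) \<in> cuts m \<alpha> \<and> (c, d) \<in> cuts m \<beta> \<and> u \<in> ?S a c \<and> v \<in> ?S b d) \<longleftrightarrow>
      a = low n u \<and> b = low n v \<and> c = high n u \<and> d = high n v \<and> (u, v) \<in> T" for a b c d u v
  proof -
    have "u \<in> ?S a c \<longleftrightarrow> low n u = a \<and> high n u = c" "v \<in> ?S b d \<longleftrightarrow> low n v = b \<and> high n v = d"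
      if "(a, b) \<in> cuts m \<alpha>" "(c, d) \<in> cuts m \<beta>"
      using cuts_subset[OF that(1)] cuts_subset[OF that(2)] s by (auto intro!: mem_shifted_iff)
    then show ?thesis unfolding T_def by blast
  qed
  have R: "Sigma ?X ?Y = (\<lambda>p. (((low n (fst p), low n (snd p)), (high n (fst p), high n (snd p))), p)) ` T"
  proof (rule Set.set_eqI)
    fix p :: "((nat list \<times> nat list) \<times> (nat list \<times> nat list)) \<times> nat list \<times> nat list"
    obtain a b c d u v where p: "p = (((a, b), (c, d)), u, v)" by (cases p) auto
    show "p \<in> Sigma ?X ?Y \<longleftrightarrow>
      p \<in> (\<lambda>p. (((low n (fst p), low n (snd p)), (high n (fst p), high n (snd p))), p)) ` T"
      using r[of a b c d u v] unfolding p mem_Sigma_iff by force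
  qed
  have "(\<Sum>(a, b)\<in>cuts m \<alpha>. \<Sum>(c, d)\<in>cuts m \<beta>. \<Sum>u\<in>?S a c. \<Sum>v\<in>?S b d. h u v)
      = (\<Sum>x\<in>?X. \<Sum>y\<in>?Y x. h (fst y) (snd y))"
    by (simp add: sum.cartesian_product case_prod_unfold)
  also have "\<dots> = (\<Sum>p\<in>T. h (fst p) (snd p))"
    by (subst sum.Sigma) (simp_all add: finite_cuts case_prod_unfold R sum.reindex inj_on_def)
  finally show ?thesis using lhs by simp
qed

lemma sum_cuts_shuffle:
  assumes m: "m \<ge> 1" and \<alpha>: "\<alpha> \<in> mperms m n" and \<beta>: "\<beta> \<in> mperms m k"
  shows "(\<Sum>\<gamma>\<in>shifted_shuffle \<alpha> \<beta>. \<Sum>(u, v)\<in>cuts m \<gamma>. f (pack u) (pack v))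
    = (\<Sum>(a, b)\<in>cuts m \<alpha>. \<Sum>(c, d)\<in>cuts m \<beta>. \<Sum>p\<in>shifted_shuffle (pack a) (pack c).
        \<Sum>q\<in>shifted_shuffle (pack b) (pack d). f p q)"
  unfolding sum_cuts_shuffle_words[OF assms, of "\<lambda>u v. f (pack u) (pack v)"]
proof (intro sum.cong HOL.refl, clarify, intro sum.cong HOL.refl, clarify)
  fix a b c d assume "(a, b) \<in> cuts m \<alpha>" "(c, d) \<in> cuts m \<beta>"
  note cuts_subset[OF this(1)] cuts_subset[OF this(2)]
  then have "set a \<union> set b \<subseteq> {1..n}" "set c \<union> set d \<subseteq> {1..k}"
    unfolding mperms_set[OF m \<alpha>] mperms_set[OF m \<beta>] by blast+
  then have *: "\<forall>x\<in>set a. x \<le> n" "\<forall>x\<in>set b. x \<le> n" "\<forall>y\<in>set c. 0 < y" "\<forall>y\<in>set d. 0 < y"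
    by auto
  show "(\<Sum>u\<in>shuffles a (map (\<lambda>i. i + n) c). \<Sum>v\<in>shuffles b (map (\<lambda>i. i + n) d). f (pack u) (pack v))
    = (\<Sum>p\<in>shifted_shuffle (pack a) (pack c). \<Sum>q\<in>shifted_shuffle (pack b) (pack d). f p q)"
    unfolding sum_shuffles_pack[OF *(1,3)] sum_shuffles_pack[OF *(2,4)] ..
qed

section \<open>The Hopf algebra of m-permutations\<close>

definition fmult :: "nat list \<Rightarrow> nat list \<Rightarrow> (nat list \<Rightarrow>\<^sub>0 'k::field_char_0)"
  where "fmult \<alpha> \<beta> = (\<Sum>\<gamma>\<in>shifted_shuffle \<alpha> \<beta>. F \<gamma>)"

text \<open>Packing replaces m-standardization, with which it coincides on the pieces when \<alpha>
  is an m-permutation.\<close>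

definition fcomult :: "nat \<Rightarrow> nat list \<Rightarrow> ((nat list \<Rightarrow>\<^sub>0 'k::field_char_0) \<times> (nat list \<Rightarrow>\<^sub>0 'k) \<Rightarrow>\<^sub>0 'k)"
  where "fcomult m \<alpha> = (\<Sum>(u, v)\<in>cuts m \<alpha>. tens (F (pack u)) (F (pack v)))"

lemma FQSym_simps [simp]:
  "carrier (FQSym m) = {x. keys x \<subseteq> all_mperms m}"
  "x \<otimes>\<^bsub>FQSym m\<^esub> y = lin_ext (\<lambda>\<alpha>. lin_ext (fmult \<alpha>) y) x"
  "\<one>\<^bsub>FQSym m\<^esub> = F []" "\<zero>\<^bsub>FQSym m\<^esub> = 0" "x \<oplus>\<^bsub>FQSym m\<^esub> y = x + y"
  "r \<odot>\<^bsub>FQSym m\<^esub> x = pscale r x" "counit (FQSym m) x = lookup x []"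
  "grade (FQSym m) n = {x. keys x \<subseteq> mperms m n}"
  by (simp_all add: FQSym_def fmult_def[abs_def])

lemma all_mperms_balanced: "m \<ge> 1 \<Longrightarrow> \<alpha> \<in> all_mperms m \<Longrightarrow> balanced m \<alpha>"
  by (auto simp: all_mperms_def mperms_iff)

lemma comult_FQSym:
  assumes "m \<ge> 1" "keys x \<subseteq> all_mperms m"
  shows "comult (FQSym m) x = lin_ext (fcomult m) x"
proof -
  have "comult (FQSym m) x = lin_ext (\<lambda>\<alpha>. \<Sum>(u, v)\<in>cuts m \<alpha>. tens (F (mstd m u)) (F (mstd m v))) x"
    by (simp add: FQSym_def cuts_def)
  also have "\<dots> = lin_ext (fcomult m) x"
    unfolding fcomult_def
  proof (intro lin_ext_cong sum.cong HOL.refl, clarify)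
    fix \<alpha> u v assume "\<alpha> \<in> keys x" "(u, v) \<in> cuts m \<alpha>"
    then have "balanced m u" "balanced m v"
      using cuts_balanced all_mperms_balanced[OF assms(1)] assms(2) by blast+
    then show "tens (F (mstd m u)) (F (mstd m v)) = tens (F (pack u)) (F (pack v))"
      by (simp add: mstd_balanced)
  qed
  finally show ?thesis .
qed

lemma pack_cuts_mperms:
  assumes "m \<ge> 1" "\<alpha> \<in> all_mperms m" "(u, v) \<in> cuts m \<alpha>"
  shows "pack u \<in> all_mperms m" "pack v \<in> all_mperms m"
  using assms cuts_balanced[OF all_mperms_balanced[OF assms(1,2)] assms(3)] by (auto intro: pack_all_mperms)

lemma lin_ext_fmult: "lin_ext g (fmult \<alpha> \<beta>) = (\<Sum>\<gamma>\<in>shifted_shuffle \<alpha> \<beta>. g \<gamma>)"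
  by (simp add: fmult_def lin_ext_sum)

lemma lin_ext_fcomult: "lin_ext g (fcomult m \<alpha>) = (\<Sum>(u, v)\<in>cuts m \<alpha>. g (F (pack u), F (pack v)))"
  by (simp add: fcomult_def lin_ext_sum case_prod_unfold)

lemma lsum_fcomult: "lsum g (fcomult m \<alpha>) = (\<Sum>(u, v)\<in>cuts m \<alpha>. g (F (pack u), F (pack v)))"
  by (simp add: fcomult_def lsum_sum case_prod_unfold)

lemma fmult_Nil_left: "fmult [] \<beta> = F \<beta>"
  by (simp add: fmult_def shifted_shuffle_def)

lemma fmult_Nil_right: "fmult \<alpha> [] = F \<alpha>"
  by (simp add: fmult_def shifted_shuffle_def)

lemma keys_sum_single: "finite A \<Longrightarrow> keys (\<Sum>a\<in>A. single (f a) 1 :: 'b \<Rightarrow>\<^sub>0 'k::field) \<subseteq> f ` A"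
  by (rule order_trans[OF Poly_Mapping.keys_sum]) auto

lemma shifted_shuffle_all_mperms:
  assumes "m \<ge> 1" "\<alpha> \<in> all_mperms m" "\<beta> \<in> all_mperms m"
  shows "shifted_shuffle \<alpha> \<beta> \<subseteq> all_mperms m"
  using assms shifted_shuffle_mperms[OF assms(1)] unfolding all_mperms_def by blast

lemma keys_fmult: "keys (fmult \<alpha> \<beta> :: _ \<Rightarrow>\<^sub>0 'k::field_char_0) \<subseteq> shifted_shuffle \<alpha> \<beta>"
  unfolding fmult_def using keys_sum_single[of "shifted_shuffle \<alpha> \<beta>" "\<lambda>x. x"] by simp

lemma lookup_fmult: "lookup (fmult \<alpha> \<beta> :: _ \<Rightarrow>\<^sub>0 'k::field_char_0) \<gamma> = (if \<gamma> \<in> shifted_shuffle \<alpha> \<beta> then 1 else 0)"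
  by (simp add: fmult_def lookup_sum lookup_single when_def)

locale m_permutations =
  fixes m :: nat and scalars :: "'k::field_char_0 itself"
  assumes m: "m \<ge> 1"
begin

abbreviation H :: "('k, nat list \<Rightarrow>\<^sub>0 'k) hopf" where "H \<equiv> FQSym m"

sublocale free_space H "all_mperms m" "\<lambda>w. card (set w)"
proof unfold_locales
  show "carrier H = {x. keys x \<subseteq> all_mperms m}" by simp
  show "\<zero>\<^bsub>H\<^esub> = 0" by simp
  show "x \<oplus>\<^bsub>H\<^esub> y = x + y" for x y by simp
  show "r \<odot>\<^bsub>H\<^esub> x = pscale r x" for r x by simp
  show "finite {w \<in> all_mperms m. card (set w) = n}" for n
    unfolding mperms_eq[OF m] by (rule finite_mperms)
  show "grade H n = {x. keys x \<subseteq> {w \<in> all_mperms m. card (set w) = n}}" for n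
    unfolding mperms_eq[OF m] by simp
qed

lemma FQSym_mult_closed:
  assumes "x \<in> carrier H" "y \<in> carrier H"
  shows "x \<otimes>\<^bsub>H\<^esub> y \<in> carrier H"
  unfolding FQSym_simps(2)
proof (intro lin_ext_carrier)
  fix \<alpha> \<beta> assume "\<alpha> \<in> keys x" "\<beta> \<in> keys y"
  then have "shifted_shuffle \<alpha> \<beta> \<subseteq> all_mperms m"
    using assms by (intro shifted_shuffle_all_mperms m) auto
  then show "fmult \<alpha> \<beta> \<in> carrier H"
    using keys_fmult by (simp, blast)
qed

lemma FQSym_mult_assoc:
  assumes x: "x \<in> carrier H" and y: "y \<in> carrier H" and z: "z \<in> carrier H"
  shows "x \<otimes>\<^bsub>H\<^esub> y \<otimes>\<^bsub>H\<^esub> z = x \<otimes>\<^bsub>H\<^esub> (y \<otimes>\<^bsub>H\<^esub> z)"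
proof -
  have "x \<otimes>\<^bsub>H\<^esub> y \<otimes>\<^bsub>H\<^esub> z
      = lin_ext (\<lambda>\<alpha>. lin_ext (\<lambda>\<beta>. lin_ext (\<lambda>\<gamma>. lin_ext (fmult \<gamma>) z) (fmult \<alpha> \<beta>)) y) x"
    by (simp add: lin_ext_lin_ext)
  also have "\<dots> = lin_ext (\<lambda>\<alpha>. lin_ext (\<lambda>\<beta>. lin_ext (\<lambda>\<kappa>. lin_ext (\<lambda>\<gamma>. fmult \<gamma> \<kappa>) (fmult \<alpha> \<beta>)) z) y) x"
    by (intro lin_ext_cong lin_ext_swap)
  also have "\<dots> = lin_ext (\<lambda>\<alpha>. lin_ext (\<lambda>\<beta>. lin_ext (\<lambda>\<kappa>. lin_ext (fmult \<alpha>) (fmult \<beta> \<kappa>)) z) y) x"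
  proof (intro lin_ext_cong)
    fix \<alpha> \<beta> \<kappa> assume "\<alpha> \<in> keys x" "\<beta> \<in> keys y" "\<kappa> \<in> keys z"
    then obtain n k l where "\<alpha> \<in> mperms m n" "\<beta> \<in> mperms m k" "\<kappa> \<in> mperms m l"
      using assms by (fastforce simp: all_mperms_def)
    from sum_shifted_shuffle_assoc[OF m this, of "\<lambda>\<omega>. F \<omega>"]
    show "lin_ext (\<lambda>\<gamma>. fmult \<gamma> \<kappa>) (fmult \<alpha> \<beta>) = lin_ext (fmult \<alpha>) (fmult \<beta> \<kappa>)"
      unfolding lin_ext_fmult by (simp add: fmult_def)
  qed
  also have "\<dots> = x \<otimes>\<^bsub>H\<^esub> (y \<otimes>\<^bsub>H\<^esub> z)"
    by (simp add: lin_ext_lin_ext)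
  finally show ?thesis .
qed

lemma FQSym_ring: "ring H"
proof (rule ringI)
  show "abelian_group H" by (rule abelian_group)
  show "Group.monoid H"
  proof (rule monoidI)
    show "\<one>\<^bsub>H\<^esub> \<in> carrier H" by (simp add: Nil_all_mperms)
    have "fmult [] = (F :: _ \<Rightarrow> _ \<Rightarrow>\<^sub>0 'k)" by (rule ext) (rule fmult_Nil_left)
    then show "\<one>\<^bsub>H\<^esub> \<otimes>\<^bsub>H\<^esub> x = x" "x \<otimes>\<^bsub>H\<^esub> \<one>\<^bsub>H\<^esub> = x" for x
      by (simp_all add: fmult_Nil_right)
  qed (rule FQSym_mult_closed FQSym_mult_assoc; assumption)+
  show "(x \<oplus>\<^bsub>H\<^esub> y) \<otimes>\<^bsub>H\<^esub> z = x \<otimes>\<^bsub>H\<^esub> z \<oplus>\<^bsub>H\<^esub> y \<otimes>\<^bsub>H\<^esub> z"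
    and "z \<otimes>\<^bsub>H\<^esub> (x \<oplus>\<^bsub>H\<^esub> y) = z \<otimes>\<^bsub>H\<^esub> x \<oplus>\<^bsub>H\<^esub> z \<otimes>\<^bsub>H\<^esub> y" for x y z
    by (simp_all add: lin_ext_add lin_ext_fun_add)
qed

lemma FQSym_unital_algebra: "unital_algebra H"
  unfolding unital_algebra_def using module FQSym_ring
  by (simp add: lin_ext_pscale lin_ext_fun_pscale)

lemma keys_comult_FQSym:
  assumes "x \<in> carrier H"
  shows "keys (comult H x) \<subseteq> carrier H \<times> carrier H"
proof -
  have "keys (fcomult m \<alpha>) \<subseteq> carrier H \<times> carrier H" if "\<alpha> \<in> all_mperms m" for \<alpha>
    unfolding fcomult_def using pack_cuts_mperms[OF m that]
    by (intro order_trans[OF Poly_Mapping.keys_sum] UN_least) auto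
  then show ?thesis
    using assms by (simp add: comult_FQSym[OF m]) (intro order_trans[OF keys_lin_ext] UN_least, auto)
qed

lemma comult_F: "\<alpha> \<in> all_mperms m \<Longrightarrow> comult H (F \<alpha>) = fcomult m \<alpha>"
  by (subst comult_FQSym[OF m]) auto

text \<open>Both iterated coproducts list the factorizations into three m-words, already as
  representatives, since packing a piece before cutting it leaves the packed pieces
  unchanged.\<close>

lemma FQSym_coassoc:
  assumes "x \<in> carrier H"
  shows "lin_ext (\<lambda>(a, c). lin_ext (\<lambda>(a', b). tens3 a' b c) (comult H a)) (comult H x)
    = lin_ext (\<lambda>(a, c). lin_ext (\<lambda>(b, c'). tens3 a b c') (comult H c)) (comult H x)"
proof -
  have "lin_ext (\<lambda>(a, c). lin_ext (\<lambda>(a', b). tens3 a' b c) (comult H a)) (fcomult m \<alpha>)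
    = lin_ext (\<lambda>(a, c). lin_ext (\<lambda>(b, c'). tens3 a b c') (comult H c)) (fcomult m \<alpha>)"
    if \<alpha>: "\<alpha> \<in> all_mperms m" for \<alpha>
  proof -
    let ?f = "\<lambda>a b c. tens3 (F (pack a)) (F (pack b)) (F (pack c)) :: _ \<Rightarrow>\<^sub>0 'k"
    have s1: "(\<Sum>(a, b)\<in>cuts m (pack u). ?f a b v) = (\<Sum>(a, b)\<in>cuts m u. ?f a b v)" for u v
      by (rule sum_cuts_pack[where f = "\<lambda>a b. tens3 (F a) (F b) (F (pack v))"])
    have s2: "(\<Sum>(b, c)\<in>cuts m (pack v). ?f u b c) = (\<Sum>(b, c)\<in>cuts m v. ?f u b c)" for u v
      by (rule sum_cuts_pack[where f = "\<lambda>b c. tens3 (F (pack u)) (F b) (F c)"])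
    have "lin_ext (\<lambda>(a, c). lin_ext (\<lambda>(a', b). tens3 a' b c) (comult H a)) (fcomult m \<alpha>)
      = (\<Sum>(u, v)\<in>cuts m \<alpha>. \<Sum>(a, b)\<in>cuts m (pack u). ?f a b v)"
      unfolding lin_ext_fcomult
      by (intro sum.cong) (auto simp: comult_F pack_cuts_mperms[OF m \<alpha>] lin_ext_fcomult)
    also have "\<dots> = (\<Sum>(u, v)\<in>cuts m \<alpha>. \<Sum>(a, b)\<in>cuts m u. ?f a b v)"
      unfolding s1 ..
    also have "\<dots> = (\<Sum>(u, v)\<in>cuts m \<alpha>. \<Sum>(b, c)\<in>cuts m v. ?f u b c)"
      by (rule sum_cuts_assoc)
    also have "\<dots> = (\<Sum>(u, v)\<in>cuts m \<alpha>. \<Sum>(b, c)\<in>cuts m (pack v). ?f u b c)"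
      unfolding s2 ..
    also have "\<dots> = lin_ext (\<lambda>(a, c). lin_ext (\<lambda>(b, c'). tens3 a b c') (comult H c)) (fcomult m \<alpha>)"
      unfolding lin_ext_fcomult
      by (intro sum.cong) (auto simp: comult_F pack_cuts_mperms[OF m \<alpha>] lin_ext_fcomult)
    finally show ?thesis .
  qed
  then show ?thesis
    unfolding comult_FQSym[OF m assms[unfolded FQSym_simps(1) mem_Collect_eq]] lin_ext_lin_ext
    by (rule lin_ext_cong) (use assms in auto)
qed

lemma FQSym_counit:
  assumes x: "x \<in> carrier H"
  shows "leval H (\<lambda>(a, b). counit H a \<odot>\<^bsub>H\<^esub> b) (comult H x) = x"
    "leval H (\<lambda>(a, b). counit H b \<odot>\<^bsub>H\<^esub> a) (comult H x) = x"
proof -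
  note kx = keys_comult_FQSym[OF x]
  have x': "keys x \<subseteq> all_mperms m" using x by simp
  have *: "lin_ext (\<lambda>(a, b). pscale (lookup a []) b) (fcomult m \<alpha>) = F \<alpha>"
     "lin_ext (\<lambda>(a, b). pscale (lookup b []) a) (fcomult m \<alpha>) = F \<alpha>" if "\<alpha> \<in> all_mperms m" for \<alpha>
  proof -
    have mw: "mword m \<alpha>" by (rule balanced_mword[OF all_mperms_balanced[OF m that]])
    have pk: "pack \<alpha> = \<alpha>" using that m by (auto simp: all_mperms_def mperms_iff intro: pack_id)
    have "lin_ext (\<lambda>(a, b). pscale (lookup a []) b) (fcomult m \<alpha>)
      = (\<Sum>(u, v)\<in>cuts m \<alpha>. pscale (lookup (F (pack u)) []) (F (pack v)))"
      by (simp add: lin_ext_fcomult)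
    \<comment> \<open>A piece packs to the empty word only if it is empty, so the cut with empty
      left piece alone contributes.\<close>
    also have "\<dots> = (\<Sum>(u, v)\<in>{([], \<alpha>)}. pscale (lookup (F (pack u)) []) (F (pack v)))"
      using mw by (intro sum.mono_neutral_right finite_cuts) (auto simp: cuts_def mword_def lookup_single)
    finally show "lin_ext (\<lambda>(a, b). pscale (lookup a []) b) (fcomult m \<alpha>) = F \<alpha>"
      by (simp add: pk pack_def[of "[]"])
    have "lin_ext (\<lambda>(a, b). pscale (lookup b []) a) (fcomult m \<alpha>)
      = (\<Sum>(u, v)\<in>cuts m \<alpha>. pscale (lookup (F (pack v)) []) (F (pack u)))"
      by (simp add: lin_ext_fcomult)
    also have "\<dots> = (\<Sum>(u, v)\<in>{(\<alpha>, [])}. pscale (lookup (F (pack v)) []) (F (pack u)))"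
      using mw by (intro sum.mono_neutral_right finite_cuts) (auto simp: cuts_def mword_def lookup_single)
    finally show "lin_ext (\<lambda>(a, b). pscale (lookup b []) a) (fcomult m \<alpha>) = F \<alpha>"
      by (simp add: pk pack_def[of "[]"])
  qed
  have sc: "pscale r a \<in> carrier H" if "a \<in> carrier H" for r a
    using free.subspace_scale[OF subspace_carrier that] .
  have "leval H (\<lambda>(a, b). counit H a \<odot>\<^bsub>H\<^esub> b) (comult H x)
      = lin_ext (\<lambda>(a, b). counit H a \<odot>\<^bsub>H\<^esub> b) (comult H x)"
    by (rule leval_eq_lin_ext) (use kx in \<open>auto simp del: FQSym_simps(1) intro: sc\<close>)
  also have "\<dots> = lin_ext (\<lambda>(a, b). pscale (lookup a []) b) (comult H x)"
    by (simp add: case_prod_unfold)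
  also have "\<dots> = lin_ext (\<lambda>\<alpha>. F \<alpha>) x"
    unfolding comult_FQSym[OF m x'] lin_ext_lin_ext by (rule lin_ext_cong) (use x' * in auto)
  finally show "leval H (\<lambda>(a, b). counit H a \<odot>\<^bsub>H\<^esub> b) (comult H x) = x" by simp
  have "leval H (\<lambda>(a, b). counit H b \<odot>\<^bsub>H\<^esub> a) (comult H x)
      = lin_ext (\<lambda>(a, b). counit H b \<odot>\<^bsub>H\<^esub> a) (comult H x)"
    by (rule leval_eq_lin_ext) (use kx in \<open>auto simp del: FQSym_simps(1) intro: sc\<close>)
  also have "\<dots> = lin_ext (\<lambda>(a, b). pscale (lookup b []) a) (comult H x)"
    by (simp add: case_prod_unfold)
  also have "\<dots> = lin_ext (\<lambda>\<alpha>. F \<alpha>) x"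
    unfolding comult_FQSym[OF m x'] lin_ext_lin_ext by (rule lin_ext_cong) (use x' * in auto)
  finally show "leval H (\<lambda>(a, b). counit H b \<odot>\<^bsub>H\<^esub> a) (comult H x) = x" by simp
qed

lemma comult_FQSym_linear:
  assumes "x \<in> carrier H" "y \<in> carrier H"
  shows "comult H (x + y) = comult H x + comult H y" "comult H (pscale r x) = pscale r (comult H x)"
proof -
  have "x + y \<in> carrier H" "pscale r x \<in> carrier H"
    using assms free.subspace_add[OF subspace_carrier] free.subspace_scale[OF subspace_carrier] by blast+
  then show "comult H (x + y) = comult H x + comult H y" "comult H (pscale r x) = pscale r (comult H x)"
    using assms by (simp_all add: comult_FQSym[OF m] lin_ext_add lin_ext_pscale)
qed

lemma FQSym_counital_coalgebra: "counital_coalgebra H"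
  unfolding counital_coalgebra_def
  by (intro conjI ballI allI keys_comult_FQSym FQSym_counit)
    (simp_all add: FQSym_coassoc comult_FQSym_linear functional_on_def lookup_add del: FQSym_simps(1))

text \<open>The representatives differ, one side having sums inside its tensors and the other only
  basis vectors; their coefficients agree by the identity between cuts and shuffles.\<close>

lemma FQSym_comult_mult:
  assumes x: "x \<in> carrier H" and y: "y \<in> carrier H"
  shows "tensor_eq H (comult H (x \<otimes>\<^bsub>H\<^esub> y))
     (lin_ext (\<lambda>(a, b). lin_ext (\<lambda>(c, d). tens (a \<otimes>\<^bsub>H\<^esub> c) (b \<otimes>\<^bsub>H\<^esub> d)) (comult H y)) (comult H x))"
proof (rule tensor_eqI_lookup)
  show "keys (comult H (x \<otimes>\<^bsub>H\<^esub> y)) \<subseteq> carrier H \<times> carrier H"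
    by (intro keys_comult_FQSym FQSym_mult_closed x y)
  have "keys (lin_ext (\<lambda>(c, d). tens (a \<otimes>\<^bsub>H\<^esub> c) (b \<otimes>\<^bsub>H\<^esub> d)) (comult H y)) \<subseteq> carrier H \<times> carrier H"
    if "(a, b) \<in> keys (comult H x)" for a b
    using keys_comult_FQSym[OF y] keys_comult_FQSym[OF x] that
    by (intro order_trans[OF keys_lin_ext] UN_least)
      (auto simp del: FQSym_simps(1,2) intro!: FQSym_mult_closed)
  then show "keys (lin_ext (\<lambda>(a, b). lin_ext (\<lambda>(c, d). tens (a \<otimes>\<^bsub>H\<^esub> c) (b \<otimes>\<^bsub>H\<^esub> d)) (comult H y)) (comult H x))
      \<subseteq> carrier H \<times> carrier H"
    by (intro order_trans[OF keys_lin_ext] UN_least) (auto simp del: FQSym_simps(1,2))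
  fix i j :: "nat list"
  have x': "keys x \<subseteq> all_mperms m" and y': "keys y \<subseteq> all_mperms m" using x y by auto
  have xy': "keys (x \<otimes>\<^bsub>H\<^esub> y) \<subseteq> all_mperms m" using FQSym_mult_closed[OF x y] by simp
  let ?e = "\<lambda>p. lookup (fst p) i * lookup (snd p) j"
  let ?f = "\<lambda>p q. lookup (F p) i * lookup (F q) j :: 'k"
  have lm: "lookup (fmult \<alpha> \<beta>) w = (\<Sum>\<gamma>\<in>shifted_shuffle \<alpha> \<beta>. lookup (F \<gamma>) w :: 'k)" for \<alpha> \<beta> w
    by (simp add: fmult_def lookup_sum)
  have "lsum ?e (comult H (x \<otimes>\<^bsub>H\<^esub> y)) = lsum (\<lambda>\<alpha>. lsum (\<lambda>\<beta>.
      \<Sum>\<gamma>\<in>shifted_shuffle \<alpha> \<beta>. \<Sum>(u, v)\<in>cuts m \<gamma>. ?f (pack u) (pack v)) y) x"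
    unfolding comult_FQSym[OF m xy']
    by (simp add: lsum_lin_ext lsum_fcomult) (simp add: fmult_def lsum_sum)
  also have "\<dots> = lsum (\<lambda>\<alpha>. lsum (\<lambda>\<beta>. \<Sum>(a, b)\<in>cuts m \<alpha>. \<Sum>(c, d)\<in>cuts m \<beta>.
      \<Sum>p\<in>shifted_shuffle (pack a) (pack c). \<Sum>q\<in>shifted_shuffle (pack b) (pack d). ?f p q) y) x"
  proof (intro lsum_cong)
    fix \<alpha> \<beta> assume "\<alpha> \<in> keys x" "\<beta> \<in> keys y"
    then obtain n k where "\<alpha> \<in> mperms m n" "\<beta> \<in> mperms m k"
      using x' y' by (fastforce simp: all_mperms_def)
    from sum_cuts_shuffle[OF m this, of ?f]
    show "(\<Sum>\<gamma>\<in>shifted_shuffle \<alpha> \<beta>. \<Sum>(u, v)\<in>cuts m \<gamma>. ?f (pack u) (pack v))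
      = (\<Sum>(a, b)\<in>cuts m \<alpha>. \<Sum>(c, d)\<in>cuts m \<beta>.
      \<Sum>p\<in>shifted_shuffle (pack a) (pack c). \<Sum>q\<in>shifted_shuffle (pack b) (pack d). ?f p q)" .
  qed
  also have "\<dots> = lsum (\<lambda>\<alpha>. \<Sum>(a, b)\<in>cuts m \<alpha>. lsum (\<lambda>\<beta>. \<Sum>(c, d)\<in>cuts m \<beta>.
      lookup (fmult (pack a) (pack c)) i * lookup (fmult (pack b) (pack d)) j) y) x"
    by (simp add: lsum_fun_sum case_prod_unfold lm sum_product)
  also have "\<dots> = lsum ?e (lin_ext (\<lambda>(a, b). lin_ext (\<lambda>(c, d). tens (a \<otimes>\<^bsub>H\<^esub> c) (b \<otimes>\<^bsub>H\<^esub> d)) (comult H y)) (comult H x))"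
    unfolding comult_FQSym[OF m x'] comult_FQSym[OF m y']
    by (simp add: lsum_lin_ext lsum_fcomult case_prod_unfold)
  finally show "lsum (\<lambda>(a, b). lookup a i * lookup b j) (comult H (x \<otimes>\<^bsub>H\<^esub> y)) = lsum (\<lambda>(a, b). lookup a i * lookup b j)
     (lin_ext (\<lambda>(a, b). lin_ext (\<lambda>(c, d). tens (a \<otimes>\<^bsub>H\<^esub> c) (b \<otimes>\<^bsub>H\<^esub> d)) (comult H y)) (comult H x))"
    by (simp add: case_prod_unfold)
qed

lemma FQSym_counit_mult: "counit H (x \<otimes>\<^bsub>H\<^esub> y) = counit H x * counit H y"
proof -
  have "lookup (fmult \<alpha> \<beta> :: _ \<Rightarrow>\<^sub>0 'k) [] = lookup (F \<alpha>) [] * lookup (F \<beta>) []" for \<alpha> \<beta>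
    by (simp add: lookup_fmult shifted_shuffle_def lookup_single when_def)
  then show ?thesis
    by (simp add: lookup_lin_ext lsum_lookup_single flip: lsum_mult)
qed

lemma FQSym_bialgebra: "bialgebra H"
  unfolding bialgebra_def
proof (intro conjI ballI FQSym_unital_algebra FQSym_counital_coalgebra FQSym_counit_mult FQSym_comult_mult)
  have "cuts m [] = {([], [])}" by (auto simp: cuts_def mword_def)
  then have "comult H \<one>\<^bsub>H\<^esub> = tens \<one>\<^bsub>H\<^esub> \<one>\<^bsub>H\<^esub>"
    by (simp add: comult_F Nil_all_mperms) (simp add: fcomult_def pack_def)
  then show "tensor_eq H (comult H \<one>\<^bsub>H\<^esub>) (tens \<one>\<^bsub>H\<^esub> \<one>\<^bsub>H\<^esub>)" by simp
qed simp

sublocale connected_bialgebra H "all_mperms m" "\<lambda>w. card (set w)"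
proof (unfold_locales, rule FQSym_bialgebra)
  fix x y :: "nat list \<Rightarrow>\<^sub>0 'k" and p q n
  assume *: "x \<in> grade H p" "y \<in> grade H q"
  have "keys (lin_ext (fmult \<alpha>) y) \<subseteq> mperms m (p + q)" if "\<alpha> \<in> keys x" for \<alpha>
  proof (intro order_trans[OF keys_lin_ext] UN_least)
    fix \<beta> assume "\<beta> \<in> keys y"
    then show "keys (fmult \<alpha> \<beta> :: _ \<Rightarrow>\<^sub>0 'k) \<subseteq> mperms m (p + q)"
      using keys_fmult[of \<alpha> \<beta>] shifted_shuffle_mperms[OF m, of \<alpha> p \<beta> q] * that by fastforce
  qed
  then show "x \<otimes>\<^bsub>H\<^esub> y \<in> grade H (p + q)"
    by simp (rule order_trans[OF keys_lin_ext], rule UN_least)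
next
  fix x :: "nat list \<Rightarrow>\<^sub>0 'k" and n assume x: "x \<in> grade H n"
  then have xc: "keys x \<subseteq> all_mperms m" by (auto simp: all_mperms_def)
  have "keys (fcomult m \<alpha> :: _ \<Rightarrow>\<^sub>0 'k) \<subseteq> (\<Union>p\<le>n. grade H p \<times> grade H (n - p))" if "\<alpha> \<in> keys x" for \<alpha>
    unfolding fcomult_def
  proof (intro order_trans[OF Poly_Mapping.keys_sum] UN_least, clarify)
    fix u v and a b :: "nat list \<Rightarrow>\<^sub>0 'k" assume uv: "(u, v) \<in> cuts m \<alpha>" and ab: "(a, b) \<in> keys (tens (F (pack u)) (F (pack v)) :: _ \<Rightarrow>\<^sub>0 'k)"
    have \<alpha>: "\<alpha> \<in> mperms m n" using that x by auto
    then have bal: "balanced m \<alpha>" by (simp add: mperms_iff[OF m])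
    note b = cuts_balanced[OF bal uv]
    \<comment> \<open>The pieces share no letter, so their numbers of letters, which are the
      degrees, add up to n.\<close>
    have "set \<alpha> = set u \<union> set v" using uv by (auto simp: cuts_def)
    then have "n = card (set u) + card (set v)"
      using mperms_card[OF m \<alpha>] b(3) by (simp add: card_Un_disjoint)
    then show "(a, b) \<in> (\<Union>p\<le>n. grade H p \<times> grade H (n - p))"
      using ab pack_mperms[OF m b(1)] pack_mperms[OF m b(2)]
      by (intro UN_I[of "card (set u)"]) auto
  qed
  then show "\<exists>t. keys t \<subseteq> (\<Union>p\<le>n. grade H p \<times> grade H (n - p)) \<and> tensor_eq H (comult H x) t"
    by (intro exI[of _ "comult H x"] conjI tensor_eq_refl)
      (simp only: comult_FQSym[OF m xc], intro order_trans[OF keys_lin_ext] UN_least, simp)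
next
  show "\<one>\<^bsub>H\<^esub> \<in> grade H 0" by (simp add: mperms_0)
  show "x = pscale (counit H x) \<one>\<^bsub>H\<^esub>" if "x \<in> grade H 0" for x :: "nat list \<Rightarrow>\<^sub>0 'k"
  proof (rule poly_mapping_eqI)
    fix w
    have "w \<noteq> [] \<Longrightarrow> lookup x w = 0" using that by (auto simp: mperms_0 in_keys_iff)
    then show "lookup x w = lookup (pscale (counit H x) \<one>\<^bsub>H\<^esub>) w" by (simp add: lookup_single when_def)
  qed
  show "counit H x = 0" if "x \<in> grade H n" "n > 0" for x :: "nat list \<Rightarrow>\<^sub>0 'k" and n
    using that mperms_set[OF m, of "[]" n] by (auto simp: in_keys_iff)
qed

end

section \<open>Normal forms of the metasylvester congruence\<close>

inductive ms_step :: "nat list \<Rightarrow> nat list \<Rightarrow> bool"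
  where ms_step: "a < b \<Longrightarrow> a \<in> set v \<or> (\<exists>z\<in>set u \<inter> set v. a < z \<and> z < b) \<Longrightarrow>
    ms_step (u @ a # b # v) (u @ b # a # v)"

text \<open>Splitting u and v at the witnessing letters exhibits the rewritten factor as an instance
  of \<open>rule1\<close> or \<open>rule2\<close> in a larger context.\<close>

lemma ms_step_metasylv: "ms_step w w' \<Longrightarrow> w \<equiv>ms w'"
proof (induction rule: ms_step.induct)
  case (ms_step a b v u)
  from ms_step(2) show ?case
  proof
    assume "a \<in> set v"
    then obtain y v' where v: "v = y @ a # v'" by (auto dest: split_list)
    show ?thesis
      using metasylv.cong[OF metasylv.rule1[OF ms_step(1), of y], of u v'] by (simp add: v)
  next
    assume "\<exists>z\<in>set u \<inter> set v. a < z \<and> z < b"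
    then obtain z where z: "z \<in> set u" "z \<in> set v" "a < z" "z < b" by blast
    then obtain u1 u2 v1 v2 where uv: "u = u1 @ z # u2" "v = v1 @ z # v2" by (auto dest!: split_list)
    show ?thesis
      using metasylv.cong[OF metasylv.rule2[OF z(3,4), of u2 v1], of u1 v2] by (simp add: uv)
  qed
qed

lemma ms_step_context: "ms_step w w' \<Longrightarrow> ms_step (x @ w @ y) (x @ w' @ y)"
proof (induction rule: ms_step.induct)
  case (ms_step a b v u)
  have "ms_step ((x @ u) @ a # b # (v @ y)) ((x @ u) @ b # a # (v @ y))"
    using ms_step by (intro ms_step.intros) auto
  then show ?case by simp
qed

lemma equivclp_context: "equivclp ms_step w w' \<Longrightarrow> equivclp ms_step (x @ w @ y) (x @ w' @ y)"
proof (induction rule: equivclp_induct)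
  case (step v w')
  then have "ms_step (x @ v @ y) (x @ w' @ y) \<or> ms_step (x @ w' @ y) (x @ v @ y)"
    using ms_step_context by blast
  then show ?case using step.IH by (blast intro: equivclp_into_equivclp)
qed simp

lemma metasylv_equivclp: "u \<equiv>ms v \<longleftrightarrow> equivclp ms_step u v"
proof
  assume "u \<equiv>ms v"
  then show "equivclp ms_step u v"
  proof (induction rule: metasylv.induct)
    case (sym u v)
    show ?case using sym.IH by (rule equivclp_sym)
  next
    case (trans u v w)
    then show ?case by (metis equivclp_trans)
  next
    case (cong u v x y)
    then show ?case by (intro equivclp_context)
  next
    case (rule1 a b y)
    have "ms_step ([] @ a # b # (y @ [a])) ([] @ b # a # (y @ [a]))"
      using rule1 by (intro ms_step.intros) auto
    then show ?case by (auto intro: r_into_equivclp)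
  next
    case (rule2 a b c y z)
    have "ms_step ((b # y) @ a # c # (z @ [b])) ((b # y) @ c # a # (z @ [b]))"
      using rule2 by (intro ms_step.intros) auto
    then show ?case by (auto intro: r_into_equivclp)
  qed simp
next
  assume "equivclp ms_step u v"
  then show "u \<equiv>ms v"
    by (induction rule: equivclp_induct) (blast intro: metasylv.intros ms_step_metasylv)+
qed

text \<open>Counts the pairs of positions with the smaller letter on the left; swapping an adjacent
  ascent removes exactly one of them.\<close>

fun asc :: "nat list \<Rightarrow> nat"
  where "asc [] = 0" | "asc (x # xs) = length (filter (\<lambda>y. x < y) xs) + asc xs"

lemma ms_step_asc: "ms_step w w' \<Longrightarrow> asc w' < asc w"
proof (induction rule: ms_step.induct)
  case (ms_step a b v u)
  from ms_step(1) have "asc (u @ b # a # v) < asc (u @ a # b # v)"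
    by (induction u) auto
  then show ?case .
qed

text \<open>A factor a b c with a < b < c admits both reductions, and each continues in two further
  steps to c b a. The two witnesses remain available because they can be placed in u and v.\<close>

lemma ms_step_local_confluent_overlap:
  assumes "a < b" "a \<in> set (c # v) \<or> (\<exists>z\<in>set u \<inter> set (c # v). a < z \<and> z < b)"
    and "b < c" "b \<in> set v \<or> (\<exists>z\<in>set (u @ [a]) \<inter> set v. b < z \<and> z < c)"
  shows "\<exists>w. ms_step\<^sup>*\<^sup>* (u @ b # a # c # v) w \<and> ms_step\<^sup>*\<^sup>* (u @ a # c # b # v) w"
proof -
  \<comment> \<open>Letters of the overlap are ruled out as witnesses: c is not below b, and a is
    not above b.\<close>
  have 1: "a \<in> set v \<or> (\<exists>z\<in>set u \<inter> set v. a < z \<and> z < b)"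
    using assms by auto
  have 2: "b \<in> set v \<or> (\<exists>z\<in>set u \<inter> set v. b < z \<and> z < c)"
    using assms by auto
  have "ms_step ((u @ [b]) @ a # c # v) ((u @ [b]) @ c # a # v)"
    using 1 2 assms(1,3) by (intro ms_step.intros) auto
  moreover have "ms_step (u @ b # c # (a # v)) (u @ c # b # (a # v))"
    using 2 assms(3) by (intro ms_step.intros) auto
  moreover have "ms_step (u @ a # c # (b # v)) (u @ c # a # (b # v))"
    using 1 assms(1,3) by (intro ms_step.intros) auto
  moreover have "ms_step ((u @ [c]) @ a # b # v) ((u @ [c]) @ b # a # v)"
    using 1 assms(1) by (intro ms_step.intros) auto
  ultimately have "ms_step\<^sup>*\<^sup>* (u @ b # a # c # v) (u @ c # b # a # v)"
    "ms_step\<^sup>*\<^sup>* (u @ a # c # b # v) (u @ c # b # a # v)"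
    by (auto intro: rtranclp.rtrancl_into_rtrancl converse_rtranclp_into_rtranclp)
  then show ?thesis by blast
qed

text \<open>Disjoint steps commute: the condition of a step mentions only the sets of letters before
  and after it, and a swap elsewhere leaves these unchanged.\<close>

lemma ms_step_local_confluent_less:
  assumes w: "w = u @ a # b # v" "a < b" "a \<in> set v \<or> (\<exists>z\<in>set u \<inter> set v. a < z \<and> z < b)"
    and w': "w = u' @ a' # b' # v'" "a' < b'" "a' \<in> set v' \<or> (\<exists>z\<in>set u' \<inter> set v'. a' < z \<and> z < b')"
    and less: "length u < length u'"
  shows "\<exists>x. ms_step\<^sup>*\<^sup>* (u @ b # a # v) x \<and> ms_step\<^sup>*\<^sup>* (u' @ b' # a' # v') x"
proof -
  from w(1) w'(1) less obtain r where r: "u' = u @ r" "a # b # v = r @ a' # b' # v'" "r \<noteq> []"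
    by (auto simp: append_eq_append_conv2)
  show ?thesis
  \<comment> \<open>Length 1 means that the two factors share a letter; a longer \<open>r\<close>
    contains the whole left factor.\<close>
  proof (cases "length r = 1")
    case True
    then have "r = [a]" "b = a'" "v = b' # v'" using r(2) by (auto simp: length_Suc_conv)
    then show ?thesis
      using ms_step_local_confluent_overlap[of a b b' v' u] w w' r(1) by simp
  next
    case False
    then obtain t where t: "r = a # b # t" "v = t @ a' # b' # v'"
      using r(2,3) by (cases r; cases "tl r") auto
    have "ms_step ((u @ b # a # t) @ a' # b' # v') ((u @ b # a # t) @ b' # a' # v')"
      using w'(2,3) r(1) t by (intro ms_step.intros) auto
    moreover have "ms_step (u @ a # b # (t @ b' # a' # v')) (u @ b # a # (t @ b' # a' # v'))"
      using w(2,3) t by (intro ms_step.intros) auto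
    ultimately show ?thesis
      using r(1) t by (intro exI[of _ "u @ b # a # t @ b' # a' # v'"]) auto
  qed
qed

lemma ms_step_local_confluent:
  assumes "ms_step w w1" "ms_step w w2"
  shows "\<exists>x. ms_step\<^sup>*\<^sup>* w1 x \<and> ms_step\<^sup>*\<^sup>* w2 x"
proof -
  obtain u a b v where 1: "w = u @ a # b # v" "w1 = u @ b # a # v" "a < b"
      "a \<in> set v \<or> (\<exists>z\<in>set u \<inter> set v. a < z \<and> z < b)"
    using assms(1) by (cases rule: ms_step.cases) auto
  obtain u' a' b' v' where 2: "w = u' @ a' # b' # v'" "w2 = u' @ b' # a' # v'" "a' < b'"
      "a' \<in> set v' \<or> (\<exists>z\<in>set u' \<inter> set v'. a' < z \<and> z < b')"
    using assms(2) by (cases rule: ms_step.cases) auto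
  consider "length u < length u'" | "length u = length u'" | "length u' < length u" by linarith
  then show ?thesis
  proof cases
    case 1
    then show ?thesis using ms_step_local_confluent_less \<open>w1 = _\<close> \<open>w2 = _\<close> 2 \<open>w = u @ _\<close> \<open>a < b\<close> \<open>a \<in> _ \<or> _\<close>
      by metis
  next
    case 2
    then have "w1 = w2" using \<open>w1 = _\<close> \<open>w2 = _\<close> \<open>w = u @ _\<close> \<open>w = u' @ _\<close> by auto
    then show ?thesis by blast
  next
    case 3
    then show ?thesis using ms_step_local_confluent_less \<open>w1 = _\<close> \<open>w2 = _\<close> 2 \<open>w = u @ _\<close> \<open>a < b\<close> \<open>a \<in> _ \<or> _\<close>
      by metis
  qed
qed

text \<open>Newman's lemma: \<^const>\<open>asc\<close> makes the rewriting terminating.\<close>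

lemma ms_step_confluent: "ms_step\<^sup>*\<^sup>* w x \<Longrightarrow> ms_step\<^sup>*\<^sup>* w y \<Longrightarrow> \<exists>z. ms_step\<^sup>*\<^sup>* x z \<and> ms_step\<^sup>*\<^sup>* y z"
proof (induction "asc w" arbitrary: w x y rule: less_induct)
  case less
  show ?case
  proof (cases "w = x \<or> w = y")
    case True
    then show ?thesis using less.prems by blast
  next
    case False
    then obtain w1 w2 where 1: "ms_step w w1" "ms_step\<^sup>*\<^sup>* w1 x" and 2: "ms_step w w2" "ms_step\<^sup>*\<^sup>* w2 y"
      using less.prems by (metis converse_rtranclpE)
    obtain v where v: "ms_step\<^sup>*\<^sup>* w1 v" "ms_step\<^sup>*\<^sup>* w2 v"
      using ms_step_local_confluent[OF 1(1) 2(1)] by blast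
    obtain z1 where z1: "ms_step\<^sup>*\<^sup>* x z1" "ms_step\<^sup>*\<^sup>* v z1"
      using less.hyps[OF ms_step_asc[OF 1(1)] 1(2) v(1)] by blast
    obtain z where "ms_step\<^sup>*\<^sup>* y z" "ms_step\<^sup>*\<^sup>* z1 z"
      using less.hyps[OF ms_step_asc[OF 2(1)] 2(2) rtranclp_trans[OF v(2) z1(2)]] by blast
    then show ?thesis using z1(1) by (meson rtranclp_trans)
  qed
qed

text \<open>Along a zigzag of steps a common reduct survives a forward step by confluence and a
  backward step by prolonging the reduction.\<close>

lemma metasylv_joinable: "u \<equiv>ms v \<Longrightarrow> \<exists>z. ms_step\<^sup>*\<^sup>* u z \<and> ms_step\<^sup>*\<^sup>* v z"
  unfolding metasylv_equivclp
proof (induction rule: equivclp_induct)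
  case base
  then show ?case by blast
next
  case (step v w)
  then obtain z where z: "ms_step\<^sup>*\<^sup>* u z" "ms_step\<^sup>*\<^sup>* v z" by blast
  from step(2) show ?case
  proof
    assume "ms_step v w"
    then obtain x where "ms_step\<^sup>*\<^sup>* z x" "ms_step\<^sup>*\<^sup>* w x"
      using ms_step_confluent[OF z(2)] by blast
    then show ?thesis using z(1) by (meson rtranclp_trans)
  next
    assume "ms_step w v"
    then show ?thesis using z by (meson converse_rtranclp_into_rtranclp)
  qed
qed

section \<open>Irreducible words and pattern avoidance\<close>

definition avoids :: "nat list \<Rightarrow> bool"
  where "avoids w \<longleftrightarrow> (\<forall>x a y b z. w = x @ a # y @ b # z \<longrightarrow> a < b \<longrightarrow> a \<notin> set z)"

lemma avoids_normal: "avoids w \<Longrightarrow> \<not> ms_step w w'"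
proof
  assume w: "avoids w" and "ms_step w w'"
  from this(2) show False
  proof (cases rule: ms_step.cases)
    case (ms_step a b v u)
    then have "a \<notin> set v" using w[unfolded avoids_def, rule_format, of u a "[]" b v] by simp
    \<comment> \<open>The condition with a letter z between a and b still yields a pattern, namely
      z, b, z.\<close>
    then obtain z where z: "z \<in> set u" "z \<in> set v" "z < b" using ms_step by blast
    then obtain u1 u2 where "u = u1 @ z # u2" by (auto dest: split_list)
    then show False using w[unfolded avoids_def, rule_format, of u1 z "u2 @ [a]" b v] ms_step z by simp
  qed
qed

text \<open>Induction on the gap y, whose last letter is c. If c > a, the pair a, c has a smaller
  gap; if c = a, it is adjacent to b; if c < a, the factor c b can be swapped, with a as the
  intermediate letter on both sides.\<close>

lemma ex_step:
  assumes "w = x @ a # y @ b # z" "a < b" "a \<in> set z"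
  shows "\<exists>w'. ms_step w w'"
  using assms
proof (induction "length y" arbitrary: x a y b z rule: less_induct)
  case less
  show ?case
  proof (cases y rule: rev_cases)
    case Nil
    then show ?thesis using less.prems ms_step.intros[of a b z x] by auto
  next
    case (snoc y' c)
    consider "a < c" | "c = a" | "c < a" by linarith
    then show ?thesis
    proof cases
      case 1
      show ?thesis
        by (rule less.hyps[of y' x a c "b # z"]) (use less.prems snoc 1 in auto)
    next
      case 2
      show ?thesis
        by (rule less.hyps[of "[]" "x @ a # y'" a b z]) (use less.prems snoc 2 in auto)
    next
      case 3
      have "ms_step ((x @ a # y') @ c # b # z) ((x @ a # y') @ b # c # z)"
        using 3 less.prems by (intro ms_step.intros) auto
      then show ?thesis using less.prems snoc by auto
    qed
  qed
qed

lemma normal_avoids: "(\<And>w'. \<not> ms_step w w') \<Longrightarrow> avoids w"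
  using ex_step unfolding avoids_def by blast

lemma ex_normal_form: "\<exists>v. w \<equiv>ms v \<and> avoids v"
proof (induction "asc w" arbitrary: w rule: less_induct)
  case less
  show ?case
  proof (cases "\<exists>w'. ms_step w w'")
    case True
    then obtain w' where w': "ms_step w w'" by blast
    then obtain v where "w' \<equiv>ms v" "avoids v" using less ms_step_asc by blast
    then show ?thesis using metasylv.trans[OF ms_step_metasylv[OF w']] by blast
  next
    case False
    then show ?thesis using normal_avoids metasylv.refl by blast
  qed
qed

lemma normal_form_unique: "u \<equiv>ms v \<Longrightarrow> avoids u \<Longrightarrow> avoids v \<Longrightarrow> u = v"
  using metasylv_joinable avoids_normal by (metis converse_rtranclpE)

section \<open>Invariance properties of the congruence\<close>

lemma metasylv_count: "u \<equiv>ms v \<Longrightarrow> count_list u a = count_list v a"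
  by (induction rule: metasylv.induct) auto

lemma metasylv_set: "u \<equiv>ms v \<Longrightarrow> set u = set v"
  by (induction rule: metasylv.induct) auto

lemma metasylv_length: "u \<equiv>ms v \<Longrightarrow> length u = length v"
  by (induction rule: metasylv.induct) auto

lemma metasylv_mperms: "u \<equiv>ms v \<Longrightarrow> u \<in> mperms m n \<longleftrightarrow> v \<in> mperms m n"
  by (simp add: mperms_def metasylv_count metasylv_set)

lemma metasylv_all_mperms: "u \<equiv>ms v \<Longrightarrow> u \<in> all_mperms m \<longleftrightarrow> v \<in> all_mperms m"
  by (simp add: all_mperms_def metasylv_mperms)

lemma metasylv_mword: "u \<equiv>ms v \<Longrightarrow> mword m u \<longleftrightarrow> mword m v"
  by (simp add: mword_def metasylv_count)

lemma finite_class: "finite {\<alpha>. \<alpha> \<equiv>ms \<tau>}"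
proof -
  have "{\<alpha>. \<alpha> \<equiv>ms \<tau>} \<subseteq> {\<alpha>. set \<alpha> \<subseteq> set \<tau> \<and> length \<alpha> = length \<tau>}"
    using metasylv_set metasylv_length by blast
  then show ?thesis using finite_lists_length_eq[of "set \<tau>" "length \<tau>"] finite_subset by auto
qed

text \<open>The danger is in \<open>rule2\<close>: keeping a and c but losing the witness b would
  destroy the relation. Convexity of \<open>Q\<close> excludes this; whenever one of the swapped
  letters is dropped, both sides coincide.\<close>

lemma metasylv_filter:
  assumes "u \<equiv>ms v" and convex: "\<And>a b c. a < b \<Longrightarrow> b < c \<Longrightarrow> Q a \<Longrightarrow> Q c \<Longrightarrow> Q b"
  shows "filter Q u \<equiv>ms filter Q v"
  using assms(1)
proof (induction rule: metasylv.induct)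
  case (refl u)
  show ?case by (rule metasylv.refl)
next
  case (sym u v)
  then show ?case by (blast intro: metasylv.sym)
next
  case (trans u v w)
  then show ?case by (blast intro: metasylv.trans)
next
  case (cong u v x y)
  then show ?case by (simp add: metasylv.cong)
next
  case (rule1 a b y)
  then show ?case
    using metasylv.rule1[OF rule1, of "filter Q y"] by (auto intro: metasylv.refl)
next
  case (rule2 a b c y z)
  then show ?case
    using metasylv.rule2[OF rule2, of "filter Q y" "filter Q z"] convex[OF rule2]
    by (auto intro: metasylv.refl)
qed

lemma metasylv_map:
  assumes "u \<equiv>ms v" "strict_mono_on (set u) r"
  shows "map r u \<equiv>ms map r v"
  using assms
proof (induction rule: metasylv.induct)
  case (refl u)
  show ?case by (rule metasylv.refl)
next
  case (sym u v)
  then show ?case using metasylv_set[OF sym(1)] by (auto intro: metasylv.sym)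
next
  case (trans u v w)
  then show ?case using metasylv_set[OF trans(1)] by (auto intro: metasylv.trans)
next
  case (cong u v x y)
  then have "strict_mono_on (set u) r" by (auto simp: monotone_on_def)
  then show ?case using cong.IH by (simp add: metasylv.cong)
next
  case (rule1 a b y)
  then have "r a < r b" by (auto simp: monotone_on_def)
  from metasylv.rule1[OF this, of "map r y"] show ?case by simp
next
  case (rule2 a b c y z)
  then have "r a < r b" "r b < r c" by (auto simp: monotone_on_def)
  from metasylv.rule2[OF this, of "map r y" "map r z"] show ?case by simp
qed

lemma metasylv_append: "u \<equiv>ms u' \<Longrightarrow> v \<equiv>ms v' \<Longrightarrow> u @ v \<equiv>ms u' @ v'"
  using metasylv.cong[of u u' "[]" v] metasylv.cong[of v v' u' "[]"] metasylv.trans by auto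

lemma metasylv_low: "u \<equiv>ms v \<Longrightarrow> low n u \<equiv>ms low n v"
  by (rule metasylv_filter) auto

lemma metasylv_high: "u \<equiv>ms v \<Longrightarrow> high n u \<equiv>ms high n v"
proof -
  assume "u \<equiv>ms v"
  then have "filter (\<lambda>x. n < x) u \<equiv>ms filter (\<lambda>x. n < x) v" by (rule metasylv_filter) auto
  then show "high n u \<equiv>ms high n v" by (rule metasylv_map) (auto simp: monotone_on_def)
qed

section \<open>Decreasing trees\<close>

lemma avoids_map:
  assumes r: "strict_mono_on (set w) r"
  shows "avoids (map r w) \<longleftrightarrow> avoids w"
proof
  assume m: "avoids (map r w)"
  show "avoids w"
    unfolding avoids_def
  proof (intro allI impI)
    fix x a y b z assume w: "w = x @ a # y @ b # z" "a < b"
    then have "map r w = map r x @ r a # map r y @ r b # map r z" "r a < r b"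
      using r by (auto simp: monotone_on_def)
    then have "r a \<notin> set (map r z)" using m unfolding avoids_def by blast
    then show "a \<notin> set z" by auto
  qed
next
  assume m: "avoids w"
  show "avoids (map r w)"
    unfolding avoids_def
  proof (intro allI impI notI)
    fix x a y b z assume w: "map r w = x @ a # y @ b # z" "a < b" "a \<in> set z"
    then obtain x' a' y' b' z' where w': "w = x' @ a' # y' @ b' # z'" "a = r a'" "b = r b'" "z = map r z'"
      by (auto simp: map_eq_append_conv map_eq_Cons_conv Cons_eq_map_conv append_eq_map_conv)
    obtain c where c: "c \<in> set z'" "r c = r a'" using w w' by auto
    have "c = a'" using c w'(1) strict_mono_on_eq[OF r, of c a'] by auto
    moreover have "a' < b'" using w(2) w'(1-3) strict_mono_on_less[OF r, of a' b'] by auto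
    ultimately show False using m w'(1) c(1) unfolding avoids_def by blast
  qed
qed

lemma avoids_pack: "avoids (pack w) \<longleftrightarrow> avoids w"
  unfolding pack_eq_map_rank by (rule avoids_map) (simp add: strict_mono_rank)

lemma avoids_factor: "avoids (p @ u @ q) \<Longrightarrow> avoids u"
  unfolding avoids_def
proof (intro allI impI)
  fix x a y b z
  assume *: "\<forall>x a y b z. p @ u @ q = x @ a # y @ b # z \<longrightarrow> a < b \<longrightarrow> a \<notin> set z"
    and "u = x @ a # y @ b # z" "a < b"
  then show "a \<notin> set z" using *[rule_format, of "p @ x" a y b "z @ q"] by simp
qed

section \<open>Factorization at the largest letter\<close>

abbreviation tree_join :: "nat \<Rightarrow> nat list list \<Rightarrow> nat list"
  where "tree_join n us \<equiv> hd us @ concat (map (\<lambda>u. n # u) (tl us))"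

text \<open>The letter n at both borders of the factor is recorded because it turns a repetition
  across a border into a forbidden pattern.\<close>

lemma join_factor:
  "u \<in> set us \<Longrightarrow> \<exists>p q. tree_join n us = p @ u @ q \<and> (p = [] \<or> last p = n) \<and> (q = [] \<or> hd q = n)"
proof (induction us)
  case (Cons v vs)
  show ?case
  proof (cases "u = v")
    case True
    then show ?thesis
      by (intro exI[of _ "[]"] exI[of _ "concat (map (\<lambda>u. n # u) vs)"]) (cases vs; simp)
  next
    case False
    then have u: "u \<in> set vs" using Cons.prems by simp
    then obtain p q where pq: "tree_join n vs = p @ u @ q" "p = [] \<or> last p = n" "q = [] \<or> hd q = n"
      using Cons.IH by blast
    have "tree_join n (v # vs) = v @ n # tree_join n vs" using u by (cases vs) auto
    then show ?thesis
      using pq by (intro exI[of _ "v @ n # p"] exI[of _ q]) auto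
  qed
qed simp

lemma ex_join: "\<exists>us. length us = Suc (count_list w n) \<and> w = tree_join n us \<and> (\<forall>u\<in>set us. n \<notin> set u)"
proof (induction w)
  case Nil
  then show ?case by (intro exI[of _ "[[]]"]) simp
next
  case (Cons a w)
  then obtain us where us: "length us = Suc (count_list w n)" "w = tree_join n us" "\<forall>u\<in>set us. n \<notin> set u" by blast
  then obtain v vs where v: "us = v # vs" by (cases us) auto
  show ?case
  proof (cases "a = n")
    case True
    then show ?thesis using us v by (intro exI[of _ "[] # us"]) auto
  next
    case False
    then show ?thesis using us v by (intro exI[of _ "(a # v) # vs"]) auto
  qed
qed

text \<open>Neither of the two displayed occurrences of a can fall into p or q, so the stretch they
  enclose lies inside u.\<close>

lemma factor_between:
  assumes "p @ u @ q = x @ a # s @ a # t" "a \<notin> set p" "a \<notin> set q"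
  shows "\<exists>x' t'. u = x' @ a # s @ a # t'"
proof -
  obtain x' where x: "u @ q = x' @ a # s @ a # t"
  proof -
    from assms(1) consider r where "p = x @ r" "r @ u @ q = a # s @ a # t"
      | r where "x = p @ r" "u @ q = r @ a # s @ a # t"
      by (auto simp: append_eq_append_conv2)
    then show ?thesis
    proof cases
      case 1
      then have "r = []" using assms(2) by (cases r) auto
      then show ?thesis using 1 that[of "[]"] by simp
    qed (rule that)
  qed
  define c where "c = x' @ a # s @ [a]"
  from x have "u @ q = c @ t" by (simp add: c_def)
  then consider r where "u = c @ r" | r where "c = u @ r" "q = r @ t"
    by (auto simp: append_eq_append_conv2)
  then show ?thesis
  proof cases
    case 1
    then show ?thesis by (auto simp: c_def)
  next
    case 2
    have "r = []"
    proof (cases r rule: rev_cases)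
      case (snoc r' b)
      then have "b = a" using 2(1) by (simp add: c_def flip: append_assoc append_Cons)
      then show ?thesis using snoc 2(2) assms(3) by simp
    qed
    then show ?thesis using 2(1) by (intro exI[of _ x'] exI[of _ "[]"]) (simp add: c_def)
  qed
qed

text \<open>In a pattern a, b, a the letter a is less than n, so it occurs in some subtree. That
  subtree contains all m copies of a, hence the whole pattern.\<close>

lemma dec_tree_avoids:
  assumes m: "m \<ge> 1"
  shows "dec_tree m \<tau> \<Longrightarrow> \<tau> \<in> all_mperms m \<and> avoids \<tau>"
proof (induction rule: dec_tree.induct)
  case Nil
  then show ?case by (simp add: Nil_all_mperms avoids_def)
next
  case (node us n)
  let ?w = "tree_join n us"
  have w: "?w \<in> mperms m n" by (rule node)
  have sub: "pack u \<in> all_mperms m" "avoids u" if "u \<in> set us" for u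
    using node that avoids_pack by auto
  have "avoids ?w"
    unfolding avoids_def
  proof (intro allI impI notI)
    fix x a y b z assume e: "?w = x @ a # y @ b # z" "a < b" "a \<in> set z"
    have "a \<in> set ?w" "b \<in> set ?w" unfolding e(1) by simp_all
    then have "b \<le> n" unfolding mperms_set[OF m w] by simp
    then have an: "a \<noteq> n" using e(2) by simp
    have "us \<noteq> []" using node(2) by auto
    then obtain u where u: "u \<in> set us" "a \<in> set u"
      using \<open>a \<in> set ?w\<close> an by (cases us) (auto split: if_splits)
    obtain p q where pq: "?w = p @ u @ q" using join_factor[OF u(1)] by blast
    \<comment> \<open>Packing keeps multiplicities, so u already has m copies of a and none is left
      for the rest of the word.\<close>
    have "count_list u a = m"
    proof -
      have "balanced m (pack u)" using sub(1)[OF u(1)] m by (rule all_mperms_balanced[rotated])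
      then have "balanced m u" by (simp add: pack_eq_map_rank balanced_map inj_on_rank)
      then show ?thesis using u(2) by (simp add: balanced_def)
    qed
    moreover have "count_list ?w a = m" using w \<open>a \<in> set ?w\<close> by (auto simp: mperms_def)
    ultimately have "count_list p a = 0" "count_list q a = 0" unfolding pq by simp_all
    then have apq: "a \<notin> set p" "a \<notin> set q" by (simp_all add: count_list_0_iff)
    obtain z1 z2 where z: "z = z1 @ a # z2" using e(3) by (auto dest: split_list)
    have "p @ u @ q = x @ a # (y @ b # z1) @ a # z2" using e(1) pq z by simp
    from factor_between[OF this apq] obtain x' t' where "u = x' @ a # y @ b # (z1 @ a # t')" by auto
    then show False using sub(2)[OF u(1)] e(2) unfolding avoids_def by fastforce
  qed
  then show ?case using w by (auto simp: all_mperms_def)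
qed

text \<open>Avoidance makes the factors between occurrences of n disjoint in letters, so each has m
  copies of its letters and packs to a smaller m-permutation that avoids the pattern.\<close>

lemma avoids_dec_tree:
  assumes m: "m \<ge> 1"
  shows "w \<in> mperms m n \<Longrightarrow> avoids w \<Longrightarrow> dec_tree m w"
proof (induction n arbitrary: w rule: less_induct)
  case (less n)
  show ?case
  proof (cases "n = 0")
    case True
    then show ?thesis using less.prems by (simp add: mperms_0 dec_tree.Nil)
  next
    case False
    then have cnt: "count_list w n = m" using less.prems by (simp add: mperms_def)
    obtain us where us: "length us = Suc m" "w = tree_join n us" "\<forall>u\<in>set us. n \<notin> set u"
      using ex_join[of w n] cnt by auto
    have "dec_tree m (pack u)" if u: "u \<in> set us" for u
    proof -
      obtain p q where pq: "w = p @ u @ q" "p = [] \<or> last p = n" "q = [] \<or> hd q = n"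
        using join_factor[OF u, of n] us(2) by blast
      have wset: "set w = {1..n}" by (rule mperms_set[OF m less.prems(1)])
      have nu: "n \<notin> set u" using us(3) u by blast
      have "set u \<subseteq> set w" using pq(1) by auto
      then have lt: "a < n" if "a \<in> set u" for a
        using that nu unfolding wset by (metis atLeastAtMost_iff nless_le subsetD)
      have "balanced m u"
        unfolding balanced_def
      proof
        fix a assume a: "a \<in> set u"
        \<comment> \<open>A copy of a on the other side of a border would be separated from u by an
          n, giving the pattern a, n, a.\<close>
        have "a \<notin> set p"
        proof
          assume ap: "a \<in> set p"
          then obtain p' where p': "p = p' @ [n]" using pq(2) by (cases p rule: rev_cases) auto
          then have "a \<in> set p'" using ap lt[OF a] by auto
          then obtain x y where "p' = x @ a # y" by (auto dest: split_list)
          then have "w = x @ a # y @ n # (u @ q)" using pq(1) p' by simp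
          then show False using less.prems(2) lt[OF a] a unfolding avoids_def by fastforce
        qed
        moreover have "a \<notin> set q"
        proof
          assume aq: "a \<in> set q"
          then obtain q' where q': "q = n # q'" using pq(3) by (cases q) auto
          then have "a \<in> set q'" using aq lt[OF a] by auto
          obtain x y where "u = x @ a # y" using a by (auto dest: split_list)
          then have "w = (p @ x) @ a # y @ n # q'" using pq(1) q' by simp
          then show False using less.prems(2) lt[OF a] \<open>a \<in> set q'\<close> unfolding avoids_def by blast
        qed
        ultimately have "count_list u a = count_list w a" using pq(1) by simp
        also have "\<dots> = m"
          using less.prems(1) a \<open>set u \<subseteq> set w\<close> wset by (auto simp: mperms_def)
        finally show "count_list u a = m" .
      qed
      then have pm: "pack u \<in> mperms m (card (set u))" by (rule pack_mperms[OF m])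
      have "set u \<subseteq> {1..<n}" using lt \<open>set u \<subseteq> set w\<close> wset by auto
      then have "card (set u) \<le> card {1..<n}" by (intro card_mono) auto
      then have "card (set u) < n" using False by simp
      moreover have "avoids (pack u)"
        using less.prems(2) pq(1) by (simp add: avoids_pack avoids_factor)
      ultimately show ?thesis using less.IH pm by blast
    qed
    then show ?thesis
      using dec_tree.node[of us n m] us less.prems(1) by simp
  qed
qed

lemma dec_tree_iff: "m \<ge> 1 \<Longrightarrow> dec_tree m \<tau> \<longleftrightarrow> \<tau> \<in> all_mperms m \<and> avoids \<tau>"
  using dec_tree_avoids avoids_dec_tree by (auto simp: all_mperms_def)

lemma dec_tree_unique:
  "m \<ge> 1 \<Longrightarrow> dec_tree m \<sigma> \<Longrightarrow> dec_tree m \<tau> \<Longrightarrow> \<sigma> \<equiv>ms \<tau> \<Longrightarrow> \<sigma> = \<tau>"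
  by (simp add: dec_tree_iff normal_form_unique)

lemma ex_dec_tree:
  assumes "m \<ge> 1" "\<alpha> \<in> all_mperms m"
  shows "\<exists>\<tau>. dec_tree m \<tau> \<and> \<alpha> \<equiv>ms \<tau>"
  using ex_normal_form[of \<alpha>] assms by (auto simp: dec_tree_iff metasylv_all_mperms)

section \<open>The metasylvester subalgebra and its dual\<close>

lemma lookup_P: "lookup (P \<tau> :: _ \<Rightarrow>\<^sub>0 'k::field_char_0) \<alpha> = (if \<alpha> \<equiv>ms \<tau> then 1 else 0)"
  by (simp add: P_def lookup_sum lookup_single when_def finite_class)

lemma lsum_P: "lsum f (P \<tau>) = (\<Sum>\<alpha>\<in>{\<alpha>. \<alpha> \<equiv>ms \<tau>}. f \<alpha>)"
  by (simp add: P_def lsum_sum)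

text \<open>Inverse of packing for a prescribed set of letters.\<close>

definition relabel :: "nat set \<Rightarrow> nat list \<Rightarrow> nat list"
  where "relabel A w = map (the_inv_into A (rank A)) w"

lemma relabel_pack: "relabel (set u) (pack u) = u"
  unfolding relabel_def pack_eq_map_rank
  by (simp add: o_def) (rule map_idI, simp add: the_inv_into_f_f inj_on_rank)

lemma strict_mono_unrank:
  assumes "finite A"
  shows "strict_mono_on {1..card A} (the_inv_into A (rank A))"
proof (rule strict_mono_onI)
  fix r s assume "r \<in> {1..card A}" "s \<in> {1..card A}" "r < s"
  then obtain a b where ab: "a \<in> A" "b \<in> A" "r = rank A a" "s = rank A b"
    using rank_image[OF assms] by (metis imageE)
  then have "a < b"
    using \<open>r < s\<close> strict_mono_on_less[OF strict_mono_rank[OF assms], of a b] by simp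
  then show "the_inv_into A (rank A) r < the_inv_into A (rank A) s"
    using ab by (simp add: the_inv_into_f_f inj_on_rank assms)
qed

text \<open>Lifts a congruence between packed words to the original letters: each word congruent to
  the packing of u comes from a word congruent to u.\<close>

lemma relabel_metasylv:
  assumes "pack u \<equiv>ms w"
  shows "relabel (set u) w \<equiv>ms u" "pack (relabel (set u) w) = w"
proof -
  have s: "set w = {1..card (set u)}" using metasylv_set[OF assms] by (simp add: set_pack)
  have mono: "strict_mono_on (set w) (the_inv_into (set u) (rank (set u)))"
    unfolding s by (rule strict_mono_unrank) simp
  have "relabel (set u) w \<equiv>ms relabel (set u) (pack u)"
    unfolding relabel_def by (rule metasylv_map[OF metasylv.sym[OF assms] mono])
  then show "relabel (set u) w \<equiv>ms u" by (simp add: relabel_pack)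
  show "pack (relabel (set u) w) = w"
    unfolding relabel_def pack_map[OF mono] by (rule pack_id[OF s])
qed

section \<open>The projection onto the span of the tree sums\<close>

context m_permutations
begin

definition nf :: "nat list \<Rightarrow> nat list"
  where "nf \<alpha> = (SOME \<tau>. dec_tree m \<tau> \<and> \<alpha> \<equiv>ms \<tau>)"

lemma nf: "\<alpha> \<in> all_mperms m \<Longrightarrow> dec_tree m (nf \<alpha>)" "\<alpha> \<in> all_mperms m \<Longrightarrow> \<alpha> \<equiv>ms nf \<alpha>"
  using someI_ex[OF ex_dec_tree[OF m, of \<alpha>]] by (auto simp: nf_def)

lemma nf_eq_iff: "\<alpha> \<in> all_mperms m \<Longrightarrow> dec_tree m \<tau> \<and> \<alpha> \<equiv>ms \<tau> \<longleftrightarrow> \<tau> = nf \<alpha>"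
  using nf[of \<alpha>] dec_tree_unique[OF m, of \<tau> "nf \<alpha>"] by (metis metasylv.sym metasylv.trans)

lemma dec_tree_all_mperms: "dec_tree m \<tau> \<Longrightarrow> \<tau> \<in> all_mperms m"
  using dec_tree_iff[OF m] by blast

definition tree_pr :: "(nat list \<Rightarrow>\<^sub>0 'k) \<Rightarrow> (nat list \<Rightarrow>\<^sub>0 'k)"
  where "tree_pr = lin_ext (\<lambda>\<tau>. if dec_tree m \<tau> then P \<tau> else 0)"

text \<open>A class contains one tree, so only the coefficient of x at \<open>nf \<alpha>\<close>
  reaches \<alpha>.\<close>

lemma lookup_tree_pr: "lookup (tree_pr x) \<alpha> = (if \<alpha> \<in> all_mperms m then lookup x (nf \<alpha>) else 0)"
proof -
  have "lookup (tree_pr x) \<alpha> = lsum (\<lambda>\<tau>. if dec_tree m \<tau> \<and> \<alpha> \<equiv>ms \<tau> then 1 else 0) x"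
    unfolding tree_pr_def lookup_lin_ext by (intro lsum_cong) (simp add: lookup_P)
  also have "\<dots> = (if \<alpha> \<in> all_mperms m then lookup x (nf \<alpha>) else 0)"
  proof (cases "\<alpha> \<in> all_mperms m")
    case True
    have "lsum (\<lambda>\<tau>. if dec_tree m \<tau> \<and> \<alpha> \<equiv>ms \<tau> then 1 else 0) x = lsum (\<lambda>\<tau>. lookup (single \<tau> 1) (nf \<alpha>)) x"
      unfolding nf_eq_iff[OF True] by (intro lsum_cong) (simp add: lookup_single when_def)
    then show ?thesis using True by (simp add: lsum_lookup_single)
  next
    case False
    then have n: "(dec_tree m \<tau> \<and> \<alpha> \<equiv>ms \<tau>) = False" for \<tau>
      using dec_tree_all_mperms metasylv_all_mperms by blast
    show ?thesis unfolding n using False by simp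
  qed
  finally show ?thesis .
qed

lemma tree_pr_DT: "tree_pr x \<in> DT m"
  unfolding tree_pr_def DT_def
  by (rule lin_ext_mem_subspace[OF free.subspace_span]) (auto intro: free.span_base free.span_zero)

lemma DT_iff:
  "x \<in> DT m \<longleftrightarrow> keys x \<subseteq> all_mperms m \<and> (\<forall>\<alpha> \<beta>. \<alpha> \<equiv>ms \<beta> \<longrightarrow> lookup x \<alpha> = lookup x \<beta>)"
  for x :: "nat list \<Rightarrow>\<^sub>0 'k"
proof
  let ?S = "{x :: nat list \<Rightarrow>\<^sub>0 'k. keys x \<subseteq> all_mperms m} \<inter>
    {x. \<forall>\<alpha> \<beta>. \<alpha> \<equiv>ms \<beta> \<longrightarrow> lookup x \<alpha> = lookup x \<beta>}"
  have "free.subspace ?S"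
  proof (rule free.subspace_inter[OF subspace_keys])
    show "free.subspace {x :: nat list \<Rightarrow>\<^sub>0 'k. \<forall>\<alpha> \<beta>. \<alpha> \<equiv>ms \<beta> \<longrightarrow> lookup x \<alpha> = lookup x \<beta>}"
      unfolding free.subspace_def by (auto simp: lookup_add)
  qed
  moreover have "P ` {\<tau>. dec_tree m \<tau>} \<subseteq> ?S"
  proof (clarify, intro IntI CollectI allI impI subsetI)
    fix \<tau> assume \<tau>: "dec_tree m \<tau>"
    show "\<alpha> \<in> all_mperms m" if "\<alpha> \<in> keys (P \<tau> :: nat list \<Rightarrow>\<^sub>0 'k)" for \<alpha>
      using that \<tau> dec_tree_all_mperms metasylv_all_mperms
      by (auto simp: in_keys_iff lookup_P split: if_splits)
    show "lookup (P \<tau> :: nat list \<Rightarrow>\<^sub>0 'k) \<alpha> = lookup (P \<tau>) \<beta>" if "\<alpha> \<equiv>ms \<beta>" for \<alpha> \<beta>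
    proof -
      have "\<alpha> \<equiv>ms \<tau> \<longleftrightarrow> \<beta> \<equiv>ms \<tau>" using that by (blast intro: metasylv.trans metasylv.sym)
      then show ?thesis by (simp add: lookup_P)
    qed
  qed
  ultimately have "DT m \<subseteq> ?S" unfolding DT_def by (rule free.span_minimal[rotated])
  then show "x \<in> DT m \<Longrightarrow> keys x \<subseteq> all_mperms m \<and> (\<forall>\<alpha> \<beta>. \<alpha> \<equiv>ms \<beta> \<longrightarrow> lookup x \<alpha> = lookup x \<beta>)"
    by auto
next
  assume x: "keys x \<subseteq> all_mperms m \<and> (\<forall>\<alpha> \<beta>. \<alpha> \<equiv>ms \<beta> \<longrightarrow> lookup x \<alpha> = lookup x \<beta>)"
  \<comment> \<open>A vector constant on classes is determined by its coefficients at trees, so it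
    is its own projection and lies in the span.\<close>
  have "tree_pr x = x"
  proof (rule poly_mapping_eqI)
    fix \<alpha>
    show "lookup (tree_pr x) \<alpha> = lookup x \<alpha>"
    proof (cases "\<alpha> \<in> all_mperms m")
      case True
      then have "lookup x \<alpha> = lookup x (nf \<alpha>)" using x nf(2) by blast
      then show ?thesis using True by (simp add: lookup_tree_pr)
    next
      case False
      then have "\<alpha> \<notin> keys x" using x by blast
      then show ?thesis using False by (simp add: lookup_tree_pr in_keys_iff)
    qed
  qed
  then show "x \<in> DT m" using tree_pr_DT[of x] by simp
qed

lemma DT_class: "x \<in> DT m \<Longrightarrow> \<alpha> \<equiv>ms \<beta> \<Longrightarrow> lookup x \<alpha> = lookup x \<beta>" for x :: "nat list \<Rightarrow>\<^sub>0 'k"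
  by (simp add: DT_iff)

lemma DT_keys: "x \<in> DT m \<Longrightarrow> keys x \<subseteq> all_mperms m" for x :: "nat list \<Rightarrow>\<^sub>0 'k"
  by (simp add: DT_iff)

lemma tree_pr_id: "x \<in> DT m \<Longrightarrow> tree_pr x = x"
proof (rule poly_mapping_eqI)
  fix \<alpha> assume x: "x \<in> DT m"
  show "lookup (tree_pr x) \<alpha> = lookup x \<alpha>"
    using DT_class[OF x nf(2), of \<alpha>] DT_keys[OF x] by (auto simp: lookup_tree_pr in_keys_iff)
qed

section \<open>Closure under product and coproduct\<close>

lemma P_DT: "dec_tree m \<tau> \<Longrightarrow> (P \<tau> :: _ \<Rightarrow>\<^sub>0 'k) \<in> DT m"
  unfolding DT_def by (intro free.span_base) auto

text \<open>A word \<gamma> can be a shuffle only of its low part with its high part. The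
  coefficient at \<gamma> is therefore 1 or 0 according to the classes of these two parts, which
  depend only on the class of \<gamma>.\<close>

lemma P_mult_DT:
  assumes \<tau>: "dec_tree m \<tau>" and \<sigma>: "dec_tree m \<sigma>"
  shows "(P \<tau> :: _ \<Rightarrow>\<^sub>0 'k) \<otimes>\<^bsub>H\<^esub> P \<sigma> \<in> DT m"
proof -
  obtain n k where n: "\<tau> \<in> mperms m n" "\<sigma> \<in> mperms m k"
    using dec_tree_all_mperms[OF \<tau>] dec_tree_all_mperms[OF \<sigma>] by (auto simp: all_mperms_def)
  have l: "lookup ((P \<tau> :: _ \<Rightarrow>\<^sub>0 'k) \<otimes>\<^bsub>H\<^esub> P \<sigma>) \<gamma>
      = (if low n \<gamma> \<equiv>ms \<tau> \<and> high n \<gamma> \<equiv>ms \<sigma> then 1 else 0)" for \<gamma>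
  proof -
    have "lookup ((P \<tau> :: _ \<Rightarrow>\<^sub>0 'k) \<otimes>\<^bsub>H\<^esub> P \<sigma>) \<gamma>
      = (\<Sum>\<alpha>\<in>{\<alpha>. \<alpha> \<equiv>ms \<tau>}. \<Sum>\<beta>\<in>{\<beta>. \<beta> \<equiv>ms \<sigma>}. if \<gamma> \<in> shifted_shuffle \<alpha> \<beta> then 1 else 0)"
      by (simp add: lookup_lin_ext lsum_P lookup_fmult)
    also have "\<dots> = (\<Sum>\<alpha>\<in>{\<alpha>. \<alpha> \<equiv>ms \<tau>}. \<Sum>\<beta>\<in>{\<beta>. \<beta> \<equiv>ms \<sigma>}.
        if \<alpha> = low n \<gamma> then if \<beta> = high n \<gamma> then 1 else 0 else 0)"
    proof (intro sum.cong HOL.refl)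
      fix \<alpha> \<beta> assume "\<alpha> \<in> {\<alpha>. \<alpha> \<equiv>ms \<tau>}" "\<beta> \<in> {\<beta>. \<beta> \<equiv>ms \<sigma>}"
      then have "set \<alpha> = {1..n}" "set \<beta> = {1..k}"
        using n metasylv_set mperms_set[OF m] by auto
      from mem_shifted_shuffle_iff[OF this]
      show "(if \<gamma> \<in> shifted_shuffle \<alpha> \<beta> then 1 else 0 :: 'k) =
          (if \<alpha> = low n \<gamma> then if \<beta> = high n \<gamma> then 1 else 0 else 0)" by auto
    qed
    also have "\<dots> = (\<Sum>\<alpha>\<in>{\<alpha>. \<alpha> \<equiv>ms \<tau>}. if \<alpha> = low n \<gamma> then if high n \<gamma> \<equiv>ms \<sigma> then 1 else 0 else 0)"
      by (intro sum.cong HOL.refl) (simp add: finite_class)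
    also have "\<dots> = (if low n \<gamma> \<equiv>ms \<tau> \<and> high n \<gamma> \<equiv>ms \<sigma> then 1 else 0)"
      by (simp add: finite_class)
    finally show ?thesis .
  qed
  have "P \<tau> \<in> carrier H" "P \<sigma> \<in> carrier H"
    using DT_keys[OF P_DT] \<tau> \<sigma> by auto
  then have "keys ((P \<tau> :: _ \<Rightarrow>\<^sub>0 'k) \<otimes>\<^bsub>H\<^esub> P \<sigma>) \<subseteq> all_mperms m"
    using mult_closed by (simp del: FQSym_simps(2))
  moreover have "low n \<gamma> \<equiv>ms \<tau> \<and> high n \<gamma> \<equiv>ms \<sigma> \<longleftrightarrow> low n \<gamma>' \<equiv>ms \<tau> \<and> high n \<gamma>' \<equiv>ms \<sigma>"
    if "\<gamma> \<equiv>ms \<gamma>'" for \<gamma> \<gamma>'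
    using metasylv_low[OF that, of n] metasylv_high[OF that, of n] by (blast intro: metasylv.trans metasylv.sym)
  ultimately show ?thesis unfolding DT_iff l by auto
qed

lemma mult_DT:
  assumes x: "x \<in> DT m" and y: "y \<in> DT m"
  shows "x \<otimes>\<^bsub>H\<^esub> y \<in> DT m"
proof -
  have sub: "free.subspace (DT m :: (_ \<Rightarrow>\<^sub>0 'k) set)"
    unfolding DT_def by (rule free.subspace_span)
  have 1: "x \<in> {x. x \<otimes>\<^bsub>H\<^esub> P \<sigma> \<in> DT m}" if "dec_tree m \<sigma>" for \<sigma>
    using x unfolding DT_def[of m]
  proof (rule subsetD[OF free.span_minimal, rotated 2])
    show "free.subspace {x. x \<otimes>\<^bsub>H\<^esub> P \<sigma> \<in> free.span (P ` {\<tau>. dec_tree m \<tau>})}"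
      unfolding FQSym_simps by (intro subspace_lin_ext_vimage free.subspace_span)
    show "P ` {\<tau>. dec_tree m \<tau>} \<subseteq> {x. x \<otimes>\<^bsub>H\<^esub> P \<sigma> \<in> free.span (P ` {\<tau>. dec_tree m \<tau>})}"
      using P_mult_DT that unfolding DT_def by blast
  qed
  have "y \<in> {y. x \<otimes>\<^bsub>H\<^esub> y \<in> DT m}"
    using y unfolding DT_def[of m]
  proof (rule subsetD[OF free.span_minimal, rotated 2])
    show "free.subspace {y. x \<otimes>\<^bsub>H\<^esub> y \<in> free.span (P ` {\<tau>. dec_tree m \<tau>})}"
      unfolding FQSym_simps lin_ext_swap[of fmult]
      by (intro subspace_lin_ext_vimage free.subspace_span)
    show "P ` {\<tau>. dec_tree m \<tau>} \<subseteq> {y. x \<otimes>\<^bsub>H\<^esub> y \<in> free.span (P ` {\<tau>. dec_tree m \<tau>})}"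
      using 1 unfolding DT_def by blast
  qed
  then show ?thesis by simp
qed

definition coef :: "(nat list \<Rightarrow>\<^sub>0 'k) \<Rightarrow> nat list \<Rightarrow> nat list \<Rightarrow> 'k"
  where "coef x i j = lsum (\<lambda>(a, b). lookup a i * lookup b j) (comult H x)"

definition coef_set :: "(nat list \<Rightarrow>\<^sub>0 'k) \<Rightarrow> nat list \<Rightarrow> nat list \<Rightarrow> (nat list \<times> nat list) set"
  where "coef_set x i j = {(u, v). u @ v \<in> keys x \<and> mword m u \<and> mword m v \<and> pack u = i \<and> pack v = j}"

lemma coef_eq:
  assumes x: "keys x \<subseteq> all_mperms m"
  shows "coef x i j = (\<Sum>(u, v)\<in>coef_set x i j. lookup x (u @ v))"
proof -
  let ?C = "SIGMA \<alpha>:keys x. cuts m \<alpha>"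
  have fin: "finite ?C" by (simp add: finite_cuts)
  have "coef x i j = (\<Sum>\<alpha>\<in>keys x. \<Sum>p\<in>cuts m \<alpha>.
      lookup x \<alpha> * (if pack (fst p) = i \<and> pack (snd p) = j then 1 else 0))"
    unfolding coef_def comult_FQSym[OF m x] lsum_lin_ext lsum_fcomult
    by (simp add: lsum_def case_prod_unfold sum_distrib_left lookup_single when_def)
      (intro sum.cong HOL.refl, auto)
  also have "\<dots> = (\<Sum>q\<in>?C. lookup x (fst q) * (if pack (fst (snd q)) = i \<and> pack (snd (snd q)) = j then 1 else 0))"
    by (subst sum.Sigma) (auto simp: finite_cuts case_prod_unfold)
  also have "\<dots> = (\<Sum>q\<in>{q\<in>?C. pack (fst (snd q)) = i \<and> pack (snd (snd q)) = j}. lookup x (fst q))"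
    using fin by (intro sum.mono_neutral_cong_right) auto
  also have "\<dots> = (\<Sum>p\<in>coef_set x i j. lookup x (fst p @ snd p))"
    by (rule sum.reindex_bij_witness[where i = "\<lambda>p. (fst p @ snd p, p)" and j = snd])
      (auto simp: coef_set_def cuts_def)
  finally show ?thesis by (simp add: case_prod_unfold)
qed

text \<open>Replacing each piece by the word on the same letters that packs to i' or j' is a
  bijection between the contributing cuts. The concatenation stays in its class, where x is
  constant.\<close>

lemma coef_class:
  assumes x: "x \<in> DT m" and ii: "i \<equiv>ms i'" and jj: "j \<equiv>ms j'"
  shows "coef x i j = coef x i' j'"
proof -
  \<comment> \<open>Relabelling keeps the set of letters, which is what allows the replacement to be
    reversed.\<close>
  have undo: "relabel (set (relabel (set u) w)) (pack u) = u" if "pack u \<equiv>ms w" for u w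
    using metasylv_set[OF relabel_metasylv(1)[OF that]] relabel_pack[of u] by simp
  have *: "relabel (set (relabel (set u) i2)) i1 = u" "relabel (set (relabel (set v) j2)) j1 = v"
    "(relabel (set u) i2, relabel (set v) j2) \<in> coef_set x i2 j2"
    "lookup x (relabel (set u) i2 @ relabel (set v) j2) = lookup x (u @ v)"
    if uv: "(u, v) \<in> coef_set x i1 j1" and e: "i1 \<equiv>ms i2" "j1 \<equiv>ms j2" for u v i1 i2 j1 j2
  proof -
    have p: "pack u = i1" "pack v = j1" using uv by (simp_all add: coef_set_def)
    note r = relabel_metasylv[OF e(1)[folded p(1)]] and s = relabel_metasylv[OF e(2)[folded p(2)]]
    show "relabel (set (relabel (set u) i2)) i1 = u" "relabel (set (relabel (set v) j2)) j1 = v"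
      using undo[of u i2] undo[of v j2] p e by simp_all
    show l: "lookup x (relabel (set u) i2 @ relabel (set v) j2) = lookup x (u @ v)"
      by (rule DT_class[OF x metasylv_append[OF r(1) s(1)]])
    show "(relabel (set u) i2, relabel (set v) j2) \<in> coef_set x i2 j2"
      using uv l r(2) s(2) metasylv_mword[OF r(1)] metasylv_mword[OF s(1)]
      by (simp add: coef_set_def in_keys_iff)
  qed
  show ?thesis
    unfolding coef_eq[OF DT_keys[OF x]]
    by (rule sum.reindex_bij_witness[where
          i = "\<lambda>(u, v). (relabel (set u) i, relabel (set v) j)" and
          j = "\<lambda>(u, v). (relabel (set u) i', relabel (set v) j')"])
      (use *[OF _ ii jj] *[OF _ metasylv.sym[OF ii] metasylv.sym[OF jj]] in \<open>auto split: prod.splits\<close>)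
qed

text \<open>The representative is obtained by projecting both tensor factors. It is equivalent to
  the coproduct because projecting replaces the coefficient at i, j by the one at their normal
  forms.\<close>

lemma comult_DT:
  assumes x: "x \<in> DT m"
  shows "\<exists>t. keys t \<subseteq> DT m \<times> DT m \<and> tensor_eq H (comult H x) t"
proof -
  let ?t = "lin_ext (\<lambda>(a, b). tens (tree_pr a) (tree_pr b)) (comult H x)"
  have xc: "x \<in> carrier H" using DT_keys[OF x] by simp
  have kt: "keys ?t \<subseteq> DT m \<times> DT m"
    by (intro order_trans[OF keys_lin_ext] UN_least) (auto simp: tree_pr_DT)
  have "tensor_eq H (comult H x) ?t"
  proof (rule tensor_eqI_lookup)
    show "keys (comult H x) \<subseteq> carrier H \<times> carrier H" by (rule keys_comult[OF xc])
    show "keys ?t \<subseteq> carrier H \<times> carrier H" using kt DT_keys by fastforce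
    fix i j
    have "lsum (\<lambda>(a, b). lookup a i * lookup b j) ?t
        = lsum (\<lambda>(a, b). lookup (tree_pr a) i * lookup (tree_pr b) j) (comult H x)"
      by (simp add: lsum_lin_ext case_prod_unfold)
    also have "\<dots> = coef x i j"
    proof (cases "i \<in> all_mperms m \<and> j \<in> all_mperms m")
      case True
      then have "lsum (\<lambda>(a, b). lookup (tree_pr a) i * lookup (tree_pr b) j) (comult H x) = coef x (nf i) (nf j)"
        by (simp add: lookup_tree_pr coef_def)
      also have "\<dots> = coef x i j"
        using coef_class[OF x nf(2) nf(2), of i j] True by simp
      finally show ?thesis .
    next
      case False
      have "coef x i j = lsum (\<lambda>_. 0) (comult H x)"
        unfolding coef_def
      proof (rule lsum_cong, clarify)
        fix a b assume "(a, b) \<in> keys (comult H x)"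
        then have "keys a \<subseteq> all_mperms m" "keys b \<subseteq> all_mperms m" using keys_comult[OF xc] by auto
        then have "i \<notin> keys a \<or> j \<notin> keys b" using False by blast
        then show "lookup a i * lookup b j = 0" by (auto simp: in_keys_iff)
      qed
      then show ?thesis using False by (auto simp: lookup_tree_pr case_prod_unfold)
    qed
    finally show "lsum (\<lambda>(a, b). lookup a i * lookup b j) (comult H x) = lsum (\<lambda>(a, b). lookup a i * lookup b j) ?t"
      by (simp add: coef_def)
  qed
  then show ?thesis using kt by blast
qed

lemma metasylv_Nil: "\<alpha> \<equiv>ms [] \<Longrightarrow> \<alpha> = []"
  using metasylv_length by fastforce

sublocale graded_hopf_subspace H "all_mperms m" "\<lambda>w. card (set w)" "DT m" tree_pr
proof unfold_locales
  show "free.subspace (DT m :: (_ \<Rightarrow>\<^sub>0 'k) set)" unfolding DT_def by (rule free.subspace_span)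
  show "DT m \<subseteq> carrier H" using DT_keys by auto
  show "\<one>\<^bsub>H\<^esub> \<in> DT m"
    using metasylv_Nil metasylv.sym
    by (auto simp: DT_iff Nil_all_mperms lookup_single when_def)
  show "linear_on H H tree_pr"
    using DT_keys[OF tree_pr_DT]
    by (auto simp: linear_on_def) (simp_all add: tree_pr_def lin_ext_add lin_ext_pscale)
  show "tree_pr x \<in> grade H n" if "x \<in> grade H n" for x n
  proof -
    have "\<alpha> \<in> mperms m n" if "\<alpha> \<in> keys (tree_pr x)" for \<alpha>
    proof -
      have "\<alpha> \<in> all_mperms m" "nf \<alpha> \<in> keys x"
        using that by (auto simp: in_keys_iff lookup_tree_pr split: if_splits)
      then show ?thesis using \<open>x \<in> grade H n\<close> metasylv_mperms[OF nf(2), of \<alpha> m n] by auto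
    qed
    then show ?thesis by auto
  qed
qed (simp_all only: mult_DT comult_DT tree_pr_DT tree_pr_id)

section \<open>The defining ideal as an annihilator\<close>

lemma G_eq_dbasis: "G m \<alpha> = dbasis \<alpha>"
  by (simp add: G_def dbasis_def)

lemma G_closed: "G m \<alpha> \<in> carrier V"
  unfolding G_eq_dbasis by (rule dbasis_closed)

lemma G_D: "x \<in> DT m \<Longrightarrow> G m \<alpha> x = lookup x \<alpha>" for x :: "nat list \<Rightarrow>\<^sub>0 'k"
  using D_carrier[of x] by (simp add: G_def)

lemma diff_G_ms_ideal:
  assumes "\<alpha> \<in> all_mperms m" "\<beta> \<in> all_mperms m" "\<alpha> \<equiv>ms \<beta>"
  shows "G m \<alpha> \<ominus>\<^bsub>V\<^esub> G m \<beta> \<in> ms_ideal m"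
proof -
  let ?R = "{G m \<alpha> \<ominus>\<^bsub>V\<^esub> G m \<beta> | \<alpha> \<beta>. \<alpha> \<in> all_mperms m \<and> \<beta> \<in> all_mperms m \<and> \<alpha> \<equiv>ms \<beta>}"
  have "?R \<subseteq> carrier V" using dual.minus_closed G_closed by auto
  then have "?R \<subseteq> ms_ideal m" unfolding ms_ideal_def by (rule ring.genideal_self[OF dual_ring])
  then show ?thesis using assms by blast
qed

lemma ms_ideal_is_ideal: "ideal (ms_ideal m) V"
  unfolding ms_ideal_def
  by (rule ring.genideal_ideal[OF dual_ring]) (use dual.minus_closed G_closed in auto)

text \<open>The ideal is generated in the ring sense; it absorbs scalars because these act as
  multiplication by multiples of the unit.\<close>

lemma ms_ideal_smult:
  assumes \<phi>: "\<phi> \<in> ms_ideal m"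
  shows "r \<odot>\<^bsub>V\<^esub> \<phi> \<in> ms_ideal m"
proof -
  have \<phi>V: "\<phi> \<in> carrier V" using ideal.Icarr[OF ms_ideal_is_ideal \<phi>] .
  have "r \<odot>\<^bsub>V\<^esub> \<phi> = (r \<odot>\<^bsub>V\<^esub> \<one>\<^bsub>V\<^esub>) \<otimes>\<^bsub>V\<^esub> \<phi>"
    using dual_unital_algebra \<phi>V dual_one_closed unfolding unital_algebra_def
    by (simp only: dual_mult_one)
  also have "\<dots> \<in> ms_ideal m"
    by (rule ideal.I_l_closed[OF ms_ideal_is_ideal \<phi>]) (rule dual.smult_closed[OF dual_one_closed])
  finally show ?thesis .
qed

lemma ms_ideal_leval:
  assumes "\<And>a. a \<in> keys t \<Longrightarrow> f a \<in> ms_ideal m"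
  shows "leval V f t \<in> ms_ideal m"
proof -
  interpret J: ideal "ms_ideal m" V by (rule ms_ideal_is_ideal)
  have "finsum V (\<lambda>a. lookup t a \<odot>\<^bsub>V\<^esub> f a) A \<in> ms_ideal m" if "finite A" "A \<subseteq> keys t" for A
    using that
  proof (induction A rule: finite_induct)
    case empty
    show ?case unfolding J.finsum_empty by (rule additive_subgroup.zero_closed[OF J.additive_subgroup_axioms])
  next
    case (insert a A)
    have *: "lookup t b \<odot>\<^bsub>V\<^esub> f b \<in> ms_ideal m" if "b \<in> insert a A" for b
      using that insert.prems assms by (intro ms_ideal_smult) auto
    have "finsum V (\<lambda>a. lookup t a \<odot>\<^bsub>V\<^esub> f a) (insert a A)
      = lookup t a \<odot>\<^bsub>V\<^esub> f a \<oplus>\<^bsub>V\<^esub> finsum V (\<lambda>a. lookup t a \<odot>\<^bsub>V\<^esub> f a) A"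
      using insert.hyps * J.Icarr by (intro J.finsum_insert) auto
    also have "\<dots> \<in> ms_ideal m"
      using * insert by (intro additive_subgroup.a_closed[OF J.additive_subgroup_axioms]) auto
    finally show ?case .
  qed
  then show ?thesis unfolding leval_def by simp
qed

text \<open>A functional \<phi> that kills the span is the combination of the differences of
  \<open>G m \<alpha>\<close> and \<open>G m (nf \<alpha>)\<close> whose coefficients are the values
  of \<phi> at the \<open>F \<alpha>\<close>. The ring ideal thus coincides with the linear span of
  the relations.\<close>

lemma ms_ideal_eq_ann: "ms_ideal m = ann"
proof
  show "ms_ideal m \<subseteq> ann"
    unfolding ms_ideal_def
  proof (rule ring.genideal_minimal[OF dual_ring ann_ideal], clarify)
    fix \<alpha> \<beta> assume "\<alpha> \<equiv>ms \<beta>"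
    then show "G m \<alpha> \<ominus>\<^bsub>V\<^esub> G m \<beta> \<in> ann"
      by (simp add: ann_def dual.minus_closed dual.crd_minus G_closed G_D DT_class)
  qed
  show "ann \<subseteq> ms_ideal m"
  proof
    fix \<phi> assume \<phi>: "\<phi> \<in> ann"
    note \<phi>V = ann_closed[OF \<phi>]
    have kd: "keys (dcf \<phi>) \<subseteq> all_mperms m"
      by (auto simp: in_keys_iff lookup_dcf[OF \<phi>V] split: if_splits)
    have "leval V (\<lambda>\<alpha>. G m \<alpha> \<ominus>\<^bsub>V\<^esub> G m (nf \<alpha>)) (dcf \<phi>) = \<phi>"
    proof (rule dual.leval_eqI[OF \<phi>V])
      show "G m \<alpha> \<ominus>\<^bsub>V\<^esub> G m (nf \<alpha>) \<in> carrier V" for \<alpha> by (intro dual.minus_closed G_closed)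
      fix x
      show "\<phi> x = lsum (\<lambda>\<alpha>. (G m \<alpha> \<ominus>\<^bsub>V\<^esub> G m (nf \<alpha>)) x) (dcf \<phi>)"
      proof (cases "x \<in> carrier H")
        case True
        have "lsum (\<lambda>\<alpha>. (G m \<alpha> \<ominus>\<^bsub>V\<^esub> G m (nf \<alpha>)) x) (dcf \<phi>)
            = lsum (\<lambda>\<alpha>. G m \<alpha> x - G m (nf \<alpha>) x) (dcf \<phi>)"
          by (simp only: dual.crd_minus G_closed)
        \<comment> \<open>The terms with \<open>nf \<alpha>\<close> add up to the expansion of
          \<phi> at \<open>tree_pr x\<close>, whose coefficient at \<alpha> is that of x at
          \<open>nf \<alpha>\<close>.\<close>
        also have "\<dots> = lsum (\<lambda>\<alpha>. dbasis \<alpha> x) (dcf \<phi>) - lsum (\<lambda>\<alpha>. dbasis \<alpha> (tree_pr x)) (dcf \<phi>)"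
          unfolding lsum_fun_diff[symmetric] using kd True pr_closed[OF True]
          by (intro lsum_cong) (auto simp: dbasis_def G_def lookup_tree_pr)
        also have "\<dots> = \<phi> x - \<phi> (tree_pr x)"
          by (simp only: dual_expand[OF \<phi>V, symmetric])
        also have "\<phi> (tree_pr x) = 0" using \<phi> tree_pr_DT by (simp add: ann_def)
        finally show ?thesis by simp
      next
        case False
        then show ?thesis
          using dual_outside[OF \<phi>V False] dual_outside[OF G_closed False]
          by (simp only: dual.crd_minus G_closed) simp
      qed
    qed
    moreover have "leval V (\<lambda>\<alpha>. G m \<alpha> \<ominus>\<^bsub>V\<^esub> G m (nf \<alpha>)) (dcf \<phi>) \<in> ms_ideal m"
    proof (rule ms_ideal_leval)
      fix \<alpha> assume "\<alpha> \<in> keys (dcf \<phi>)"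
      then have "\<alpha> \<in> all_mperms m" using kd by blast
      then show "G m \<alpha> \<ominus>\<^bsub>V\<^esub> G m (nf \<alpha>) \<in> ms_ideal m"
        using nf[of \<alpha>] dec_tree_all_mperms by (intro diff_G_ms_ideal) auto
    qed
    ultimately show "\<phi> \<in> ms_ideal m" by simp
  qed
qed

section \<open>The quotient and its basis\<close>

lemma quot_eq: "ms_quotient m = Q" and dual_eq: "DT_dual m = W"
  by (simp_all add: ms_quotient_def DT_dual_def ms_ideal_eq_ann)

lemma G_class_eq: "G_class m \<alpha> = ann +>\<^bsub>V\<^esub> G m \<alpha>"
  by (simp add: G_class_def ms_ideal_eq_ann)

lemma Theta_G_class: "x \<in> DT m \<Longrightarrow> \<Theta> (G_class m \<alpha>) x = lookup x \<alpha>" for x :: "nat list \<Rightarrow>\<^sub>0 'k"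
  by (simp add: G_class_eq Theta_coset G_closed res_def G_D)

lemma G_class_metasylv: "\<alpha> \<equiv>ms \<beta> \<Longrightarrow> (G_class m \<alpha> :: ((_ \<Rightarrow>\<^sub>0 'k) \<Rightarrow> 'k) set) = G_class m \<beta>"
  by (simp add: G_class_eq coset_eq_iff G_closed G_D DT_class)

lemma Theta_G_class_P:
  assumes "dec_tree m \<sigma>" "dec_tree m \<tau>"
  shows "\<Theta> (G_class m \<sigma>) (P \<tau>) = (if \<tau> = \<sigma> then 1 else 0)"
proof -
  have "\<sigma> \<equiv>ms \<tau> \<longleftrightarrow> \<tau> = \<sigma>" using dec_tree_unique[OF m assms] metasylv.refl by blast
  then show ?thesis by (simp add: Theta_G_class P_DT assms lookup_P)
qed

lemma inj_G_class: "inj_on (G_class m :: _ \<Rightarrow> ((_ \<Rightarrow>\<^sub>0 'k) \<Rightarrow> 'k) set) {\<tau>. dec_tree m \<tau>}"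
proof (rule inj_onI)
  fix \<sigma> \<tau>
  assume t: "\<sigma> \<in> {\<tau>. dec_tree m \<tau>}" "\<tau> \<in> {\<tau>. dec_tree m \<tau>}"
    and e: "(G_class m \<sigma> :: ((_ \<Rightarrow>\<^sub>0 'k) \<Rightarrow> 'k) set) = G_class m \<tau>"
  have "(if \<tau> = \<sigma> then 1 else 0 :: 'k) = 1"
    using Theta_G_class_P[of \<sigma> \<tau>] Theta_G_class_P[of \<tau> \<tau>] t e by simp
  then show "\<sigma> = \<tau>" by (simp split: if_splits)
qed

text \<open>An element of the span equals its projection, which is an explicit combination of the
  \<open>P \<tau>\<close>.\<close>

lemma functional_on_DT_eq:
  assumes "functional_on H \<phi>" "functional_on H \<psi>" "x \<in> DT m"
    and eq: "\<And>\<tau>. dec_tree m \<tau> \<Longrightarrow> \<phi> (P \<tau>) = \<psi> (P \<tau>)"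
  shows "\<phi> x = \<psi> x"
proof -
  have exp: "\<chi> x = lsum (\<lambda>\<tau>. \<chi> (if dec_tree m \<tau> then P \<tau> else 0)) x" if "functional_on H \<chi>" for \<chi>
  proof -
    have "\<chi> (tree_pr x) = lsum (\<lambda>\<tau>. \<chi> (if dec_tree m \<tau> then P \<tau> else 0)) x"
      unfolding tree_pr_def
      by (rule functional_on_lin_ext[OF that]) (use P_DT D_carrier zero_closed in auto)
    then show ?thesis by (simp add: tree_pr_id assms(3))
  qed
  have "\<chi> 0 = 0" if "functional_on H \<chi>" for \<chi> :: "_ \<Rightarrow> 'k" using functional_on_zero[OF that] by simp
  from this[OF assms(1)] this[OF assms(2)] show ?thesis
    unfolding exp[OF assms(1)] exp[OF assms(2)] using eq by (intro lsum_cong) simp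
qed

text \<open>The coordinate functional of the class of \<tau> is evaluation at
  \<open>P \<tau>\<close>; biorthogonality is the uniqueness of the tree in a class.\<close>

lemma is_basis_G_class: "is_basis Q (G_class m ` {\<tau>. dec_tree m \<tau>})"
proof (rule quot.is_basisI[where c = "\<lambda>\<tau> A. \<Theta> A (P \<tau>)"])
  fix \<tau> \<sigma> assume t: "\<tau> \<in> {\<tau>. dec_tree m \<tau>}"
  show "G_class m \<tau> \<in> carrier Q" by (auto simp: quot_carrier G_class_eq G_closed)
  show "functional_on Q (\<lambda>A. \<Theta> A (P \<tau>))" by (rule quot.functional_on_crd)
  show "\<Theta> (G_class m \<sigma>) (P \<tau>) = (if \<tau> = \<sigma> then 1 else 0)" if "\<sigma> \<in> {\<tau>. dec_tree m \<tau>}"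
    using Theta_G_class_P that t by simp
next
  fix A assume "A \<in> carrier Q"
  then obtain \<phi> where \<phi>: "\<phi> \<in> carrier V" "A = ann +>\<^bsub>V\<^esub> \<phi>" by (auto simp: quot_carrier)
  obtain N where N: "\<forall>n\<ge>N. \<forall>x\<in>grade H n. \<phi> x = 0" using dual_bound[OF \<phi>(1)] by blast
  \<comment> \<open>\<open>P \<tau>\<close> is homogeneous because congruent words have the same
    letter counts, so \<phi> is nonzero only on trees of bounded degree.\<close>
  have "\<phi> (P \<tau>) = 0" if "dec_tree m \<tau>" "\<not> card (set \<tau>) < N" for \<tau>
  proof -
    have "\<tau> \<in> mperms m (card (set \<tau>))"
      using dec_tree_all_mperms[OF that(1)] all_mperms_iff[OF m] by blast
    then have "P \<tau> \<in> grade H (card (set \<tau>))"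
      using metasylv_mperms by (auto simp: in_keys_iff lookup_P split: if_splits)
    then show ?thesis using N that(2) not_less by blast
  qed
  then have "{\<tau> \<in> {\<tau>. dec_tree m \<tau>}. \<Theta> A (P \<tau>) \<noteq> 0} \<subseteq> {\<tau> \<in> all_mperms m. card (set \<tau>) < N}"
    using dec_tree_all_mperms by (auto simp: \<phi>(2) Theta_coset[OF \<phi>(1)] res_def)
  then show "finite {\<tau> \<in> {\<tau>. dec_tree m \<tau>}. \<Theta> A (P \<tau>) \<noteq> 0}"
    using finite_below[of N] by (rule finite_subset)
next
  fix A B assume AB: "A \<in> carrier Q" "B \<in> carrier Q"
    and eq: "\<And>\<tau>. \<tau> \<in> {\<tau>. dec_tree m \<tau>} \<Longrightarrow> \<Theta> A (P \<tau>) = \<Theta> B (P \<tau>)"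
  obtain \<phi> \<psi> where c: "\<phi> \<in> carrier V" "A = ann +>\<^bsub>V\<^esub> \<phi>" "\<psi> \<in> carrier V" "B = ann +>\<^bsub>V\<^esub> \<psi>"
    using AB by (auto simp: quot_carrier)
  have "\<phi> (P \<tau>) = \<psi> (P \<tau>)" if "dec_tree m \<tau>" for \<tau>
    using eq[of \<tau>] that P_DT[OF that] by (simp add: c(2,4) Theta_coset[OF c(1)] Theta_coset[OF c(3)] res_def)
  then have "\<forall>x\<in>DT m. \<phi> x = \<psi> x"
    using functional_on_DT_eq[OF dual_functional[OF c(1)] dual_functional[OF c(3)]] by blast
  then show "A = B" unfolding c(2,4) coset_eq_iff[OF c(1,3)] .
qed

lemma quot_iso_restrict:
  "\<phi> \<in> carrier V \<Longrightarrow> \<Theta> (ann +>\<^bsub>V\<^esub> \<phi>) = (\<lambda>x. if x \<in> DT m then \<phi> x else 0)"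
  by (simp add: Theta_coset res_def)

end

theorem theorem4p14:
  fixes m :: nat
  assumes "m \<ge> 1"
  shows
    "hopf_subalgebra (DT m) (FQSym m :: ('k::field_char_0, nat list \<Rightarrow>\<^sub>0 'k) hopf) \<and>
     hopf_ideal (ms_ideal m :: ((nat list \<Rightarrow>\<^sub>0 'k) \<Rightarrow> 'k) set) (graded_dual (FQSym m)) \<and>
     (\<exists>\<Theta>. graded_hopf_iso
            (ms_quotient m :: ('k, ((nat list \<Rightarrow>\<^sub>0 'k) \<Rightarrow> 'k) set) hopf) (DT_dual m) \<Theta> \<and>
          (\<forall>\<phi>\<in>carrier (graded_dual (FQSym m)).
             \<Theta> (ms_ideal m +>\<^bsub>graded_dual (FQSym m)\<^esub> \<phi>) = (\<lambda>x. if x \<in> DT m then \<phi> x else 0))) \<and>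
     (\<forall>\<tau> \<alpha>. dec_tree m \<tau> \<longrightarrow> \<alpha> \<equiv>ms \<tau> \<longrightarrow>
        (G_class m \<alpha> :: ((nat list \<Rightarrow>\<^sub>0 'k) \<Rightarrow> 'k) set) = G_class m \<tau>) \<and>
     inj_on (G_class m :: nat list \<Rightarrow> ((nat list \<Rightarrow>\<^sub>0 'k) \<Rightarrow> 'k) set) {\<tau>. dec_tree m \<tau>} \<and>
     is_basis (ms_quotient m :: ('k, ((nat list \<Rightarrow>\<^sub>0 'k) \<Rightarrow> 'k) set) hopf)
       (G_class m ` {\<tau>. dec_tree m \<tau>})"
proof -
  interpret m_permutations m "TYPE('k)" by unfold_locales (rule assms)
  show ?thesis
    unfolding quot_eq dual_eq ms_ideal_eq_ann
    using hopf_subalgebra hopf_ideal_ann quot_iso quot_iso_restrict G_class_metasylv inj_G_class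
      is_basis_G_class by blast
qed

end
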